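(* For $d\in\mathbb{N}$ let $G=\{0,1\}^d$ be the hypercube graph, with vertex set $V=\{0,1\}^d$, $n=2^d=|V|$, and let $(\eta_t)_{t\ge 0}$ be the averaging process on $G$. Let $\pi\equiv 1/n$ be the uniform distribution on $V$ and let $$T(a):=\tfrac12\log d+a,\qquad a\in\mathbb{R}.$$ Then (with $n=2^d\to\infty$, i.e. $d\to\infty$) $$\lim_{a\to\infty}\limsup_{n\to\infty}\sup_{\xi\in\Delta(V)}\mathbb{E}_\xi\left[\left\|\frac{\eta_{T(a)}}{\pi}-1\right\|_p^p\right]=0,\qquad p=1,2,$$ and $$\lim_{a\to-\infty}\liminf_{n\to\infty}\sup_{\xi\in\Delta(V)}\mathbb{E}_\xi\left[\left\|\frac{\eta_{T(a)}}{\pi}-1\right\|_p^p\right]=\begin{cases}2&\text{if }p=1,\\ +\infty&\text{if }p=2.\end{cases}$$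
   Context: The hypercube graph has vertex set $\{0,1\}^d$, with two vertices joined by an edge iff they differ in exactly one coordinate. For a finite connected graph $G=(V,E)$, let $\Delta(V)$ be the set of probability mass functions on $V$. The averaging process on $G$ is the continuous-time Markov process $(\eta_t)_{t\ge0}$ on $\Delta(V)$ in which each edge $xy\in E$ carries an independent Poisson clock of rate $1$; when the clock of $xy$ rings, both $\eta(x)$ and $\eta(y)$ are replaced by $\frac12(\eta(x)+\eta(y))$, the other values being unchanged. $\mathbb{E}_\xi$ is the expectation when $\eta_0=\xi\in\Delta(V)$. For $f:V\to\mathbb{R}$, $\|f\|_p=\big(\sum_{x\in V}\pi(x)|f(x)|^p\big)^{1/p}$ is the $L^p(\pi)$-norm, and $\eta/\pi$ denotes the function $x\mapsto\eta(x)/\pi(x)=n\,\eta(x)$. For fixed $a$, $T(a)\geq 0$ for all $d$ large enough. $\log$ is the natural logarithm. *)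

theory Defs
  imports "HOL-Probability.Probability"
begin

section \<open>Poisson clocks\<close>

definition poisson_process :: "'a measure \<Rightarrow> real \<Rightarrow> (real \<Rightarrow> 'a \<Rightarrow> nat) \<Rightarrow> bool" where
  "poisson_process M r N \<longleftrightarrow>
     (\<forall>t\<ge>0. N t \<in> measurable M (count_space UNIV)) \<and>
     (AE \<omega> in M. N 0 \<omega> = 0 \<and> mono_on {0..} (\<lambda>t. N t \<omega>) \<and>
                 (\<forall>t\<ge>0. continuous (at_right t) (\<lambda>s. N s \<omega>))) \<and>
     (\<forall>s t. 0 \<le> s \<and> s < t \<longrightarrow>
        distr M (count_space UNIV) (\<lambda>\<omega>. N t \<omega> - N s \<omega>) = measure_pmf (poisson_pmf (r * (t - s)))) \<and>
     (\<forall>(\<tau> :: nat \<Rightarrow> real) k. 0 \<le> \<tau> 0 \<and> mono \<tau> \<longrightarrow>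
        prob_space.indep_vars M (\<lambda>_. count_space UNIV)
          (\<lambda>i \<omega>. N (\<tau> (Suc i)) \<omega> - N (\<tau> i) \<omega>) {..<k})"

text \<open>A family of processes is independent when their whole paths are, the paths being
  random elements of the product space over the time set \<open>{0..}\<close>.\<close>

definition independent_poisson_clocks ::
    "'a measure \<Rightarrow> 'e set \<Rightarrow> ('e \<Rightarrow> real \<Rightarrow> 'a \<Rightarrow> nat) \<Rightarrow> bool" where
  "independent_poisson_clocks M E N \<longleftrightarrow>
     (\<forall>e\<in>E. poisson_process M 1 (N e)) \<and>
     prob_space.indep_vars M (\<lambda>_. PiM {0..} (\<lambda>_. count_space UNIV))
       (\<lambda>e \<omega>. \<lambda>t\<in>{0..}. N e t \<omega>) E"

text \<open>For a nondecreasing counting path \<open>c\<close> with values in the natural numbers, this says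
  \<open>c(t-) < c(t)\<close>.\<close>

definition rings_at :: "(real \<Rightarrow> nat) \<Rightarrow> real \<Rightarrow> bool" where
  "rings_at c t \<longleftrightarrow> 0 < t \<and> (\<forall>s\<in>{0..<t}. c s < c t)"

section \<open>The averaging process\<close>

text \<open>Mass functions on a finite vertex set are extended by \<open>0\<close> off that set.\<close>

definition mass_functions :: "'v set \<Rightarrow> ('v \<Rightarrow> real) set" where
  "mass_functions V = {\<xi>. (\<forall>x\<in>V. 0 \<le> \<xi> x) \<and> (\<forall>x. x \<notin> V \<longrightarrow> \<xi> x = 0) \<and> (\<Sum>x\<in>V. \<xi> x) = 1}"

text \<open>An edge \<open>e\<close> is the two-element set of its end points.\<close>

definition average_edge :: "'v set \<Rightarrow> ('v \<Rightarrow> real) \<Rightarrow> 'v \<Rightarrow> real" where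
  "average_edge e \<eta> = (\<lambda>z. if z \<in> e then (\<Sum>x\<in>e. \<eta> x) / 2 else \<eta> z)"

text \<open>\<open>\<eta>\<close> is an averaging process on the graph \<open>(V, E)\<close> started from \<open>\<xi>\<close>: it stays constant
  over any time interval in which no clock rings, and when the clock of an edge rings at
  time \<open>t\<close>, the state just before \<open>t\<close> is averaged over that edge. Almost surely no two clocks
  ring simultaneously and only finitely many rings occur in bounded time, so the clocks
  determine the path of \<open>\<eta>\<close> on \<open>{0..}\<close>. Times \<open>t < 0\<close> are not constrained.\<close>

definition averaging_process ::
    "'v set \<Rightarrow> 'v set set \<Rightarrow> ('v \<Rightarrow> real) \<Rightarrow> 'a measure \<Rightarrow> (real \<Rightarrow> 'a \<Rightarrow> 'v \<Rightarrow> real) \<Rightarrow> bool" where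
  "averaging_process V E \<xi> M \<eta> \<longleftrightarrow>
     prob_space M \<and>
     (\<forall>t\<ge>0. \<forall>x\<in>V. (\<lambda>\<omega>. \<eta> t \<omega> x) \<in> borel_measurable M) \<and>
     (\<exists>N. independent_poisson_clocks M E N \<and>
        (AE \<omega> in M.
           \<eta> 0 \<omega> = \<xi> \<and>
           (\<forall>s t. 0 \<le> s \<and> s < t \<and>
              (\<forall>e\<in>E. \<forall>u\<in>{s<..t}. \<not> rings_at (\<lambda>r. N e r \<omega>) u) \<longrightarrow> \<eta> t \<omega> = \<eta> s \<omega>) \<and>
           (\<forall>t. \<forall>e\<in>E. rings_at (\<lambda>r. N e r \<omega>) t \<longrightarrow>
              (\<forall>\<^sub>F s in at_left t. \<eta> t \<omega> = average_edge e (\<eta> s \<omega>)))))"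

definition Lp_norm :: "'v set \<Rightarrow> ('v \<Rightarrow> real) \<Rightarrow> real \<Rightarrow> ('v \<Rightarrow> real) \<Rightarrow> real" where
  "Lp_norm V \<pi> p f = (\<Sum>x\<in>V. \<pi> x * \<bar>f x\<bar> powr p) powr (1 / p)"

section \<open>The hypercube\<close>

definition cube :: "nat \<Rightarrow> (nat \<Rightarrow> nat) set" where
  "cube d = {..<d} \<rightarrow>\<^sub>E {0, 1}"

definition cube_edges :: "nat \<Rightarrow> (nat \<Rightarrow> nat) set set" where
  "cube_edges d = {{x, y} | x y. x \<in> cube d \<and> y \<in> cube d \<and> card {i \<in> {..<d}. x i \<noteq> y i} = 1}"

definition uniform_mass :: "'v set \<Rightarrow> 'v \<Rightarrow> real" where
  "uniform_mass V x = 1 / real (card V)"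

definition cutoff_time :: "nat \<Rightarrow> real \<Rightarrow> real" where
  "cutoff_time d a = 1 / 2 * ln (real d) + a"

end

theory Submission
  imports Defs "HOL-Real_Asymp.Real_Asymp"
begin

text \<open>Cut \<open>[0, t]\<close> into \<open>m\<close> intervals and average over an edge exactly when its clock rings once and
  no other clock rings during an interval. This chain agrees with the averaging process up to
  an event of probability \<open>O(1 / m)\<close>, and its expectations are powers of an explicit operator, so
  expectations of the process are limits of such powers.

  On the cube the operator is diagonal on the Fourier coefficients \<open>f(S) = (\<Sum>x. \<eta> x * chi S x)\<close>,
  which gives \<open>E f(S) = exp (- |S| t)\<close> from a point mass. The lower bounds follow: by Jensen's
  inequality the squared \<open>L\<^sup>2\<close> distance is at least \<open>d * exp (- 2 t)\<close>, and the sum of the singleton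
  characters separates the two laws in \<open>L\<^sup>1\<close>.

  For the upper bound, the second moments \<open>U(S) = E f(S)\<^sup>2\<close> satisfy the closed cooperative system
  \<open>U(S)' = - 2 |S| U(S) + (2 / 2 ^ d) * (\<Sum>i\<in>S. \<Sum>R\<ni>i. U(R))\<close>. Compared with supersolutions depending only
  on \<open>|S|\<close>, the coupling becomes of order \<open>2 ^ (- d)\<close>, up to a factor \<open>exp (O(\<theta>) d)\<close> with \<open>\<theta>\<close> small,
  after a time that does not depend on \<open>d\<close>; from then on \<open>U(S) \<le> \<theta> ^ |S|\<close> up to an error summable
  over all \<open>S\<close>, where \<open>\<theta>\<close> decays like \<open>exp (- 2 t)\<close>. At time \<open>ln d / 2 + a\<close> the sum of \<open>U(S)\<close> over
  \<open>S \<noteq> {}\<close>, the squared \<open>L\<^sup>2\<close> distance, is then bounded in terms of \<open>exp (- a)\<close>.\<close>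


section \<open>Discretised averaging\<close>

text \<open>The obstacle for the upper bound is the feedback. From a point mass every
  \<open>U(S)\<close> starts at \<open>1\<close>, and the mean of \<open>U\<close> over the sets
  containing \<open>i\<close> is then of order one. An additive error in the bound on
  \<open>U(S)\<close> is finally summed over \<open>2 ^ d\<close> sets, so it must end up far below
  \<open>2 ^ (- d)\<close>; a bound on the feedback by a small constant would be useless. Hence the
  Chernoff-type supersolution, which takes the feedback down to \<open>excess d (exp (- 6))\<close>.
  From there the error \<open>excess d \<theta>\<close> has to shrink together with
  \<open>\<theta>\<close>, faster than the equation for small \<open>|S|\<close> provides. The
  deficit is paid by slowing \<open>\<theta>\<close> down by the factor \<open>1 - 1 / d\<close>,
  which costs a bounded factor at time \<open>ln d / 2 + a\<close>. For this payment
  \<open>\<theta> ^ j\<close> must dominate \<open>excess d \<theta>\<close> for all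
  \<open>j\<close> up to \<open>4 * (1 + d * \<theta>)\<close>, and \<open>exp (- 6)\<close> is a
  starting value small enough: \<open>4 * \<theta> * ln (1 / \<theta>) \<le> 1 / 2 < ln 2\<close>
  for \<open>\<theta>\<close> below it.\<close>

definition single_ring :: "'e set \<Rightarrow> ('e \<Rightarrow> nat) \<Rightarrow> 'e \<Rightarrow> bool" where
  "single_ring E n e \<longleftrightarrow> e \<in> E \<and> (\<forall>e'\<in>E. n e' = (if e' = e then 1 else 0))"

text \<open>At most one summand survives. The sum over \<open>E\<close> lets measurability and
  expectations be treated edge by edge, with no choice of the ringing edge.\<close>

definition avg_step :: "'v set set \<Rightarrow> ('v set \<Rightarrow> nat) \<Rightarrow> ('v \<Rightarrow> real) \<Rightarrow> 'v \<Rightarrow> real" where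
  "avg_step E n \<eta> = (\<lambda>x. \<eta> x + (\<Sum>e\<in>E. if single_ring E n e then average_edge e \<eta> x - \<eta> x else 0))"

text \<open>Intervals with more than one ring are ignored.\<close>

primrec avg_chain :: "'v set set \<Rightarrow> ('v \<Rightarrow> real) \<Rightarrow> ('v set \<times> nat \<Rightarrow> nat) \<Rightarrow> nat \<Rightarrow> 'v \<Rightarrow> real" where
  "avg_chain E \<xi> D 0 = \<xi>"
| "avg_chain E \<xi> D (Suc i) = avg_step E (\<lambda>e. D (e, i)) (avg_chain E \<xi> D i)"

text \<open>An explicit Euler step \<open>1 + h * L\<close> for the generator \<open>L\<close> of
  the averaging process, acting on observables.\<close>

definition avg_op :: "'v set set \<Rightarrow> real \<Rightarrow> (('v \<Rightarrow> real) \<Rightarrow> real) \<Rightarrow> ('v \<Rightarrow> real) \<Rightarrow> real" where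
  "avg_op E h F = (\<lambda>\<eta>. F \<eta> + h * (\<Sum>e\<in>E. F (average_edge e \<eta>) - F \<eta>))"

text \<open>Indexed by pairs of an edge and an interval, so that independence over edges and over
  time is one statement about one family.\<close>

definition clock_increment :: "('e \<Rightarrow> real \<Rightarrow> 'a \<Rightarrow> nat) \<Rightarrow> real \<Rightarrow> 'a \<Rightarrow> 'e \<times> nat \<Rightarrow> nat" where
  "clock_increment N h \<omega> = (\<lambda>(e, i). N e (h * real (Suc i)) \<omega> - N e (h * real i) \<omega>)"

lemma single_ring_unique: "single_ring E n e \<Longrightarrow> single_ring E n e' \<Longrightarrow> e = e'"
  unfolding single_ring_def by (metis zero_neq_one)

lemma sum_single_ring:
  fixes f :: "'e \<Rightarrow> real"
  assumes "finite E" "single_ring E n e"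
  shows "(\<Sum>e'\<in>E. if single_ring E n e' then f e' else 0) = f e"
proof -
  have "(\<Sum>e'\<in>E. if single_ring E n e' then f e' else 0) = (\<Sum>e'\<in>E. if e' = e then f e' else 0)"
    using assms(2) by (intro sum.cong refl if_cong) (auto dest: single_ring_unique)
  then show ?thesis
    using assms by (simp add: single_ring_def)
qed

lemma avg_step_single:
  "finite E \<Longrightarrow> single_ring E n e \<Longrightarrow> avg_step E n \<eta> = average_edge e \<eta>"
  by (simp add: avg_step_def sum_single_ring)

lemma avg_step_none:
  "(\<And>e. \<not> single_ring E n e) \<Longrightarrow> avg_step E n \<eta> = \<eta>"
  by (simp add: avg_step_def)

text \<open>Nonlinear \<open>F\<close> are covered because at most one edge is active in a step;
  squares of Fourier coefficients depend on this.\<close>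

lemma fun_avg_step:
  fixes F :: "('v \<Rightarrow> real) \<Rightarrow> real"
  assumes "finite E"
  shows "F (avg_step E n \<eta>) =
    F \<eta> + (\<Sum>e\<in>E. if single_ring E n e then F (average_edge e \<eta>) - F \<eta> else 0)"
proof (cases "\<exists>e. single_ring E n e")
  case True
  then obtain e where "single_ring E n e" ..
  then show ?thesis using assms by (simp add: sum_single_ring avg_step_single)
next
  case False
  then show ?thesis by (simp add: avg_step_none)
qed

section \<open>The averaging path over one interval\<close>

lemma unit_jump_time:
  fixes c :: "real \<Rightarrow> nat"
  assumes "0 \<le> s" "s < t" and mono: "mono_on {0..} c"
    and cont: "\<And>r. 0 \<le> r \<Longrightarrow> continuous (at_right r) c"
    and jump: "c t = Suc (c s)"
  obtains u where "s < u" "u \<le> t" "\<And>r. s \<le> r \<Longrightarrow> r < u \<Longrightarrow> c r = c s"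
    "\<And>r. u \<le> r \<Longrightarrow> r \<le> t \<Longrightarrow> c r = c t"
proof -
  define A where "A = {r. s \<le> r \<and> r \<le> t \<and> c r = c t}"
  define u where "u = Inf A"
  have A: "t \<in> A" "bdd_below A" "\<And>r. r \<in> A \<Longrightarrow> s \<le> r"
    using assms by (auto simp: A_def intro!: bdd_belowI[of _ s])
  have u: "s \<le> u" "u \<le> t"
    unfolding u_def using A by (auto intro!: cInf_greatest cInf_lower)
  have dich: "c r = c s \<or> c r = c t" if "s \<le> r" "r \<le> t" for r
    using mono_onD[OF mono, of s r] mono_onD[OF mono, of r t] that assms by (auto simp: le_Suc_eq)
  have after: "c r = c t" if "u < r" "r \<le> t" for r
  proof -
    obtain r' where "r' \<in> A" "r' < r"
      using \<open>u < r\<close> A cInf_less_iff[of A r] unfolding u_def by auto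
    then have "c t \<le> c r" using mono_onD[OF mono, of r' r] assms by (auto simp: A_def)
    then show ?thesis using mono_onD[OF mono, of r t] that u assms by auto
  qed
  \<comment> \<open>Right-continuity at the infimum \<open>u\<close>: it makes \<open>c\<close> take
    its final value at \<open>u\<close> itself and not only after \<open>u\<close>.\<close>
  have right: "eventually (\<lambda>r. c r = c u) (at_right u)"
    using cont[of u] u assms by (auto simp: continuous_within tendsto_discrete)
  have at_u: "c u = c t"
  proof (cases "u = t")
    case False
    then have "eventually (\<lambda>r. r \<in> {u<..<t}) (at_right u)"
      using u by (intro eventually_at_right_real) auto
    with right have "eventually (\<lambda>r. c r = c u \<and> r \<in> {u<..<t}) (at_right u)"
      by eventually_elim auto
    then obtain r where "c r = c u" "u < r" "r < t"
      using eventually_happens[of _ "at_right u"] trivial_limit_at_right_real by auto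
    then show ?thesis using after[of r] by simp
  qed simp
  show thesis
  proof
    show "s < u" using at_u jump u by (cases "s = u") auto
    show "u \<le> t" by fact
    show "c r = c s" if "s \<le> r" "r < u" for r
      using that dich[of r] u A(2) cInf_lower[of r A] by (auto simp: u_def A_def)
    show "c r = c t" if "u \<le> r" "r \<le> t" for r
      using that after[of r] at_u by (cases "u = r") auto
  qed
qed

text \<open>If exactly one clock rings, say at \<open>u\<close>, the path is frozen on both sides of
  \<open>u\<close>: the state just before \<open>u\<close> is the one at \<open>s\<close>, and the
  state at \<open>u\<close> is kept until \<open>t\<close>. With no ring the path is frozen
  throughout.\<close>

lemma averaging_path_interval:
  fixes g :: "real \<Rightarrow> 'v \<Rightarrow> real" and N :: "'v set \<Rightarrow> real \<Rightarrow> nat"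
  assumes st: "0 \<le> s" "s < t" and "finite E"
    and mono: "\<And>e. e \<in> E \<Longrightarrow> mono_on {0..} (N e)"
    and cont: "\<And>e r. e \<in> E \<Longrightarrow> 0 \<le> r \<Longrightarrow> continuous (at_right r) (N e)"
    and const: "\<And>s t. 0 \<le> s \<Longrightarrow> s < t \<Longrightarrow> (\<forall>e\<in>E. \<forall>u\<in>{s<..t}. \<not> rings_at (N e) u) \<Longrightarrow> g t = g s"
    and ring: "\<And>t e. e \<in> E \<Longrightarrow> rings_at (N e) t \<Longrightarrow> (\<forall>\<^sub>F s in at_left t. g t = average_edge e (g s))"
    and few: "(\<forall>e\<in>E. N e t - N e s = 0) \<or> (\<exists>e. single_ring E (\<lambda>e. N e t - N e s) e)"
  shows "g t = avg_step E (\<lambda>e. N e t - N e s) (g s)"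
proof -
  have no_ring: "\<not> rings_at (N e) u" if "a < u" "u \<le> b" "0 \<le> a" "N e a = N e b" "e \<in> E" for e a b u
  proof -
    have "N e u \<le> N e a" using mono_onD[OF mono[OF \<open>e \<in> E\<close>], of u b] that by auto
    moreover have "N e a < N e u" if "rings_at (N e) u"
      using that \<open>a < u\<close> \<open>0 \<le> a\<close> by (auto simp: rings_at_def)
    ultimately show ?thesis by auto
  qed
  show ?thesis
  proof (cases "\<exists>e. single_ring E (\<lambda>e. N e t - N e s) e")
    case False
    then have "\<forall>e\<in>E. N e s = N e t"
      using few mono_onD[OF mono, of _ s t] st by fastforce
    then have "\<forall>e\<in>E. \<forall>u\<in>{s<..t}. \<not> rings_at (N e) u"
      using no_ring[of s _ t] st by simp
    then have "g t = g s" using st by (intro const)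
    then show ?thesis using False by (simp add: avg_step_none)
  next
    case True
    then obtain e where e: "single_ring E (\<lambda>e. N e t - N e s) e" ..
    then have "e \<in> E" and "N e t = Suc (N e s)"
      by (auto simp: single_ring_def split: if_splits)
    have others: "N e' s = N e' t" if "e' \<in> E" "e' \<noteq> e" for e'
    proof -
      have "N e' t - N e' s = 0" using e that by (auto simp: single_ring_def)
      then show ?thesis using mono_onD[OF mono[OF \<open>e' \<in> E\<close>], of s t] st by auto
    qed
    obtain u where u: "s < u" "u \<le> t" "\<And>r. s \<le> r \<Longrightarrow> r < u \<Longrightarrow> N e r = N e s"
        "\<And>r. u \<le> r \<Longrightarrow> r \<le> t \<Longrightarrow> N e r = N e t"
      using unit_jump_time[OF st mono[OF \<open>e \<in> E\<close>] cont[OF \<open>e \<in> E\<close>] \<open>N e t = Suc (N e s)\<close>] by metis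
    have others': "N e' a = N e' b" if "e' \<in> E" "e' \<noteq> e" "s \<le> a" "a \<le> b" "b \<le> t" for e' a b
      using others[OF that(1,2)] mono_onD[OF mono[OF that(1)], of s a] mono_onD[OF mono[OF that(1)], of a b]
        mono_onD[OF mono[OF that(1)], of b t] that st by auto
    have before: "g r = g s" if "s < r" "r < u" for r
    proof (rule const)
      show "\<forall>e'\<in>E. \<forall>v\<in>{s<..r}. \<not> rings_at (N e') v"
      proof (intro ballI)
        fix e' v assume "e' \<in> E" "v \<in> {s<..r}"
        moreover have "N e' s = N e' r"
          using \<open>e' \<in> E\<close> others'[of e' s r] u(2) u(3)[of r] that by (cases "e' = e") auto
        ultimately show "\<not> rings_at (N e') v" using no_ring[of s v r e'] st by auto
      qed
    qed (use that st in auto)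
    have "N e r < N e u" if "0 \<le> r" "r < u" for r
    proof -
      have "N e u = Suc (N e s)" using u(2) u(4)[of u] \<open>N e t = Suc (N e s)\<close> by simp
      moreover have "N e r \<le> N e s"
        using that st mono_onD[OF mono[OF \<open>e \<in> E\<close>], of r s] u(3)[of r] by (cases "s \<le> r") simp_all
      ultimately show ?thesis by simp
    qed
    then have "rings_at (N e) u" using u(1) st(1) by (auto simp: rings_at_def)
    then have "\<forall>\<^sub>F r in at_left u. g u = average_edge e (g r)" by (rule ring[OF \<open>e \<in> E\<close>])
    moreover have "\<forall>\<^sub>F r in at_left u. r \<in> {s<..<u}"
      using u(1) by (intro eventually_at_left_real) auto
    ultimately have "\<forall>\<^sub>F r in at_left u. g u = average_edge e (g s)"
      by eventually_elim (use before in auto)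
    then have gu: "g u = average_edge e (g s)"
      by (simp add: eventually_const_iff trivial_limit_at_left_real)
    have "g t = g u"
    proof (cases "u = t")
      case False
      show ?thesis
      proof (rule const)
        show "\<forall>e'\<in>E. \<forall>v\<in>{u<..t}. \<not> rings_at (N e') v"
        proof safe
          fix e' v assume "e' \<in> E" "v \<in> {u<..t}" "rings_at (N e') v"
          moreover have "N e' u = N e' t"
            using \<open>e' \<in> E\<close> others'[of e' u t] u(1,2) u(4)[of u] by (cases "e' = e") auto
          ultimately show False using no_ring[of u v t e'] u(1,2) st by auto
        qed
      qed (use False u(1,2) st in auto)
    qed simp
    then show ?thesis using gu e \<open>finite E\<close> by (simp add: avg_step_single)
  qed
qed

section \<open>Joint law of the clock increments\<close>

lemma (in prob_space) indep_clock_increments: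
  assumes clk: "independent_poisson_clocks M E N" and E: "finite E" "E \<noteq> {}" and h: "0 < h"
  shows "indep_vars (\<lambda>_. count_space UNIV) (\<lambda>k \<omega>. clock_increment N h \<omega> k) (E \<times> {..<m})"
\<comment> \<open>The finite product rule for independent variables asks for a nonempty index
  set.\<close>
proof (cases "m = 0")
  case True
  then show ?thesis by (simp add: indep_vars_def2 indep_sets_def)
next
  case False
  let ?X = "\<lambda>k \<omega>. clock_increment N h \<omega> k"
  let ?C = "\<lambda>_. count_space UNIV :: nat measure"
  have pp: "poisson_process M 1 (N e)" if "e \<in> E" for e
    using clk that by (auto simp: independent_poisson_clocks_def)
  have N[measurable]: "N e t \<in> measurable M (count_space UNIV)" if "e \<in> E" "0 \<le> t" for e t
    using pp[OF that(1)] that by (auto simp: poisson_process_def)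
  have rv: "random_variable (count_space UNIV) (?X k)" if "k \<in> E \<times> {..<m}" for k
  proof -
    obtain e i where k: "k = (e, i)" "e \<in> E" using \<open>k \<in> E \<times> {..<m}\<close> by auto
    have 1: "N e (h * real j) \<in> measurable M (count_space UNIV)" for j
      using h k by (intro N) auto
    show ?thesis
      unfolding clock_increment_def k prod.case
      by (rule measurable_compose_countable[where f="\<lambda>n c. n - N e (h * real i) c" and g="N e (h * real (Suc i))", OF _ 1])
        (rule measurable_compose[OF 1], simp)
  qed
  have time_indep: "indep_vars (\<lambda>_. count_space UNIV) (\<lambda>i \<omega>. ?X (e, i) \<omega>) {..<m}" if "e \<in> E" for e
  proof -
    have "0 \<le> h * real 0 \<and> mono (\<lambda>i. h * real i)" using h by (auto simp: mono_def)
    moreover have "\<forall>(\<tau> :: nat \<Rightarrow> real) k. 0 \<le> \<tau> 0 \<and> mono \<tau> \<longrightarrow>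
        indep_vars (\<lambda>_. count_space UNIV) (\<lambda>i \<omega>. N e (\<tau> (Suc i)) \<omega> - N e (\<tau> i) \<omega>) {..<k}"
      using pp[OF that] unfolding poisson_process_def by (elim conjE)
    ultimately have "indep_vars (\<lambda>_. count_space UNIV)
        (\<lambda>i \<omega>. N e (h * real (Suc i)) \<omega> - N e (h * real i) \<omega>) {..<m}"
      by (elim allE[of _ "\<lambda>i. h * real i"] allE[of _ m] mp)
    then show ?thesis unfolding clock_increment_def prod.case .
  qed
  have paths: "indep_vars (\<lambda>_. PiM {0..} ?C) (\<lambda>e \<omega>. \<lambda>t\<in>{0..}. N e t \<omega>) E"
    using clk by (simp add: independent_poisson_clocks_def)
  \<comment> \<open>Two layers of independence: a condition on all increments of the clock of
    \<open>e\<close> is an event \<open>B e\<close> about its whole path, so the probability factors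
    first over the clocks and then, for each clock, over the intervals.\<close>
  have "prob (\<Inter>k\<in>E \<times> {..<m}. ?X k -` A k \<inter> space M) = (\<Prod>k\<in>E \<times> {..<m}. prob (?X k -` A k \<inter> space M))"
    for A :: "'b \<times> nat \<Rightarrow> nat set"
  proof -
    define B where "B e = {c \<in> space (PiM {0..} ?C). \<forall>i<m. c (h * real (Suc i)) - c (h * real i) \<in> A (e, i)}" for e
    have [measurable]: "(\<lambda>c. c (h * real i)) \<in> measurable (PiM {0..} ?C) (count_space UNIV)" for i
      using h by (intro measurable_component_singleton) auto
    have B: "B e \<in> sets (PiM {0..} ?C)" for e
    proof -
      have [measurable]: "(\<lambda>c. c (h * real (Suc i)) - c (h * real i)) \<in> measurable (PiM {0..} ?C) (count_space UNIV)" for i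
        by (rule measurable_compose_countable[where f="\<lambda>n c. n - c (h * real i)" and g="\<lambda>c. c (h * real (Suc i))"])
          (rule measurable_compose[of "\<lambda>c. c (h * real i)" _ "count_space UNIV"], use h in \<open>auto intro!: measurable_component_singleton\<close>)
      show ?thesis unfolding B_def by measurable
    qed
    have eq: "(\<lambda>\<omega>. \<lambda>t\<in>{0..}. N e t \<omega>) -` B e \<inter> space M = (\<Inter>i\<in>{..<m}. ?X (e, i) -` A (e, i) \<inter> space M)"
      if "e \<in> E" for e
      using h False by (auto simp: B_def space_PiM clock_increment_def)
    have "(\<Inter>k\<in>E \<times> {..<m}. ?X k -` A k \<inter> space M) = (\<Inter>e\<in>E. (\<lambda>\<omega>. \<lambda>t\<in>{0..}. N e t \<omega>) -` B e \<inter> space M)"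
      using E(2) by (auto simp: eq)
    also have "prob \<dots> = (\<Prod>e\<in>E. prob ((\<lambda>\<omega>. \<lambda>t\<in>{0..}. N e t \<omega>) -` B e \<inter> space M))"
      by (rule indep_varsD_finite[OF paths E(2) E(1)]) (rule B)
    also have "\<dots> = (\<Prod>e\<in>E. \<Prod>i<m. prob (?X (e, i) -` A (e, i) \<inter> space M))"
    proof (rule prod.cong[OF refl])
      fix e assume "e \<in> E"
      show "prob ((\<lambda>\<omega>. \<lambda>t\<in>{0..}. N e t \<omega>) -` B e \<inter> space M) = (\<Prod>i<m. prob (?X (e, i) -` A (e, i) \<inter> space M))"
        unfolding eq[OF \<open>e \<in> E\<close>]
        by (rule indep_varsD_finite[OF time_indep[OF \<open>e \<in> E\<close>]]) (use False in auto)
    qed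
    also have "\<dots> = (\<Prod>k\<in>E \<times> {..<m}. prob (?X k -` A k \<inter> space M))"
      by (simp add: prod.cartesian_product)
    finally show ?thesis .
  qed
  then have prod: "\<forall>A\<in>(\<Pi> k\<in>E \<times> {..<m}. UNIV). prob (\<Inter>k\<in>E \<times> {..<m}. ?X k -` A k \<inter> space M) =
      (\<Prod>k\<in>E \<times> {..<m}. prob (?X k -` A k \<inter> space M))"
    by blast
  have "indep_vars ?C ?X (E \<times> {..<m}) \<longleftrightarrow> (\<forall>A\<in>(\<Pi> k\<in>E \<times> {..<m}. UNIV).
      prob (\<Inter>k\<in>E \<times> {..<m}. ?X k -` A k \<inter> space M) = (\<Prod>k\<in>E \<times> {..<m}. prob (?X k -` A k \<inter> space M)))"
  proof (rule indep_vars_finite)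
    show "E \<times> {..<m} \<noteq> {}" "finite (E \<times> {..<m})" using E False by auto
    show "sets (?C k) = sigma_sets (space (?C k)) UNIV" for k :: "'b \<times> nat"
      by (auto intro: sigma_sets.Basic)
  qed (rule rv | simp add: Int_stable_def)+
  then show ?thesis using prod by (simp only:)
qed

lemma (in prob_space) prob_clock_increments:
  assumes clk: "independent_poisson_clocks M E N" and E: "finite E" "E \<noteq> {}" and h: "0 < h"
  shows "prob {\<omega>\<in>space M. \<forall>e\<in>E. clock_increment N h \<omega> (e, i) = a e} = (\<Prod>e\<in>E. pmf (poisson_pmf h) (a e))"
proof -
  let ?X = "\<lambda>k \<omega>. clock_increment N h \<omega> k"
  note ind = indep_clock_increments[OF clk E h, of "Suc i"]
  have 1: "prob (?X (e, i) -` {a e} \<inter> space M) = pmf (poisson_pmf h) (a e)" if "e \<in> E" for e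
  proof -
    have rv: "random_variable (count_space UNIV) (?X (e, i))"
      using ind that by (auto simp: indep_vars_def)
    have "distr M (count_space UNIV) (?X (e, i)) = measure_pmf (poisson_pmf (1 * (h * real (Suc i) - h * real i)))"
      using clk that h unfolding independent_poisson_clocks_def poisson_process_def clock_increment_def prod.case
      by (auto simp del: of_nat_Suc)
    moreover have "1 * (h * real (Suc i) - h * real i) = h" by (simp add: algebra_simps)
    ultimately have "distr M (count_space UNIV) (?X (e, i)) = measure_pmf (poisson_pmf h)" by metis
    then have "measure (distr M (count_space UNIV) (?X (e, i))) {a e} = pmf (poisson_pmf h) (a e)"
      by (simp add: measure_pmf_single)
    then show ?thesis using measure_distr[OF rv, of "{a e}"] by simp
  qed
  have "{\<omega>\<in>space M. \<forall>e\<in>E. ?X (e, i) \<omega> = a e} = (\<Inter>k\<in>E \<times> {i}. ?X k -` {a (fst k)} \<inter> space M)"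
    using E by auto
  also have "prob \<dots> = (\<Prod>k\<in>E \<times> {i}. prob (?X k -` {a (fst k)} \<inter> space M))"
    by (rule indep_varsD[OF ind]) (use E in auto)
  also have "\<dots> = (\<Prod>e\<in>E. \<Prod>j\<in>{i}. prob (?X (e, j) -` {a e} \<inter> space M))"
    by (subst prod.cartesian_product) (auto intro!: prod.cong)
  also have "\<dots> = (\<Prod>e\<in>E. pmf (poisson_pmf h) (a e))" using 1 by simp
  finally show ?thesis .
qed

lemma exp_minus_power: "exp (- h) ^ n = exp (- (h * real n) :: real)"
  by (metis exp_of_nat_mult mult.commute mult_minus_right)

lemma (in prob_space) prob_no_ring:
  assumes "independent_poisson_clocks M E N" "finite E" "E \<noteq> {}" "0 < h"
  shows "prob {\<omega>\<in>space M. \<forall>e\<in>E. clock_increment N h \<omega> (e, i) = 0} = exp (- (h * card E))"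
  using prob_clock_increments[OF assms, of i "\<lambda>_. 0"] assms(4) by (simp add: exp_minus_power)

text \<open>The clock of \<open>e\<close> contributes \<open>h * exp (- h)\<close> and each other
  clock \<open>exp (- h)\<close>. Taking this probability rather than \<open>h\<close> as the step
  of the operator makes the expectations of the chain exact.\<close>

lemma (in prob_space) prob_single_ring:
  assumes "independent_poisson_clocks M E N" "finite E" "E \<noteq> {}" "0 < h" "e \<in> E"
  shows "prob {\<omega>\<in>space M. single_ring E (\<lambda>e. clock_increment N h \<omega> (e, i)) e} = h * exp (- (h * card E))"
proof -
  have "(\<Prod>e'\<in>E. pmf (poisson_pmf h) (if e' = e then 1 else 0)) = (h * exp (-h)) * (\<Prod>e'\<in>E - {e}. exp (- h))"
    using assms by (subst prod.remove[of _ e]) (auto intro!: prod.cong)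
  also have "\<dots> = h * (exp (-h) * exp (- h) ^ (card E - 1))" using assms by simp
  also have "exp (-h) * exp (- h) ^ (card E - 1) = exp (-h) ^ card E"
    using assms card_gt_0_iff[of E] by (cases "card E") auto
  also note exp_minus_power
  finally have "prob {\<omega>\<in>space M. \<forall>e'\<in>E. clock_increment N h \<omega> (e', i) = (if e' = e then 1 else 0)} =
      h * exp (- (h * card E))"
    unfolding prob_clock_increments[OF assms(1-4), of i "\<lambda>e'. if e' = e then 1 else 0"] .
  then show ?thesis
    unfolding single_ring_def using assms(5) by simp
qed

section \<open>Measurability and expectations of the chain\<close>

lemma measurable_average_edge [measurable]:
  assumes "finite e" "e \<subseteq> V"
  shows "average_edge e \<in> measurable (PiM V (\<lambda>_. borel)) (PiM V (\<lambda>_. borel))"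
proof (rule measurable_PiM_single')
  show "(\<lambda>\<eta>. average_edge e \<eta> x) \<in> borel_measurable (PiM V (\<lambda>_. borel))" if "x \<in> V" for x
    using assms that unfolding average_edge_def
    by (cases "x \<in> e") (auto intro!: borel_measurable_divide borel_measurable_sum)
  show "average_edge e \<in> space (PiM V (\<lambda>_. borel)) \<rightarrow> V \<rightarrow>\<^sub>E space borel"
    using assms by (auto simp: space_PiM average_edge_def PiE_def extensional_def)
qed

lemma average_edge_restrict:
  "e \<subseteq> V \<Longrightarrow> average_edge e (restrict \<eta> V) = restrict (average_edge e \<eta>) V"
  by (auto simp: average_edge_def fun_eq_iff subset_iff intro!: sum.cong)

lemma avg_step_restrict:
  assumes "finite E" "\<And>e. e \<in> E \<Longrightarrow> e \<subseteq> V"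
  shows "avg_step E n (restrict \<eta> V) = restrict (avg_step E n \<eta>) V"
proof (cases "\<exists>e. single_ring E n e")
  case True
  then obtain e where "single_ring E n e" ..
  moreover then have "e \<subseteq> V" using assms by (auto simp: single_ring_def)
  ultimately show ?thesis using assms(1) by (simp add: avg_step_single average_edge_restrict)
next
  case False
  then show ?thesis by (simp add: avg_step_none)
qed

text \<open>Adaptedness, from which the state of the chain is independent of the rings in the next
  interval.\<close>

lemma avg_chain_cong:
  assumes "\<And>e j. e \<in> E \<Longrightarrow> j < i \<Longrightarrow> D (e, j) = D' (e, j)"
  shows "avg_chain E \<xi> D i = avg_chain E \<xi> D' i"
  using assms
proof (induction i)
  case (Suc i)
  have "single_ring E (\<lambda>e. D (e, i)) = single_ring E (\<lambda>e. D' (e, i))"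
    using Suc.prems by (intro ext) (simp add: single_ring_def)
  moreover have "avg_chain E \<xi> D i = avg_chain E \<xi> D' i"
    using Suc.prems by (intro Suc.IH) simp
  ultimately show ?case by (simp add: avg_step_def)
qed simp

lemma avg_step_closed:
  assumes "finite E" "\<eta> \<in> K" "\<And>e \<eta>. e \<in> E \<Longrightarrow> \<eta> \<in> K \<Longrightarrow> average_edge e \<eta> \<in> K"
  shows "avg_step E n \<eta> \<in> K"
proof (cases "\<exists>e. single_ring E n e")
  case True
  then obtain e where "single_ring E n e" ..
  moreover from this have "e \<in> E" by (simp add: single_ring_def)
  ultimately show ?thesis using assms by (simp add: avg_step_single)
qed (use assms in \<open>simp add: avg_step_none\<close>)

lemma avg_chain_closed:
  assumes "finite E" "\<xi> \<in> K" "\<And>e \<eta>. e \<in> E \<Longrightarrow> \<eta> \<in> K \<Longrightarrow> average_edge e \<eta> \<in> K"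
  shows "avg_chain E \<xi> D i \<in> K"
  by (induction i) (use assms in \<open>auto intro: avg_step_closed\<close>)

lemma pred_single_ring:
  assumes "finite E" "E \<times> {i} \<subseteq> J"
  shows "Measurable.pred (PiM J (\<lambda>_. count_space UNIV)) (\<lambda>D. single_ring E (\<lambda>e. D (e, i)) e)"
proof -
  have "Measurable.pred (PiM J (\<lambda>_. count_space UNIV)) (\<lambda>D. D (e', i) = n)" if "e' \<in> E" for e' n
  proof -
    have "(\<lambda>D. D (e', i)) \<in> measurable (PiM J (\<lambda>_. count_space UNIV)) (count_space UNIV)"
      using assms(2) that by (intro measurable_component_singleton) auto
    from measurable_compose[OF this, of "\<lambda>k. k = n" "count_space UNIV"] show ?thesis by simp
  qed
  then show ?thesis unfolding single_ring_def using assms(1)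
    by (intro pred_intros_logic pred_intros_finite) auto
qed

text \<open>Measurability is in the array \<open>D\<close>, not in the sample point, because the
  independence argument composes the chain with a block of increments.\<close>

lemma measurable_avg_chain:
  assumes E: "finite E" "\<And>e. e \<in> E \<Longrightarrow> finite e" "\<And>e. e \<in> E \<Longrightarrow> e \<subseteq> V"
    and "\<xi> \<in> extensional V" "E \<times> {..<i} \<subseteq> J"
  shows "(\<lambda>D. avg_chain E \<xi> D i) \<in> measurable (PiM J (\<lambda>_. count_space UNIV)) (PiM V (\<lambda>_. borel))"
  using assms(5)
proof (induction i)
  case 0
  show ?case using assms(4) by (auto simp: space_PiM PiE_def)
next
  case (Suc i)
  let ?P = "PiM J (\<lambda>_. count_space UNIV) :: ('a set \<times> nat \<Rightarrow> nat) measure"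
  have IH: "(\<lambda>D. avg_chain E \<xi> D i) \<in> measurable ?P (PiM V (\<lambda>_. borel))"
    using Suc.prems by (intro Suc.IH) (auto simp: lessThan_Suc)
  have E': "E \<times> {i} \<subseteq> J" using Suc.prems by auto
  have coord: "(\<lambda>D. G (avg_chain E \<xi> D i) x) \<in> borel_measurable ?P"
    if "G \<in> measurable (PiM V (\<lambda>_. borel)) (PiM V (\<lambda>_. borel))" "x \<in> V"
    for x and G :: "('a \<Rightarrow> real) \<Rightarrow> 'a \<Rightarrow> real"
    using measurable_compose[OF measurable_compose[OF IH that(1)] measurable_component_singleton[OF that(2)]] .
  show ?case
  proof (rule measurable_PiM_single')
    fix x assume x: "x \<in> V"
    have "(\<lambda>D. if single_ring E (\<lambda>e. D (e, i)) e
               then average_edge e (avg_chain E \<xi> D i) x - avg_chain E \<xi> D i x else 0) \<in> borel_measurable ?P"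
      if "e \<in> E" for e
      using coord[of "average_edge e", OF _ x] coord[of "\<lambda>\<eta>. \<eta>", OF _ x] E that pred_single_ring[OF E(1) E']
      by (intro measurable_If borel_measurable_diff) (auto simp: measurable_average_edge)
    then show "(\<lambda>D. avg_chain E \<xi> D (Suc i) x) \<in> borel_measurable ?P"
      unfolding avg_chain.simps avg_step_def
      by (intro borel_measurable_add borel_measurable_sum) (use coord[of "\<lambda>\<eta>. \<eta>", OF _ x] in auto)
  next
    have "avg_chain E \<xi> D (Suc i) \<in> extensional V" for D
      using assms by (intro avg_chain_closed) (auto simp: average_edge_def extensional_def)
    then show "(\<lambda>D. avg_chain E \<xi> D (Suc i)) \<in> space ?P \<rightarrow> V \<rightarrow>\<^sub>E space borel"
      by (auto simp: PiE_def)
  qed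
qed

text \<open>\<open>K\<close> is a set of states preserved by averaging, on which observables will be
  bounded; on the cube it becomes the set of probability mass functions. Its elements are
  extensional because they have to be points of the product space over \<open>V\<close>.\<close>

locale ringing_clocks = prob_space M for M :: "'a measure" +
  fixes V :: "'v set" and E :: "'v set set" and N :: "'v set \<Rightarrow> real \<Rightarrow> 'a \<Rightarrow> nat"
    and K :: "('v \<Rightarrow> real) set" and \<xi> :: "'v \<Rightarrow> real"
  assumes clk: "independent_poisson_clocks M E N"
    and E: "finite E" "E \<noteq> {}" "\<And>e. e \<in> E \<Longrightarrow> finite e" "\<And>e. e \<in> E \<Longrightarrow> e \<subseteq> V"
    and K: "K \<subseteq> extensional V" "\<xi> \<in> K" "\<And>e \<eta>. e \<in> E \<Longrightarrow> \<eta> \<in> K \<Longrightarrow> average_edge e \<eta> \<in> K"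
begin

abbreviation "chain h i \<omega> \<equiv> avg_chain E \<xi> (clock_increment N h \<omega>) i"

lemma chain_in_K: "chain h i \<omega> \<in> K"
  using E K by (intro avg_chain_closed)

lemma measurable_clock_increment:
  assumes "0 < h" "e \<in> E"
  shows "(\<lambda>\<omega>. clock_increment N h \<omega> (e, i)) \<in> measurable M (count_space UNIV)"
  using indep_clock_increments[OF clk E(1,2) assms(1), of "Suc i"] assms by (auto simp: indep_vars_def)

lemma pred_clock_increment:
  assumes "0 < h" "e \<in> E"
  shows "Measurable.pred M (\<lambda>\<omega>. clock_increment N h \<omega> (e, i) = n)"
  using measurable_compose[OF measurable_clock_increment[OF assms], of "\<lambda>k. k = n" "count_space UNIV"] by simp

lemma pred_single_ring_increments:
  assumes "0 < h"
  shows "Measurable.pred M (\<lambda>\<omega>. single_ring E (\<lambda>e. clock_increment N h \<omega> (e, i)) e)"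
  unfolding single_ring_def using E(1) pred_clock_increment[OF assms]
  by (intro pred_intros_logic pred_intros_finite) auto

lemma measurable_chain:
  assumes h: "0 < h"
  shows "chain h i \<in> measurable M (PiM V (\<lambda>_. borel))"
proof -
  have "(\<lambda>\<omega>. \<lambda>k\<in>E \<times> {..<i}. clock_increment N h \<omega> k) \<in> measurable M (PiM (E \<times> {..<i}) (\<lambda>_. count_space UNIV))"
    using measurable_clock_increment[OF h] by (intro measurable_restrict) auto
  from measurable_compose[OF this measurable_avg_chain[OF E(1,3,4), where \<xi>=\<xi> and i=i]]
  have "(\<lambda>\<omega>. avg_chain E \<xi> (\<lambda>k\<in>E \<times> {..<i}. clock_increment N h \<omega> k) i) \<in> measurable M (PiM V (\<lambda>_. borel))"
    using K by auto
  then show ?thesis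
    by (subst measurable_cong) (auto intro: avg_chain_cong)
qed

lemma integrable_chain:
  fixes F :: "('v \<Rightarrow> real) \<Rightarrow> real"
  assumes "0 < h" "F \<in> borel_measurable (PiM V (\<lambda>_. borel))" "\<And>\<eta>. \<eta> \<in> K \<Longrightarrow> \<bar>F \<eta>\<bar> \<le> B"
  shows "integrable M (\<lambda>\<omega>. F (chain h i \<omega>))"
  by (rule integrable_const_bound[of _ B])
    (use assms chain_in_K measurable_compose[OF measurable_chain[OF assms(1)] assms(2)] in auto)

lemma integral_chain_single_ring:
  fixes F :: "('v \<Rightarrow> real) \<Rightarrow> real" and i :: nat
  assumes h: "0 < h" and F: "F \<in> borel_measurable (PiM V (\<lambda>_. borel))" "\<And>\<eta>. \<eta> \<in> K \<Longrightarrow> \<bar>F \<eta>\<bar> \<le> B"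
    and e: "e \<in> E"
  defines "S \<equiv> \<lambda>\<omega>. if single_ring E (\<lambda>e. clock_increment N h \<omega> (e, i)) e then 1 else 0 :: real"
  shows "integrable M (\<lambda>\<omega>. F (chain h i \<omega>) * S \<omega>)"
    "(\<integral>\<omega>. F (chain h i \<omega>) * S \<omega> \<partial>M) = h * exp (- (h * card E)) * (\<integral>\<omega>. F (chain h i \<omega>) \<partial>M)"
proof -
  let ?X = "\<lambda>k \<omega>. clock_increment N h \<omega> k"
  let ?C = "\<lambda>_. count_space UNIV :: nat measure"
  have F1: "(\<lambda>D. F (avg_chain E \<xi> D i)) \<in> borel_measurable (PiM (E \<times> {..<i}) ?C)"
    using K by (intro measurable_compose[OF measurable_avg_chain[OF E(1,3,4)] F(1)]) auto
  have S1: "(\<lambda>D. if single_ring E (\<lambda>e. D (e, i)) e then 1 else 0 :: real) \<in> borel_measurable (PiM (E \<times> {i}) ?C)"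
    using pred_single_ring[OF E(1), of i "E \<times> {i}" e] by (intro measurable_If) auto
  \<comment> \<open>Past and present are functions of the disjoint index blocks
    \<open>E \<times> {..<i}\<close> and \<open>E \<times> {i}\<close>.\<close>
  have "indep_var borel ((\<lambda>D. F (avg_chain E \<xi> D i)) \<circ> (\<lambda>\<omega>. restrict (\<lambda>k. ?X k \<omega>) (E \<times> {..<i})))
      borel ((\<lambda>D. if single_ring E (\<lambda>e. D (e, i)) e then 1 else 0 :: real) \<circ> (\<lambda>\<omega>. restrict (\<lambda>k. ?X k \<omega>) (E \<times> {i})))"
    by (rule indep_var_compose[OF indep_var_restrict[OF indep_clock_increments[OF clk E(1,2) h, of "Suc i"]] F1 S1]) auto
  also have "(\<lambda>D. F (avg_chain E \<xi> D i)) \<circ> (\<lambda>\<omega>. restrict (\<lambda>k. ?X k \<omega>) (E \<times> {..<i})) = (\<lambda>\<omega>. F (chain h i \<omega>))"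
    by (auto simp: fun_eq_iff intro!: arg_cong[of _ _ F] avg_chain_cong)
  also have "(\<lambda>D. if single_ring E (\<lambda>e. D (e, i)) e then 1 else 0 :: real) \<circ> (\<lambda>\<omega>. restrict (\<lambda>k. ?X k \<omega>) (E \<times> {i})) = S"
    by (auto simp: S_def fun_eq_iff single_ring_def)
  finally have ind: "indep_var borel (\<lambda>\<omega>. F (chain h i \<omega>)) borel S" .
  have [measurable]: "Measurable.pred M (\<lambda>\<omega>. single_ring E (\<lambda>e. clock_increment N h \<omega> (e, i)) e)"
    by (rule pred_single_ring_increments[OF h])
  have S: "integrable M S" unfolding S_def by (rule integrable_const_bound[of _ 1]) auto
  have "(\<integral>\<omega>. S \<omega> \<partial>M) = (\<integral>\<omega>. indicator {\<omega>\<in>space M. single_ring E (\<lambda>e. clock_increment N h \<omega> (e, i)) e} \<omega> \<partial>M)"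
    by (intro Bochner_Integration.integral_cong) (auto simp: S_def)
  also have "\<dots> = h * exp (- (h * card E))"
    using prob_single_ring[OF clk E(1,2) h e, of i] by simp
  finally have "(\<integral>\<omega>. S \<omega> \<partial>M) = h * exp (- (h * card E))" .
  then show "integrable M (\<lambda>\<omega>. F (chain h i \<omega>) * S \<omega>)"
    "(\<integral>\<omega>. F (chain h i \<omega>) * S \<omega> \<partial>M) = h * exp (- (h * card E)) * (\<integral>\<omega>. F (chain h i \<omega>) \<partial>M)"
    using indep_var_integrable[OF ind integrable_chain[OF h F] S]
      indep_var_lebesgue_integral[OF ind integrable_chain[OF h F] S] by simp_all
qed

text \<open>The Markov property with the last interval peeled off: averaging over its rings replaces
  \<open>F\<close> by the one-step operator applied to \<open>F\<close>. Hence the induction varies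
  \<open>F\<close> and, with it, the bound \<open>B\<close>.\<close>

lemma integral_chain:
  fixes F :: "('v \<Rightarrow> real) \<Rightarrow> real"
  assumes h: "0 < h" and "F \<in> borel_measurable (PiM V (\<lambda>_. borel))" "\<And>\<eta>. \<eta> \<in> K \<Longrightarrow> \<bar>F \<eta>\<bar> \<le> B"
  shows "(\<integral>\<omega>. F (chain h i \<omega>) \<partial>M) = (avg_op E (h * exp (- (h * card E))) ^^ i) F \<xi>"
  using assms(2,3)
proof (induction i arbitrary: F B)
  case 0
  then show ?case by (simp add: prob_space)
next
  case (Suc i)
  let ?p = "h * exp (- (h * card E))"
  let ?S = "\<lambda>e \<omega>. if single_ring E (\<lambda>e. clock_increment N h \<omega> (e, i)) e then 1 else 0 :: real"
  note F = Suc.prems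
  define G where "G e \<eta> = F (average_edge e \<eta>) - F \<eta>" for e \<eta>
  have G: "G e \<in> borel_measurable (PiM V (\<lambda>_. borel))" "\<And>\<eta>. \<eta> \<in> K \<Longrightarrow> \<bar>G e \<eta>\<bar> \<le> 2 * B" if "e \<in> E" for e
  proof -
    show "G e \<in> borel_measurable (PiM V (\<lambda>_. borel))"
      unfolding G_def
      by (intro borel_measurable_diff F measurable_compose[OF measurable_average_edge F(1)] E that)
    show "\<bar>G e \<eta>\<bar> \<le> 2 * B" if "\<eta> \<in> K" for \<eta>
      using F(2)[OF that] F(2)[OF K(3)[OF \<open>e \<in> E\<close> that]] by (simp add: G_def)
  qed
  have op: "avg_op E ?p F = (\<lambda>\<eta>. F \<eta> + ?p * (\<Sum>e\<in>E. G e \<eta>))"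
    by (simp add: avg_op_def G_def)
  have "(\<integral>\<omega>. F (chain h (Suc i) \<omega>) \<partial>M) = (\<integral>\<omega>. F (chain h i \<omega>) + (\<Sum>e\<in>E. G e (chain h i \<omega>) * ?S e \<omega>) \<partial>M)"
    by (subst avg_chain.simps, subst fun_avg_step[OF E(1)])
      (auto intro!: Bochner_Integration.integral_cong sum.cong simp: G_def)
  also have "\<dots> = (\<integral>\<omega>. F (chain h i \<omega>) \<partial>M) + (\<Sum>e\<in>E. ?p * (\<integral>\<omega>. G e (chain h i \<omega>) \<partial>M))"
    using integrable_chain[OF h F] integral_chain_single_ring[OF h G] by simp
  also have "\<dots> = (\<integral>\<omega>. avg_op E ?p F (chain h i \<omega>) \<partial>M)"
    unfolding op using integrable_chain[OF h F] integrable_chain[OF h G]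
    by (simp add: sum_distrib_left)
  also have "\<dots> = (avg_op E ?p ^^ i) (avg_op E ?p F) \<xi>"
  proof (rule Suc.IH)
    show "avg_op E ?p F \<in> borel_measurable (PiM V (\<lambda>_. borel))"
      unfolding op by (intro borel_measurable_add borel_measurable_times borel_measurable_sum F G) auto
    show "\<bar>avg_op E ?p F \<eta>\<bar> \<le> B + ?p * (card E * (2 * B))" if "\<eta> \<in> K" for \<eta>
    proof -
      have "\<bar>\<Sum>e\<in>E. G e \<eta>\<bar> \<le> card E * (2 * B)"
        using sum_norm_bound[of E "\<lambda>e. G e \<eta>" "2 * B"] G(2)[OF _ that] by simp
      then have "\<bar>?p * (\<Sum>e\<in>E. G e \<eta>)\<bar> \<le> ?p * (card E * (2 * B))"
        unfolding abs_mult using h by (intro mult_mono) auto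
      then show ?thesis unfolding op using F(2)[OF that] by linarith
    qed
  qed
  finally show ?case by (simp add: funpow_swap1)
qed

end

section \<open>Coupling of the chain with the process\<close>

context ringing_clocks
begin

definition few_rings :: "real \<Rightarrow> nat \<Rightarrow> 'a \<Rightarrow> bool" where
  "few_rings h i \<omega> \<longleftrightarrow> (\<forall>e\<in>E. clock_increment N h \<omega> (e, i) = 0) \<or>
     (\<exists>e. single_ring E (\<lambda>e. clock_increment N h \<omega> (e, i)) e)"

lemma few_rings_eq:
  "{\<omega>\<in>space M. few_rings h i \<omega>} = {\<omega>\<in>space M. \<forall>e\<in>E. clock_increment N h \<omega> (e, i) = 0} \<union>
     (\<Union>e\<in>E. {\<omega>\<in>space M. single_ring E (\<lambda>e. clock_increment N h \<omega> (e, i)) e})"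
  by (auto simp: few_rings_def single_ring_def)

lemma sets_no_ring:
  assumes "0 < h" shows "{\<omega>\<in>space M. \<forall>e\<in>E. clock_increment N h \<omega> (e, i) = 0} \<in> sets M"
proof -
  have "Measurable.pred M (\<lambda>\<omega>. \<forall>e\<in>E. clock_increment N h \<omega> (e, i) = 0)"
    using E(1) pred_clock_increment[OF assms] by (intro pred_intros_finite)
  then show ?thesis by (simp add: pred_def)
qed

lemma sets_single_ring:
  assumes "0 < h" shows "{\<omega>\<in>space M. single_ring E (\<lambda>e. clock_increment N h \<omega> (e, i)) e} \<in> sets M"
  using pred_single_ring_increments[OF assms] by (simp add: pred_def)

lemma sets_few_rings:
  assumes "0 < h" shows "{\<omega>\<in>space M. few_rings h i \<omega>} \<in> sets M"
  unfolding few_rings_eq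
  by (intro sets.Un sets.finite_UN sets_no_ring[OF assms] sets_single_ring[OF assms] E(1))

lemma prob_few_rings:
  assumes h: "0 < h"
  shows "prob {\<omega>\<in>space M. few_rings h i \<omega>} = (1 + h * card E) * exp (- (h * card E))"
proof -
  let ?S = "\<lambda>e. {\<omega>\<in>space M. single_ring E (\<lambda>e. clock_increment N h \<omega> (e, i)) e}"
  have "prob (\<Union>e\<in>E. ?S e) = (\<Sum>e\<in>E. prob (?S e))"
    using E(1) sets_single_ring[OF h]
    by (intro finite_measure_finite_Union) (auto simp: disjoint_family_on_def dest: single_ring_unique)
  also have "\<dots> = card E * (h * exp (- (h * card E)))"
    using prob_single_ring[OF clk E(1,2) h] by simp
  finally have "prob (\<Union>e\<in>E. ?S e) = card E * (h * exp (- (h * card E)))" .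
  moreover have "{\<omega>\<in>space M. \<forall>e\<in>E. clock_increment N h \<omega> (e, i) = 0} \<inter> (\<Union>e\<in>E. ?S e) = {}"
    unfolding single_ring_def by fastforce
  then have "prob {\<omega>\<in>space M. few_rings h i \<omega>} =
      prob {\<omega>\<in>space M. \<forall>e\<in>E. clock_increment N h \<omega> (e, i) = 0} + prob (\<Union>e\<in>E. ?S e)"
    unfolding few_rings_eq
    by (intro finite_measure_Union sets.finite_UN sets_no_ring[OF h] sets_single_ring[OF h] E(1))
  ultimately show ?thesis
    using prob_no_ring[OF clk E(1,2) h, of i] by (simp add: algebra_simps)
qed

lemma prob_many_rings:
  fixes h :: real and m :: nat
  assumes h: "0 < h"
  shows "prob {\<omega>\<in>space M. \<exists>i<m. \<not> few_rings h i \<omega>} \<le> m * (h * card E)\<^sup>2"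
proof -
  let ?B = "\<lambda>i. space M - {\<omega>\<in>space M. few_rings h i \<omega>}"
  define l :: real where "l = h * card E"
  \<comment> \<open>This yields \<open>1 - (1 + l) * exp (- l) \<le> l\<^sup>2\<close>; the union
    bound then vanishes for \<open>m\<close> intervals of length of order
    \<open>1 / m\<close>.\<close>
  have "1 - l \<le> exp (- l)" using exp_ge_add_one_self[of "- l"] by simp
  then have "(1 + l) * (1 - l) \<le> (1 + l) * exp (- l)"
    using h by (intro mult_left_mono) (auto simp: l_def)
  then have B: "prob (?B i) \<le> l\<^sup>2" for i
    using sets_few_rings[OF h, of i]
    by (subst prob_compl) (simp_all add: prob_few_rings[OF h, folded l_def] power2_eq_square algebra_simps)
  have "{\<omega>\<in>space M. \<exists>i<m. \<not> few_rings h i \<omega>} = (\<Union>i\<in>{..<m::nat}. ?B i)" by auto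
  also have "prob \<dots> \<le> (\<Sum>i<m. prob (?B i))"
    using sets_few_rings[OF h] by (intro finite_measure_subadditive_finite) auto
  also have "\<dots> \<le> m * l\<^sup>2" using sum_bounded_above[of "{..<m}" "\<lambda>i. prob (?B i)"] B by simp
  finally show ?thesis by (simp add: l_def)
qed

text \<open>Mass functions vanish off \<open>V\<close>, while points of the product space are
  \<open>undefined\<close> there; \<open>restrict\<close> passes from the process to the
  chain.\<close>

lemma chain_eq_path:
  fixes g :: "real \<Rightarrow> 'v \<Rightarrow> real"
  assumes h: "0 < h"
    and mono: "\<And>e. e \<in> E \<Longrightarrow> mono_on {0..} (\<lambda>r. N e r \<omega>)"
    and cont: "\<And>e r. e \<in> E \<Longrightarrow> 0 \<le> r \<Longrightarrow> continuous (at_right r) (\<lambda>r. N e r \<omega>)"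
    and start: "restrict (g 0) V = \<xi>"
    and const: "\<And>s t. 0 \<le> s \<Longrightarrow> s < t \<Longrightarrow> (\<forall>e\<in>E. \<forall>u\<in>{s<..t}. \<not> rings_at (\<lambda>r. N e r \<omega>) u) \<Longrightarrow> g t = g s"
    and ring: "\<And>t e. e \<in> E \<Longrightarrow> rings_at (\<lambda>r. N e r \<omega>) t \<Longrightarrow> (\<forall>\<^sub>F s in at_left t. g t = average_edge e (g s))"
    and few: "\<forall>i<m. few_rings h i \<omega>"
  shows "chain h m \<omega> = restrict (g (h * m)) V"
  using few
proof (induction m)
  case 0
  then show ?case using start by simp
next
  case (Suc m)
  have "g (h * Suc m) = avg_step E (\<lambda>e. N e (h * Suc m) \<omega> - N e (h * m) \<omega>) (g (h * m))"
  proof (rule averaging_path_interval[where N="\<lambda>e r. N e r \<omega>" and s="h * m" and t="h * Suc m" and g=g, OF _ _ E(1) mono cont const ring])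
    show "(\<forall>e\<in>E. N e (h * Suc m) \<omega> - N e (h * m) \<omega> = 0) \<or>
        (\<exists>e. single_ring E (\<lambda>e. N e (h * Suc m) \<omega> - N e (h * m) \<omega>) e)"
      using Suc.prems[rule_format, of m] unfolding few_rings_def clock_increment_def prod.case by simp
  qed (use h in auto)
  moreover have "chain h m \<omega> = restrict (g (h * m)) V"
    using Suc.prems by (intro Suc.IH) simp
  ultimately show ?case
    using avg_step_restrict[OF E(1,4)] by (simp add: clock_increment_def)
qed

end

lemma averaging_processD:
  assumes "averaging_process V E \<xi> M \<eta>"
  shows "prob_space M" "\<And>t x. 0 \<le> t \<Longrightarrow> x \<in> V \<Longrightarrow> (\<lambda>\<omega>. \<eta> t \<omega> x) \<in> borel_measurable M"
proof -
  have "\<forall>t\<ge>0. \<forall>x\<in>V. (\<lambda>\<omega>. \<eta> t \<omega> x) \<in> borel_measurable M"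
    using assms unfolding averaging_process_def by (elim conjE)
  then show "\<And>t x. 0 \<le> t \<Longrightarrow> x \<in> V \<Longrightarrow> (\<lambda>\<omega>. \<eta> t \<omega> x) \<in> borel_measurable M"
    by simp
  show "prob_space M"
    using assms unfolding averaging_process_def by (elim conjE)
qed

lemma averaging_processE:
  assumes "averaging_process V E \<xi> M \<eta>" and E: "finite E" "E \<noteq> {}" "\<And>e. e \<in> E \<Longrightarrow> finite e" "\<And>e. e \<in> E \<Longrightarrow> e \<subseteq> V"
    and K: "K \<subseteq> extensional V" "restrict \<xi> V \<in> K" "\<And>e \<eta>. e \<in> E \<Longrightarrow> \<eta> \<in> K \<Longrightarrow> average_edge e \<eta> \<in> K"
  obtains N where "ringing_clocks M V E N K (restrict \<xi> V)"
    "\<forall>h m. 0 < h \<longrightarrow> (AE \<omega> in M. (\<forall>i<m. ringing_clocks.few_rings E N h i \<omega>) \<longrightarrow>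
       avg_chain E (restrict \<xi> V) (clock_increment N h \<omega>) m = restrict (\<eta> (h * real m) \<omega>) V)"
proof -
  have "\<exists>N. independent_poisson_clocks M E N \<and> (AE \<omega> in M.
           \<eta> 0 \<omega> = \<xi> \<and>
           (\<forall>s t. 0 \<le> s \<and> s < t \<and>
              (\<forall>e\<in>E. \<forall>u\<in>{s<..t}. \<not> rings_at (\<lambda>r. N e r \<omega>) u) \<longrightarrow> \<eta> t \<omega> = \<eta> s \<omega>) \<and>
           (\<forall>t. \<forall>e\<in>E. rings_at (\<lambda>r. N e r \<omega>) t \<longrightarrow>
              (\<forall>\<^sub>F s in at_left t. \<eta> t \<omega> = average_edge e (\<eta> s \<omega>))))"
    using assms(1) unfolding averaging_process_def by (elim conjE)
  then obtain N where N_path: "independent_poisson_clocks M E N \<and> (AE \<omega> in M.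
           \<eta> 0 \<omega> = \<xi> \<and>
           (\<forall>s t. 0 \<le> s \<and> s < t \<and>
              (\<forall>e\<in>E. \<forall>u\<in>{s<..t}. \<not> rings_at (\<lambda>r. N e r \<omega>) u) \<longrightarrow> \<eta> t \<omega> = \<eta> s \<omega>) \<and>
           (\<forall>t. \<forall>e\<in>E. rings_at (\<lambda>r. N e r \<omega>) t \<longrightarrow>
              (\<forall>\<^sub>F s in at_left t. \<eta> t \<omega> = average_edge e (\<eta> s \<omega>))))"
    by (erule exE)
  note N = N_path[THEN conjunct1] and path = N_path[THEN conjunct2]
  interpret prob_space M by (rule averaging_processD[OF assms(1)])
  interpret ringing_clocks M V E N K "restrict \<xi> V"
    by standard (use N E K in auto)
  have "AE \<omega> in M. N e 0 \<omega> = 0 \<and> mono_on {0..} (\<lambda>t. N e t \<omega>) \<and> (\<forall>t\<ge>0. continuous (at_right t) (\<lambda>s. N e s \<omega>))"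
    if "e \<in> E" for e
  proof -
    have "poisson_process M 1 (N e)" using N that by (simp add: independent_poisson_clocks_def)
    then show ?thesis unfolding poisson_process_def by (elim conjE)
  qed
  then have clocks: "AE \<omega> in M. \<forall>e\<in>E. N e 0 \<omega> = 0 \<and> mono_on {0..} (\<lambda>t. N e t \<omega>) \<and> (\<forall>t\<ge>0. continuous (at_right t) (\<lambda>s. N e s \<omega>))"
    using E(1) by (intro AE_finite_allI) auto
  show thesis
  proof
    show "ringing_clocks M V E N K (restrict \<xi> V)" by unfold_locales
    have "AE \<omega> in M. (\<forall>i<m. few_rings h i \<omega>) \<longrightarrow>
       avg_chain E (restrict \<xi> V) (clock_increment N h \<omega>) m = restrict (\<eta> (h * real m) \<omega>) V"
      if h: "0 < h" for h m
      using clocks path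
    proof eventually_elim
      case (elim \<omega>)
      show ?case
      proof
        assume few: "\<forall>i<m. few_rings h i \<omega>"
        show "chain h m \<omega> = restrict (\<eta> (h * real m) \<omega>) V"
          by (rule chain_eq_path[where g="\<lambda>t. \<eta> t \<omega>", OF h _ _ _ _ _ few]) (use elim in blast)+
      qed
    qed
    then show "\<forall>h m. 0 < h \<longrightarrow> (AE \<omega> in M. (\<forall>i<m. few_rings h i \<omega>) \<longrightarrow>
       chain h m \<omega> = restrict (\<eta> (h * real m) \<omega>) V)"
      by simp
  qed
qed

text \<open>The chain and the averaging process agree unless two rings fall into one of the \<open>m\<close>
  intervals of length \<open>t / m\<close>, which has probability \<open>O(1 / m)\<close>.\<close>

lemma averaging_process_limit:
  assumes ap: "averaging_process V E \<xi> M \<eta>" and E: "finite E" "E \<noteq> {}" "\<And>e. e \<in> E \<Longrightarrow> finite e" "\<And>e. e \<in> E \<Longrightarrow> e \<subseteq> V"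
    and K: "K \<subseteq> extensional V" "restrict \<xi> V \<in> K" "\<And>e \<eta>. e \<in> E \<Longrightarrow> \<eta> \<in> K \<Longrightarrow> average_edge e \<eta> \<in> K"
    and t: "0 < t"
  shows AE_averaging_process: "AE \<omega> in M. restrict (\<eta> t \<omega>) V \<in> K"
    and "F \<in> borel_measurable (PiM V (\<lambda>_. borel)) \<Longrightarrow> (\<And>\<eta>. \<eta> \<in> K \<Longrightarrow> \<bar>F \<eta>\<bar> \<le> B) \<Longrightarrow>
      (\<lambda>m. (avg_op E (t / m * exp (- (t / m * card E))) ^^ m) F (restrict \<xi> V))
        \<longlonglongrightarrow> (\<integral>\<omega>. F (restrict (\<eta> t \<omega>) V) \<partial>M)"
proof -
  obtain N where clocks: "ringing_clocks M V E N K (restrict \<xi> V)"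
    and path: "\<forall>h m. 0 < h \<longrightarrow> (AE \<omega> in M. (\<forall>i<m. ringing_clocks.few_rings E N h i \<omega>) \<longrightarrow>
       avg_chain E (restrict \<xi> V) (clock_increment N h \<omega>) m = restrict (\<eta> (h * real m) \<omega>) V)"
    by (rule averaging_processE[OF ap E K])
  interpret ringing_clocks M V E N K "restrict \<xi> V" by fact
  define bad where "bad m = {\<omega>\<in>space M. \<exists>i<m. \<not> few_rings (t / m) i \<omega>}" for m :: nat
  have bad_sets: "bad m \<in> sets M" if "m > 0" for m :: nat
  proof -
    have "bad m = (\<Union>i<m. space M - {\<omega>\<in>space M. few_rings (t / m) i \<omega>})"
      by (auto simp: bad_def)
    then show ?thesis
      using t that by (auto simp only: intro!: sets.finite_UN sets.Diff sets.top sets_few_rings divide_pos_pos finite_lessThan of_nat_0_less_iff)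
  qed
  have bad_prob: "prob (bad m) \<le> (t * card E)\<^sup>2 / m" if "m > 0" for m :: nat
  proof -
    have "prob (bad m) \<le> m * (t / m * card E)\<^sup>2"
      unfolding bad_def using t that by (intro prob_many_rings) auto
    also have "\<dots> = (t * card E)\<^sup>2 / m"
      using that by (simp add: power2_eq_square field_simps)
    finally show ?thesis .
  qed
  have lim0: "(\<lambda>m. c / real m) \<longlonglongrightarrow> 0" for c :: real by (rule lim_const_over_n)
  have agree: "AE \<omega> in M. \<omega> \<notin> bad m \<longrightarrow> chain (t / m) m \<omega> = restrict (\<eta> t \<omega>) V" if "m > 0" for m :: nat
  proof -
    have "AE \<omega> in M. (\<forall>i<m. few_rings (t / m) i \<omega>) \<longrightarrow> chain (t / m) m \<omega> = restrict (\<eta> (t / m * m) \<omega>) V"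
      by (rule path[THEN spec, THEN spec, THEN mp]) (use t that in simp)
    with AE_space show ?thesis
      by eventually_elim (use that in \<open>auto simp: bad_def\<close>)
  qed
  have "AE \<omega> in M. \<forall>m>0. \<omega> \<notin> bad m \<longrightarrow> chain (t / m) m \<omega> = restrict (\<eta> t \<omega>) V"
    using agree by (subst AE_all_countable) auto
  \<comment> \<open>The bad events have probabilities tending to \<open>0\<close>, so almost every
    sample point has a good mesh \<open>m\<close>. There the process coincides with the chain, which
    never leaves \<open>K\<close>.\<close>
  moreover have "AE \<omega> in M. \<exists>m>0. \<omega> \<notin> bad m"
  proof (rule AE_I)
    show "{\<omega>\<in>space M. \<not> (\<exists>m>0. \<omega> \<notin> bad m)} \<subseteq> (\<Inter>m\<in>{0<..}. bad m)" by blast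
    show meas: "(\<Inter>m\<in>{0<..}. bad m) \<in> sets M"
      using bad_sets by (intro sets.countable_INT') auto
    have "prob (\<Inter>m\<in>{0<..}. bad m) \<le> (t * card E)\<^sup>2 / m" if "m > 0" for m :: nat
    proof -
      have "prob (\<Inter>m\<in>{0<..}. bad m) \<le> prob (bad m)"
        using bad_sets[OF that] that by (intro finite_measure_mono) auto
      then show ?thesis using bad_prob[OF that] by linarith
    qed
    then have "prob (\<Inter>m\<in>{0<..}. bad m) \<le> 0"
      by (intro LIMSEQ_le[OF tendsto_const lim0[of "(t * card E)\<^sup>2"]]) (auto intro!: exI[of _ 1])
    then show "emeasure M (\<Inter>m\<in>{0<..}. bad m) = 0"
      by (simp add: emeasure_eq_measure measure_le_0_iff)
  qed
  ultimately show AE_K: "AE \<omega> in M. restrict (\<eta> t \<omega>) V \<in> K"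
    by eventually_elim (metis chain_in_K)
  assume F: "F \<in> borel_measurable (PiM V (\<lambda>_. borel))" "\<And>\<eta>. \<eta> \<in> K \<Longrightarrow> \<bar>F \<eta>\<bar> \<le> B"
  have \<eta>: "(\<lambda>\<omega>. restrict (\<eta> t \<omega>) V) \<in> measurable M (PiM V (\<lambda>_. borel))"
    using averaging_processD[OF ap] t by (intro measurable_restrict) auto
  have int: "integrable M (\<lambda>\<omega>. F (restrict (\<eta> t \<omega>) V))"
    using AE_K F(2) by (intro integrable_const_bound[of _ B] measurable_compose[OF \<eta> F(1)]) auto
  let ?L = "\<integral>\<omega>. F (restrict (\<eta> t \<omega>) V) \<partial>M"
  let ?A = "\<lambda>m. (avg_op E (t / m * exp (- (t / m * card E))) ^^ m) F (restrict \<xi> V)"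
  \<comment> \<open>The two integrands differ only on \<open>bad m\<close>, and there by at most
    \<open>2 * B\<close>.\<close>
  have "norm (?A m - ?L) \<le> (2 * B * (t * card E)\<^sup>2) / m" if "m > 0" for m :: nat
  proof -
    have h: "0 < t / m" using t that by simp
    note ic = integrable_chain[OF h F, of m]
    have B: "0 \<le> B" using F(2)[OF K(2)] by linarith
    have [measurable]: "bad m \<in> sets M" by (rule bad_sets[OF that])
    have "?A m - ?L = (\<integral>\<omega>. F (chain (t / m) m \<omega>) - F (restrict (\<eta> t \<omega>) V) \<partial>M)"
      using integral_chain[OF h F, of m] ic int by simp
    also have "norm \<dots> \<le> (\<integral>\<omega>. norm (F (chain (t / m) m \<omega>) - F (restrict (\<eta> t \<omega>) V)) \<partial>M)"
      by (rule integral_norm_bound)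
    also have "\<dots> \<le> (\<integral>\<omega>. 2 * B * indicator (bad m) \<omega> \<partial>M)"
    proof (rule integral_mono_AE)
      show "integrable M (\<lambda>\<omega>. norm (F (chain (t / m) m \<omega>) - F (restrict (\<eta> t \<omega>) V)))"
        using ic int by (intro integrable_norm Bochner_Integration.integrable_diff)
      show "integrable M (\<lambda>\<omega>. 2 * B * indicator (bad m) \<omega>)" by (simp add: emeasure_eq_measure)
      show "AE \<omega> in M. norm (F (chain (t / m) m \<omega>) - F (restrict (\<eta> t \<omega>) V)) \<le> 2 * B * indicator (bad m) \<omega>"
        using AE_K agree[OF that]
      proof eventually_elim
        case (elim \<omega>)
        have "\<bar>F (chain (t / m) m \<omega>)\<bar> \<le> B" "\<bar>F (restrict (\<eta> t \<omega>) V)\<bar> \<le> B"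
          by (rule F(2), rule chain_in_K) (rule F(2), rule elim)
        then show ?case using elim by (auto simp: indicator_def)
      qed
    qed
    also have "\<dots> = 2 * B * prob (bad m)" by simp
    also have "\<dots> \<le> 2 * B * ((t * card E)\<^sup>2 / m)"
      using bad_prob[OF that] B by (intro mult_left_mono) auto
    finally show ?thesis by simp
  qed
  then have "(\<lambda>m. ?A m - ?L) \<longlonglongrightarrow> 0"
    by (intro Lim_null_comparison[OF _ lim0[of "2 * B * (t * card E)\<^sup>2"]]) (auto intro!: eventually_sequentiallyI[of 1])
  then show "?A \<longlonglongrightarrow> ?L" by (simp add: LIM_zero_iff)
qed

section \<open>Fourier analysis on the hypercube\<close>

text \<open>The Walsh characters of the group \<open>(Z / 2) ^ d\<close>.\<close>

definition chi :: "nat set \<Rightarrow> (nat \<Rightarrow> nat) \<Rightarrow> real" where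
  "chi S x = (\<Prod>i\<in>S. (- 1) ^ x i)"

definition flip :: "nat \<Rightarrow> (nat \<Rightarrow> nat) \<Rightarrow> nat \<Rightarrow> nat" where
  "flip i x = x(i := 1 - x i)"

text \<open>Unnormalised: the empty set gives the total mass, the coefficients of a probability lie
  in \<open>[-1, 1]\<close>, and Parseval carries the factor \<open>2 ^ d\<close>.\<close>

definition fourier :: "nat \<Rightarrow> nat set \<Rightarrow> ((nat \<Rightarrow> nat) \<Rightarrow> real) \<Rightarrow> real" where
  "fourier d S \<eta> = (\<Sum>x\<in>cube d. \<eta> x * chi S x)"

lemma finite_cube [simp]: "finite (cube d)"
  by (auto simp: cube_def intro!: finite_PiE)

lemma card_cube [simp]: "card (cube d) = 2 ^ d"
  by (simp add: cube_def card_PiE numeral_2_eq_2)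

lemma cube_cases: "x \<in> cube d \<Longrightarrow> i < d \<Longrightarrow> x i = 0 \<or> x i = 1"
  by (auto simp: cube_def PiE_def Pi_def)

lemma flip_in_cube [simp]: "i < d \<Longrightarrow> x \<in> cube d \<Longrightarrow> flip i x \<in> cube d"
  by (auto simp: cube_def PiE_def Pi_def extensional_def flip_def)

lemma flip_flip [simp]: "x \<in> cube d \<Longrightarrow> i < d \<Longrightarrow> flip i (flip i x) = x"
  using cube_cases[of x d i] by (auto simp: flip_def)

lemma flip_same [simp]: "flip i x i = 1 - x i"
  by (simp add: flip_def)

lemma flip_other: "j \<noteq> i \<Longrightarrow> flip i x j = x j"
  by (simp add: flip_def)

lemma flip_neq [simp]: "flip i x \<noteq> x" "x \<noteq> flip i x"
proof -
  have "flip i x i \<noteq> x i" by (cases "x i") auto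
  then show "flip i x \<noteq> x" "x \<noteq> flip i x" by metis+
qed

lemma chi_flip:
  assumes "finite S" "x \<in> cube d" "i < d"
  shows "chi S (flip i x) = (if i \<in> S then - chi S x else chi S x)"
proof (cases "i \<in> S")
  case True
  have "(\<Prod>j\<in>S - {i}. (- 1) ^ flip i x j) = (\<Prod>j\<in>S - {i}. (- 1 :: real) ^ x j)"
    by (intro prod.cong) (auto simp: flip_def)
  then show ?thesis
    using assms True cube_cases[of x d i]
    by (auto simp: chi_def prod.remove[of S i] flip_def)
next
  case False
  then show ?thesis by (auto simp: chi_def flip_def intro!: prod.cong)
qed

lemma chi_square [simp]: "chi S x * chi S x = 1"
  by (simp add: chi_def flip: prod.distrib power_mult_distrib)

lemma abs_chi [simp]: "\<bar>chi S x\<bar> = 1"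
  by (simp add: chi_def abs_prod power_abs)

lemma sum_flip:
  assumes "i < d"
  shows "(\<Sum>x\<in>cube d. f (flip i x)) = (\<Sum>x\<in>cube d. f x)"
  by (rule sum.reindex_bij_witness[of _ "flip i" "flip i"]) (use assms in auto)

lemma sum_cube_halves:
  fixes f :: "(nat \<Rightarrow> nat) \<Rightarrow> real"
  assumes "i < d"
  shows "(\<Sum>x\<in>cube d. f x) = (\<Sum>x\<in>{x\<in>cube d. x i = 0}. f x + f (flip i x))"
proof -
  have "(\<Sum>x\<in>cube d. f x) = (\<Sum>x\<in>{x\<in>cube d. x i = 0} \<union> {x\<in>cube d. x i = 1}. f x)"
    using cube_cases[OF _ assms] by (intro sum.cong) auto
  also have "\<dots> = (\<Sum>x\<in>{x\<in>cube d. x i = 0}. f x) + (\<Sum>x\<in>{x\<in>cube d. x i = 1}. f x)"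
    by (rule sum.union_disjoint) auto
  also have "(\<Sum>x\<in>{x\<in>cube d. x i = 1}. f x) = (\<Sum>x\<in>{x\<in>cube d. x i = 0}. f (flip i x))"
    by (rule sum.reindex_bij_witness[of _ "flip i" "flip i"]) (use assms in auto)
  finally show ?thesis by (simp add: sum.distrib)
qed

section \<open>Edges of the cube\<close>

lemma cube_edgeI:
  assumes "x \<in> cube d" "i < d"
  shows "{x, flip i x} \<in> cube_edges d"
proof -
  have "x i \<noteq> flip i x i" by (cases "x i") auto
  then have "{j\<in>{..<d}. x j \<noteq> flip i x j} = {i}"
    using assms(2) by (auto simp: flip_def split: if_splits)
  then have "card {j\<in>{..<d}. x j \<noteq> flip i x j} = 1" by simp
  then show ?thesis unfolding cube_edges_def using assms flip_in_cube by blast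
qed

lemma cube_edges_eq: "cube_edges d = (\<lambda>(i, x). {x, flip i x}) ` (SIGMA i:{..<d}. {x\<in>cube d. x i = 0})"
  (is "_ = ?e ` ?I")
proof (intro equalityI subsetI)
  fix e assume "e \<in> cube_edges d"
  then obtain x y where e: "e = {x, y}" and xy: "x \<in> cube d" "y \<in> cube d" "card {i\<in>{..<d}. x i \<noteq> y i} = 1"
    by (auto simp: cube_edges_def)
  then obtain i where i: "{i\<in>{..<d}. x i \<noteq> y i} = {i}" by (auto simp: card_1_singleton_iff)
  then have "i < d" "x i \<noteq> y i" by auto
  have "x j = y j" if "j \<noteq> i" for j
    using i that xy by (cases "j < d") (auto simp: cube_def PiE_def extensional_def)
  then have "y = flip i x" "x = flip i y"
    using \<open>x i \<noteq> y i\<close> cube_cases[OF xy(1) \<open>i < d\<close>] cube_cases[OF xy(2) \<open>i < d\<close>]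
    by (auto simp: flip_def fun_eq_iff)
  moreover have "x i = 0 \<or> y i = 0"
    using \<open>x i \<noteq> y i\<close> cube_cases[OF xy(1) \<open>i < d\<close>] cube_cases[OF xy(2) \<open>i < d\<close>] by auto
  ultimately show "e \<in> ?e ` ?I"
    using xy \<open>i < d\<close> e by (auto intro: image_eqI[of _ _ "(i, x)"] image_eqI[of _ _ "(i, y)"])
next
  fix e assume "e \<in> ?e ` ?I"
  then obtain i x where "i < d" "x \<in> cube d" "x i = 0" "e = {x, flip i x}" by auto
  then show "e \<in> cube_edges d" by (simp add: cube_edgeI)
qed

text \<open>An edge has one direction \<open>i\<close> and one end point with coordinate
  \<open>0\<close> in that direction, so this parametrisation counts no edge twice.\<close>

lemma sum_cube_edges:
  "(\<Sum>e\<in>cube_edges d. f e) = (\<Sum>i<d. \<Sum>x\<in>{x\<in>cube d. x i = 0}. f {x, flip i x})"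
proof -
  let ?I = "SIGMA i:{..<d}. {x\<in>cube d. x i = 0}" and ?e = "\<lambda>(i, x). {x, flip i x}"
  have "inj_on ?e ?I"
  proof (rule inj_onI, clarify)
    fix i j x y assume ij: "i < d" "j < d" "x i = 0" "y j = 0" and "{x, flip i x} = {y, flip j y}"
    then have "x = y \<and> flip i x = flip j y \<or> x = flip j y \<and> flip i x = y"
      by (simp only: doubleton_eq_iff)
    then show "i = j \<and> x = y"
    proof (elim disjE conjE)
      assume eq: "x = y" "flip i x = flip j y"
      have "i = j"
      proof (rule ccontr)
        assume "i \<noteq> j"
        then have "flip i x i = x i" using eq flip_other[of i j y] by metis
        then show False using ij by simp
      qed
      then show ?thesis using eq by simp
    next
      assume eq: "x = flip j y" "flip i x = y"
      have "x j = 1" "flip i x j = 0" using eq ij by (metis flip_same diff_zero) (use eq ij in simp)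
      then have "i = j" using flip_other[of j i x] by fastforce
      then show ?thesis using ij \<open>x j = 1\<close> by simp
    qed
  qed
  then have "(\<Sum>e\<in>cube_edges d. f e) = (\<Sum>p\<in>?I. f (?e p))"
    by (simp only: cube_edges_eq sum.reindex comp_def)
  also have "\<dots> = (\<Sum>(i, x)\<in>?I. f {x, flip i x})"
    by (intro sum.cong) auto
  finally have "(\<Sum>e\<in>cube_edges d. f e) = (\<Sum>(i, x)\<in>?I. f {x, flip i x})" .
  then show ?thesis by (simp add: sum.Sigma)
qed

lemma finite_cube_edges [simp]: "finite (cube_edges d)"
proof -
  have "cube_edges d \<subseteq> (\<lambda>(x, y). {x, y}) ` (cube d \<times> cube d)"
    by (auto simp: cube_edges_def)
  then show ?thesis by (rule finite_subset) auto
qed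

lemma cube_edgesD: "e \<in> cube_edges d \<Longrightarrow> finite e \<and> e \<subseteq> cube d \<and> card e = 2"
proof -
  assume "e \<in> cube_edges d"
  then obtain x y where "e = {x, y}" "x \<in> cube d" "y \<in> cube d" "card {i\<in>{..<d}. x i \<noteq> y i} = 1"
    by (auto simp: cube_edges_def)
  moreover then have "x \<noteq> y" by auto
  ultimately show ?thesis by auto
qed

lemma cube_edges_nonempty:
  assumes "0 < d" shows "cube_edges d \<noteq> {}"
proof -
  let ?x = "\<lambda>i\<in>{..<d}. 0 :: nat"
  have "?x \<in> cube d" by (auto simp: cube_def)
  then have "{?x, flip 0 ?x} \<in> cube_edges d" using assms by (rule cube_edgeI)
  then show ?thesis by auto
qed

section \<open>Averaging in Fourier coordinates\<close>

lemma average_edge_pair: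
  "x \<noteq> y \<Longrightarrow> average_edge {x, y} \<eta> z =
    \<eta> z - (if z = x then (\<eta> x - \<eta> y) / 2 else 0) + (if z = y then (\<eta> x - \<eta> y) / 2 else 0)"
  by (auto simp: average_edge_def field_simps)

text \<open>Averaging moves the mass \<open>(\<eta> x - \<eta> (flip i x)) / 2\<close> from
  \<open>x\<close> to \<open>flip i x\<close>, where \<open>chi S\<close> has the opposite sign if
  \<open>i \<in> S\<close> and the same value otherwise.\<close>

lemma fourier_average_edge:
  assumes "x \<in> cube d" "i < d" "finite S"
  shows "fourier d S (average_edge {x, flip i x} \<eta>) =
    fourier d S \<eta> - (if i \<in> S then (\<eta> x - \<eta> (flip i x)) * chi S x else 0)"
proof -
  let ?D = "(\<eta> x - \<eta> (flip i x)) / 2"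
  have "fourier d S (average_edge {x, flip i x} \<eta>) = (\<Sum>z\<in>cube d. \<eta> z * chi S z
      - (if z = x then ?D * chi S z else 0) + (if z = flip i x then ?D * chi S z else 0))"
    unfolding fourier_def by (intro sum.cong) (auto simp: average_edge_pair algebra_simps)
  also have "\<dots> = fourier d S \<eta> - ?D * chi S x + ?D * chi S (flip i x)"
    unfolding fourier_def using assms by (simp add: sum.distrib sum_subtractf)
  finally show ?thesis using assms by (auto simp: chi_flip field_simps)
qed

lemma fourier_flip:
  assumes "i < d" "finite S"
  shows "fourier d S (\<lambda>x. \<eta> (flip i x)) = (if i \<in> S then - fourier d S \<eta> else fourier d S \<eta>)"
proof -
  have "fourier d S (\<lambda>x. \<eta> (flip i x)) = (\<Sum>x\<in>cube d. \<eta> (flip i (flip i x)) * chi S (flip i x))"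
    unfolding fourier_def using assms sum_flip[of i d "\<lambda>x. \<eta> (flip i x) * chi S x"] by simp
  also have "\<dots> = (\<Sum>x\<in>cube d. if i \<in> S then - (\<eta> x * chi S x) else \<eta> x * chi S x)"
    using assms by (intro sum.cong) (auto simp: chi_flip)
  finally show ?thesis by (auto simp: fourier_def sum_negf)
qed

lemma sum_gradient_chi:
  assumes "i \<in> S" "i < d" "finite S"
  shows "(\<Sum>x\<in>{x\<in>cube d. x i = 0}. (\<eta> x - \<eta> (flip i x)) * chi S x) = fourier d S \<eta>"
  unfolding fourier_def sum_cube_halves[OF assms(2)]
  using assms by (intro sum.cong) (auto simp: chi_flip algebra_simps)

text \<open>The sum over \<open>S\<close> expands the product over \<open>i\<close> of
  \<open>(- 1) ^ x i * (- 1) ^ y i + 1\<close>, whose factors are \<open>0\<close> where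
  \<open>x\<close> and \<open>y\<close> differ and \<open>2\<close> elsewhere.\<close>

lemma sum_chi_chi:
  assumes "x \<in> cube d" "y \<in> cube d"
  shows "(\<Sum>S\<in>Pow {..<d}. chi S x * chi S y) = (if x = y then 2 ^ d else 0)"
proof -
  have "(\<Sum>S\<in>Pow {..<d}. chi S x * chi S y) = (\<Sum>S\<in>Pow {..<d}. (\<Prod>i\<in>S. (- 1) ^ x i * (- 1) ^ y i) * (\<Prod>i\<in>{..<d} - S. 1))"
    by (simp add: chi_def prod.distrib)
  also have "\<dots> = (\<Prod>i<d. (- 1) ^ x i * (- 1) ^ y i + (1::real))"
    by (subst prod_add) auto
  also have "\<dots> = (if x = y then 2 ^ d else 0)"
  proof (cases "x = y")
    case True
    then show ?thesis by (simp flip: power_mult_distrib)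
  next
    case False
    then obtain i where "x i \<noteq> y i" by auto
    then have "i < d" using assms by (cases "i < d") (auto simp: cube_def PiE_def extensional_def)
    then have "(- 1) ^ x i * (- 1) ^ y i + (1::real) = 0"
      using \<open>x i \<noteq> y i\<close> cube_cases[OF assms(1)] cube_cases[OF assms(2)] by fastforce
    then show ?thesis using False \<open>i < d\<close> by (auto intro!: prod_zero)
  qed
  finally show ?thesis .
qed

lemma parseval: "(\<Sum>S\<in>Pow {..<d}. (fourier d S \<eta>)\<^sup>2) = 2 ^ d * (\<Sum>x\<in>cube d. (\<eta> x)\<^sup>2)"
proof -
  have "(\<Sum>S\<in>Pow {..<d}. (fourier d S \<eta>)\<^sup>2)
      = (\<Sum>S\<in>Pow {..<d}. \<Sum>x\<in>cube d. \<Sum>y\<in>cube d. \<eta> x * \<eta> y * (chi S x * chi S y))"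
    by (simp add: fourier_def power2_eq_square sum_product algebra_simps)
  also have "\<dots> = (\<Sum>x\<in>cube d. \<Sum>y\<in>cube d. \<eta> x * \<eta> y * (\<Sum>S\<in>Pow {..<d}. chi S x * chi S y))"
    by (subst sum.swap, intro sum.cong refl, subst sum.swap) (simp add: sum_distrib_left)
  also have "\<dots> = (\<Sum>x\<in>cube d. \<Sum>y\<in>cube d. if y = x then 2 ^ d * (\<eta> x)\<^sup>2 else 0)"
    by (intro sum.cong refl) (auto simp: sum_chi_chi power2_eq_square)
  finally show ?thesis by (simp add: sum_distrib_left)
qed

text \<open>Parseval for the discrete gradient, whose coefficient is
  \<open>2 * fourier d S \<eta>\<close> if \<open>i \<in> S\<close> and \<open>0\<close> otherwise.
  The resulting factor \<open>4\<close> is halved because the full cube sees each edge from both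
  ends. This is the source of the coupling.\<close>

lemma sum_gradient_square:
  assumes "i < d"
  shows "(\<Sum>x\<in>{x\<in>cube d. x i = 0}. (\<eta> x - \<eta> (flip i x))\<^sup>2)
    = 2 / 2 ^ d * (\<Sum>S | S \<subseteq> {..<d} \<and> i \<in> S. (fourier d S \<eta>)\<^sup>2)"
proof -
  let ?g = "\<lambda>x. \<eta> x - \<eta> (flip i x)"
  have fin: "finite S" if "S \<in> Pow {..<d}" for S using that by (auto intro: finite_subset)
  have "fourier d S ?g = fourier d S \<eta> - fourier d S (\<lambda>x. \<eta> (flip i x))" for S
    by (simp add: fourier_def algebra_simps sum_subtractf)
  then have "fourier d S ?g = (if i \<in> S then 2 * fourier d S \<eta> else 0)" if "S \<in> Pow {..<d}" for S
    using fourier_flip[OF assms fin[OF that]] by simp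
  then have "(\<Sum>S\<in>Pow {..<d}. (fourier d S ?g)\<^sup>2) = (\<Sum>S\<in>Pow {..<d}. if i \<in> S then 4 * (fourier d S \<eta>)\<^sup>2 else 0)"
    by (intro sum.cong) auto
  also have "\<dots> = (\<Sum>S | S \<subseteq> {..<d} \<and> i \<in> S. 4 * (fourier d S \<eta>)\<^sup>2)"
    by (subst sum.inter_filter[symmetric]) auto
  finally have "2 ^ d * (\<Sum>x\<in>cube d. (?g x)\<^sup>2) = 4 * (\<Sum>S | S \<subseteq> {..<d} \<and> i \<in> S. (fourier d S \<eta>)\<^sup>2)"
    by (simp add: parseval sum_distrib_left)
  moreover have "(\<Sum>x\<in>cube d. (?g x)\<^sup>2) = 2 * (\<Sum>x\<in>{x\<in>cube d. x i = 0}. (?g x)\<^sup>2)"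
    unfolding sum_cube_halves[OF assms] sum_distrib_left
    using assms by (intro sum.cong) (auto simp: power2_commute)
  ultimately show ?thesis by (simp add: field_simps)
qed

lemma sum_if_subset:
  assumes "S \<subseteq> A" "finite A"
  shows "(\<Sum>i\<in>A. if i \<in> S then f i else 0) = sum f S"
  using assms by (simp add: sum.inter_restrict[symmetric] Int_absorb1)

lemma avg_op_fourier:
  assumes "S \<subseteq> {..<d}"
  shows "avg_op (cube_edges d) h (fourier d S) = (\<lambda>\<eta>. (1 - h * card S) * fourier d S \<eta>)"
proof
  fix \<eta> :: "(nat \<Rightarrow> nat) \<Rightarrow> real"
  have fin: "finite S" using assms by (auto intro: finite_subset)
  have "(\<Sum>e\<in>cube_edges d. fourier d S (average_edge e \<eta>) - fourier d S \<eta>) =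
      (\<Sum>i<d. if i \<in> S then - (\<Sum>x\<in>{x\<in>cube d. x i = 0}. (\<eta> x - \<eta> (flip i x)) * chi S x) else 0)"
    unfolding sum_cube_edges using fin
    by (intro sum.cong refl) (auto simp: fourier_average_edge sum_negf intro!: sum.cong sum.neutral)
  also have "\<dots> = (\<Sum>i<d. if i \<in> S then - fourier d S \<eta> else 0)"
    by (intro sum.cong refl if_cong) (simp add: sum_gradient_chi fin)
  also have "\<dots> = (\<Sum>i\<in>S. - fourier d S \<eta>)"
    using assms by (intro sum_if_subset) auto
  finally show "avg_op (cube_edges d) h (fourier d S) \<eta> = (1 - h * card S) * fourier d S \<eta>"
    by (simp add: avg_op_def algebra_simps)
qed

text \<open>With \<open>a\<close> the coefficient and \<open>b\<close> its loss on one edge,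
  \<open>(a - b)\<^sup>2 - a\<^sup>2 = b\<^sup>2 - 2 * a * b\<close>. Over a direction
  \<open>i \<in> S\<close> the losses \<open>b\<close> sum to \<open>a\<close>, which gives the
  decay. In \<open>b\<^sup>2\<close> the character disappears, which leaves the gradient energy in
  direction \<open>i\<close> and so couples \<open>S\<close> to all sets containing
  \<open>i\<close>.\<close>

lemma avg_op_fourier_square:
  assumes "S \<subseteq> {..<d}"
  shows "avg_op (cube_edges d) h (\<lambda>\<eta>. (fourier d S \<eta>)\<^sup>2) = (\<lambda>\<eta>. (1 - 2 * h * card S) * (fourier d S \<eta>)\<^sup>2
    + 2 * h / 2 ^ d * (\<Sum>i\<in>S. \<Sum>R | R \<subseteq> {..<d} \<and> i \<in> R. (fourier d R \<eta>)\<^sup>2))"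
proof
  fix \<eta> :: "(nat \<Rightarrow> nat) \<Rightarrow> real"
  have fin: "finite S" using assms by (auto intro: finite_subset)
  let ?D = "\<lambda>i x. \<eta> x - \<eta> (flip i x)"
  let ?G = "\<lambda>i. \<Sum>R | R \<subseteq> {..<d} \<and> i \<in> R. (fourier d R \<eta>)\<^sup>2"
  have diff_sq: "(a - b)\<^sup>2 - a\<^sup>2 = b\<^sup>2 - 2 * a * b" for a b :: real
    by (simp add: power2_diff)
  have sq: "(?D i x * chi S x)\<^sup>2 = (?D i x)\<^sup>2" for i x
    using chi_square[of S x] by (simp add: power_mult_distrib power2_eq_square)
  have "(\<Sum>e\<in>cube_edges d. (fourier d S (average_edge e \<eta>))\<^sup>2 - (fourier d S \<eta>)\<^sup>2) =
      (\<Sum>i<d. if i \<in> S then (\<Sum>x\<in>{x\<in>cube d. x i = 0}. (?D i x)\<^sup>2 - 2 * fourier d S \<eta> * (?D i x * chi S x)) else 0)"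
    unfolding sum_cube_edges using fin
    by (intro sum.cong refl) (auto simp: fourier_average_edge diff_sq sq intro!: sum.cong)
  also have "\<dots> = (\<Sum>i<d. if i \<in> S then 2 / 2 ^ d * ?G i - 2 * fourier d S \<eta> * fourier d S \<eta> else 0)"
  proof (intro sum.cong refl if_cong)
    fix i assume "i \<in> {..<d}" "i \<in> S"
    then show "(\<Sum>x\<in>{x\<in>cube d. x i = 0}. (?D i x)\<^sup>2 - 2 * fourier d S \<eta> * (?D i x * chi S x)) =
        2 / 2 ^ d * ?G i - 2 * fourier d S \<eta> * fourier d S \<eta>"
      using sum_gradient_square[of i d \<eta>] sum_gradient_chi[of i S d \<eta>] fin
      unfolding sum_subtractf sum_distrib_left[symmetric] by simp
  qed
  also have "\<dots> = (\<Sum>i\<in>S. 2 / 2 ^ d * ?G i - 2 * fourier d S \<eta> * fourier d S \<eta>)"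
    using assms by (intro sum_if_subset) auto
  also have "\<dots> = 2 / 2 ^ d * (\<Sum>i\<in>S. ?G i) - 2 * card S * (fourier d S \<eta>)\<^sup>2"
    by (simp add: sum_subtractf sum_distrib_left power2_eq_square)
  finally have eq: "(\<Sum>e\<in>cube_edges d. (fourier d S (average_edge e \<eta>))\<^sup>2 - (fourier d S \<eta>)\<^sup>2) =
      2 / 2 ^ d * (\<Sum>i\<in>S. ?G i) - 2 * card S * (fourier d S \<eta>)\<^sup>2" .
  show "avg_op (cube_edges d) h (\<lambda>\<eta>. (fourier d S \<eta>)\<^sup>2) \<eta> = (1 - 2 * h * card S) * (fourier d S \<eta>)\<^sup>2
      + 2 * h / 2 ^ d * (\<Sum>i\<in>S. ?G i)"
    unfolding avg_op_def eq by (simp add: algebra_simps)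
qed

section \<open>Powers of the averaging operator\<close>

lemma avg_op_lincomb:
  "avg_op E h (\<lambda>\<eta>. a * F \<eta> + b * G \<eta>) = (\<lambda>\<eta>. a * avg_op E h F \<eta> + b * avg_op E h G \<eta>)"
proof
  fix \<eta>
  have "(\<Sum>e\<in>E. a * F (average_edge e \<eta>) + b * G (average_edge e \<eta>) - (a * F \<eta> + b * G \<eta>))
      = (\<Sum>e\<in>E. a * (F (average_edge e \<eta>) - F \<eta>) + b * (G (average_edge e \<eta>) - G \<eta>))"
    by (intro sum.cong) (auto simp: algebra_simps)
  also have "\<dots> = a * (\<Sum>e\<in>E. F (average_edge e \<eta>) - F \<eta>) + b * (\<Sum>e\<in>E. G (average_edge e \<eta>) - G \<eta>)"
    unfolding sum.distrib sum_distrib_left ..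
  finally show "avg_op E h (\<lambda>\<eta>. a * F \<eta> + b * G \<eta>) \<eta> = a * avg_op E h F \<eta> + b * avg_op E h G \<eta>"
    unfolding avg_op_def by (simp only:) (simp add: algebra_simps)
qed

lemma funpow_avg_op_lincomb:
  "(avg_op E h ^^ m) (\<lambda>\<eta>. a * F \<eta> + b * G \<eta>) = (\<lambda>\<eta>. a * (avg_op E h ^^ m) F \<eta> + b * (avg_op E h ^^ m) G \<eta>)"
proof (induction m)
  case (Suc m)
  show ?case by (simp only: funpow.simps o_apply Suc avg_op_lincomb)
qed simp

lemma funpow_avg_op_sum:
  assumes "finite I"
  shows "(avg_op E h ^^ m) (\<lambda>\<eta>. \<Sum>k\<in>I. F k \<eta>) = (\<lambda>\<eta>. \<Sum>k\<in>I. (avg_op E h ^^ m) (F k) \<eta>)"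
  using assms
proof induction
  case empty
  show ?case using funpow_avg_op_lincomb[where a=0 and b=0 and F="\<lambda>_. 0" and G="\<lambda>_. 0"] by simp
next
  case (insert k I)
  show ?case using insert funpow_avg_op_lincomb[where a=1 and b=1 and F="F k" and G="\<lambda>\<eta>. \<Sum>k\<in>I. F k \<eta>"] by simp
qed

lemma funpow_avg_op_fourier:
  assumes "S \<subseteq> {..<d}"
  shows "(avg_op (cube_edges d) h ^^ m) (fourier d S) = (\<lambda>\<eta>. (1 - h * card S) ^ m * fourier d S \<eta>)"
proof (induction m)
  case (Suc m)
  show ?case
    using avg_op_lincomb[where a="(1 - h * card S) ^ m" and F="fourier d S" and b=0 and G="\<lambda>_. 0"]
    by (simp add: Suc avg_op_fourier[OF assms] mult_ac)
qed simp

text \<open>The additional step is applied innermost, to the observable itself, where the operator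
  maps a square to a combination of squares; linearity carries the outer power through that
  combination.\<close>

lemma funpow_avg_op_fourier_square:
  fixes \<xi> :: "(nat \<Rightarrow> nat) \<Rightarrow> real" and h :: real
  assumes "S \<subseteq> {..<d}"
  defines "U \<equiv> \<lambda>m S. (avg_op (cube_edges d) h ^^ m) (\<lambda>\<eta>. (fourier d S \<eta>)\<^sup>2) \<xi>"
  shows "U (Suc m) S = (1 - 2 * h * card S) * U m S
    + 2 * h / 2 ^ d * (\<Sum>i\<in>S. \<Sum>R | R \<subseteq> {..<d} \<and> i \<in> R. U m R)"
proof -
  have fin: "finite S" "\<And>i. finite {R. R \<subseteq> {..<d} \<and> i \<in> R}"
    using assms by (auto intro: finite_subset)
  show ?thesis
    unfolding U_def funpow_Suc_right o_apply avg_op_fourier_square[OF assms(1)]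
    by (subst funpow_avg_op_lincomb) (simp add: funpow_avg_op_sum fin)
qed

section \<open>Supersolutions for the second moments\<close>

lemma sum_power_card_Pow:
  fixes x :: real
  assumes "finite A"
  shows "(\<Sum>R\<in>Pow A. x ^ card R) = (1 + x) ^ card A"
proof -
  have "(\<Prod>i\<in>A. x + 1) = (\<Sum>R\<in>Pow A. (\<Prod>i\<in>R. x) * (\<Prod>i\<in>A - R. 1))"
    using assms by (rule prod_add)
  then show ?thesis by (simp add: add.commute)
qed

lemma sum_power_card_containing:
  fixes x :: real
  assumes "i < d"
  shows "(\<Sum>R | R \<subseteq> {..<d} \<and> i \<in> R. x ^ card R) = x * (1 + x) ^ (d - 1)"
proof -
  have "(\<Sum>R | R \<subseteq> {..<d} \<and> i \<in> R. x ^ card R) = (\<Sum>R\<in>Pow ({..<d} - {i}). x * x ^ card R)"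
  proof (rule sum.reindex_bij_witness[of _ "insert i" "\<lambda>R. R - {i}"])
    fix R assume "R \<in> {R. R \<subseteq> {..<d} \<and> i \<in> R}"
    then have "finite R" "i \<in> R" by (auto intro: finite_subset)
    then have "card R = Suc (card (R - {i}))" by (rule card.remove)
    then show "x * x ^ card (R - {i}) = x ^ card R" by (simp only: power_Suc)
  qed (use assms in auto)
  also have "\<dots> = x * (1 + x) ^ (d - 1)"
    using assms by (simp add: sum_power_card_Pow flip: sum_distrib_left)
  finally show ?thesis .
qed

text \<open>Twice the bound \<open>2 * \<theta> * exp (d * \<theta>) / 2 ^ d\<close> on the feedback of the profile \<open>\<theta> ^ |S|\<close>
  through the coupling.\<close>

definition excess :: "nat \<Rightarrow> real \<Rightarrow> real" where
  "excess d \<theta> = 4 * \<theta> * exp (d * \<theta>) / 2 ^ d"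

text \<open>The condition \<open>2 * h * d \<le> 1\<close> keeps all coefficients nonnegative. A
  step is then monotone in \<open>U\<close>, which is the discrete form of cooperativity behind all
  comparisons below.\<close>

locale cooperative_flow =
  fixes d :: nat and h :: real and U :: "nat \<Rightarrow> nat set \<Rightarrow> real"
  assumes h: "0 < h" "2 * h * d \<le> 1"
    and init: "\<And>S. S \<subseteq> {..<d} \<Longrightarrow> U 0 S \<le> 1"
    and step: "\<And>m S. S \<subseteq> {..<d} \<Longrightarrow> U (Suc m) S = (1 - 2 * h * card S) * U m S
      + 2 * h / 2 ^ d * (\<Sum>i\<in>S. \<Sum>R | R \<subseteq> {..<d} \<and> i \<in> R. U m R)"
begin

text \<open>For \<open>i < d\<close> this is the mean of \<open>U m\<close> over the
  \<open>2 ^ (d - 1)\<close> sets containing \<open>i\<close>.\<close>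

definition W :: "nat \<Rightarrow> nat \<Rightarrow> real" where
  "W m i = 2 / 2 ^ d * (\<Sum>R | R \<subseteq> {..<d} \<and> i \<in> R. U m R)"

lemma card_le: "S \<subseteq> {..<d} \<Longrightarrow> card S \<le> d"
  using card_mono[of "{..<d}" S] by simp

lemma coeff_nonneg: "j \<le> d \<Longrightarrow> 0 \<le> 1 - 2 * h * real j"
proof -
  assume "j \<le> d"
  then have "2 * h * real j \<le> 2 * h * real d" using h by (intro mult_left_mono) auto
  then show ?thesis using h(2) by linarith
qed

lemma step_W:
  assumes "S \<subseteq> {..<d}"
  shows "U (Suc m) S = (1 - 2 * h * card S) * U m S + h * (\<Sum>i\<in>S. W m i)"
  using step[OF assms, of m] by (simp add: W_def sum_distrib_left mult_ac)

lemma W_mono: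
  assumes "\<And>R. R \<subseteq> {..<d} \<Longrightarrow> R \<noteq> {} \<Longrightarrow> U m R \<le> v (card R)"
  shows "W m i \<le> 2 / 2 ^ d * (\<Sum>R | R \<subseteq> {..<d} \<and> i \<in> R. v (card R))"
  unfolding W_def using assms by (intro mult_left_mono sum_mono) auto

lemma step_le:
  assumes S: "S \<subseteq> {..<d}" and "U m S \<le> u" "\<And>i. i < d \<Longrightarrow> W m i \<le> w"
  shows "U (Suc m) S \<le> (1 - 2 * h * card S) * u + h * card S * w"
proof -
  have "(\<Sum>i\<in>S. W m i) \<le> card S * w"
    using assms sum_bounded_above[of S "W m" w] by auto
  then have "h * (\<Sum>i\<in>S. W m i) \<le> h * (card S * w)" using h by simp
  moreover have "(1 - 2 * h * card S) * U m S \<le> (1 - 2 * h * card S) * u"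
    using assms(2) coeff_nonneg[OF card_le[OF S]] by (rule mult_left_mono)
  ultimately show ?thesis using step_W[OF S, of m] by simp
qed

text \<open>By monotonicity of a step. Since \<open>v\<close> depends on the cardinality only, the
  feedback enters through one number \<open>w l\<close>. The empty set, whose moment stays constant,
  is left out; it is never among the sets containing \<open>i\<close>. The start \<open>m0\<close>
  allows phases to be concatenated.\<close>

lemma comparison:
  assumes base: "\<And>S. S \<subseteq> {..<d} \<Longrightarrow> S \<noteq> {} \<Longrightarrow> U m0 S \<le> v 0 (card S)"
    and avg: "\<And>l i. l < L \<Longrightarrow> i < d \<Longrightarrow> 2 / 2 ^ d * (\<Sum>R | R \<subseteq> {..<d} \<and> i \<in> R. v l (card R)) \<le> w l"
    and super: "\<And>l j. l < L \<Longrightarrow> 1 \<le> j \<Longrightarrow> j \<le> d \<Longrightarrow> (1 - 2 * h * j) * v l j + h * j * w l \<le> v (Suc l) j"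
    and "l \<le> L" "S \<subseteq> {..<d}" "S \<noteq> {}"
  shows "U (m0 + l) S \<le> v l (card S)"
  using assms(4-)
proof (induction l arbitrary: S)
  case 0
  then show ?case using base by simp
next
  case (Suc l)
  have IH: "U (m0 + l) R \<le> v l (card R)" if "R \<subseteq> {..<d}" "R \<noteq> {}" for R
    using Suc that by simp
  have "W (m0 + l) i \<le> w l" if "i < d" for i
    using W_mono[of "m0 + l" "v l" i] IH avg[of l i] that Suc.prems by force
  then have "U (Suc (m0 + l)) S \<le> (1 - 2 * h * card S) * v l (card S) + h * card S * w l"
    using Suc.prems IH by (intro step_le) auto
  also have "\<dots> \<le> v (Suc l) (card S)"
    using Suc.prems card_le by (intro super) (auto simp: Suc_le_eq card_gt_0_iff intro: finite_subset)
  finally show ?case by simp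
qed

text \<open>For a uniformly random set containing \<open>i\<close> the other \<open>d - 1\<close>
  memberships are independent fair coins, each contributing a factor
  \<open>(1 + x) / 2\<close>.\<close>

lemma sum_containing_affine:
  fixes a b x :: real
  assumes "i < d"
  shows "2 / 2 ^ d * (\<Sum>R | R \<subseteq> {..<d} \<and> i \<in> R. a * x ^ card R + b) = a * x * ((1 + x) / 2) ^ (d - 1) + b"
proof -
  have "(\<Sum>R | R \<subseteq> {..<d} \<and> i \<in> R. a * x ^ card R + b)
      = a * (\<Sum>R | R \<subseteq> {..<d} \<and> i \<in> R. x ^ card R) + b * (\<Sum>R | R \<subseteq> {..<d} \<and> i \<in> R. 1 ^ card R)"
    by (simp add: sum.distrib sum_distrib_left)
  also have "\<dots> = a * (x * (1 + x) ^ (d - 1)) + b * (1 * (1 + 1) ^ (d - 1))"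
    unfolding sum_power_card_containing[OF assms] ..
  finally have "(\<Sum>R | R \<subseteq> {..<d} \<and> i \<in> R. a * x ^ card R + b)
      = a * (x * (1 + x) ^ (d - 1)) + b * 2 ^ (d - 1)" by simp
  moreover have "(2::real) ^ d = 2 * 2 ^ (d - 1)" using assms by (cases d) auto
  ultimately show ?thesis by (simp add: power_divide field_simps)
qed

lemma le_one:
  assumes "S \<subseteq> {..<d}" "S \<noteq> {}"
  shows "U m S \<le> 1"
proof -
  have "U (0 + m) S \<le> 1"
  proof (rule comparison[where v="\<lambda>_ _. 1" and w="\<lambda>_. 1" and L=m])
    show "2 / 2 ^ d * (\<Sum>R | R \<subseteq> {..<d} \<and> i \<in> R. 1) \<le> (1::real)" if "i < d" for i
      using sum_containing_affine[OF that, of 0 1 1] by simp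
    show "(1 - 2 * h * real j) * 1 + h * real j * 1 \<le> 1" for j
      using h by (simp add: algebra_simps)
  qed (use assms init in auto)
  then show ?thesis by simp
qed

text \<open>In the supersolution \<open>z powr (|S| - q * d) + P + exp (- q * d * h * m)\<close> the first summand is at
  least \<open>1\<close> for \<open>|S| \<le> q * d\<close>, where it makes up for the slow decay of \<open>U\<close>. Its weighted sum \<open>P\<close> over
  the sets containing \<open>i\<close> is Chernoff's bound for the proportion of sets of size at most \<open>q * d\<close>.\<close>

lemma crude_decay:
  fixes z q :: real
  assumes z: "0 < z" "z \<le> exp (- 1)" and q: "0 < q" and "i < d"
  shows "W m i \<le> 2 * (z powr (1 - q * d) * ((1 + z) / 2) ^ (d - 1)) + exp (- (q * d * (h * m)))"
proof -
  define P where "P = z powr (1 - q * d) * ((1 + z) / 2) ^ (d - 1)"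
  define E where "E l = exp (- (q * d * (h * real l)))" for l
  define v where "v l j = z powr (real j - q * d) + P + E l" for l j
  have v: "v l j = z powr (- (q * d)) * z ^ j + (P + E l)" for l j
    using z by (simp add: v_def powr_diff powr_minus powr_realpow field_simps)
  have P: "P = z powr (- (q * d)) * z * ((1 + z) / 2) ^ (d - 1)"
    using z by (simp add: P_def powr_diff powr_minus powr_one field_simps)
  have avg: "2 / 2 ^ d * (\<Sum>R | R \<subseteq> {..<d} \<and> i \<in> R. v l (card R)) = 2 * P + E l" if "i < d" for i l
    unfolding v sum_containing_affine[OF that] using P by simp
  have "0 \<le> P" using z by (simp add: P_def)
  have U: "U (0 + m) S \<le> v m (card S)" if "S \<subseteq> {..<d}" "S \<noteq> {}" for S m
  proof (rule comparison[where L=m and w="\<lambda>l. 2 * P + E l"])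
    show "U 0 S \<le> v 0 (card S)" if "S \<subseteq> {..<d}" for S
      using init[OF that] \<open>0 \<le> P\<close> by (simp add: v_def E_def add_increasing)
    fix l j :: nat assume j: "1 \<le> j" "j \<le> d"
    have El: "0 \<le> E l" "E l \<le> 1" using q h by (auto simp: E_def)
    \<comment> \<open>With the feedback \<open>2 * P + E l\<close> the terms in \<open>P\<close>
      cancel, and the supersolution inequality reduces to this bound on the decay of
      \<open>E\<close> at rate \<open>q * d\<close>.\<close>
    have "q * d * E l \<le> j * (2 * z powr (real j - q * d) + E l)"
    proof (cases "q * d \<le> j")
      case True
      then have "q * d * E l \<le> j * E l" using El by (intro mult_right_mono)
      also have "\<dots> \<le> j * (2 * z powr (real j - q * d) + E l)" by (intro mult_left_mono) auto
      finally show ?thesis .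
    next
      case False
      \<comment> \<open>\<open>y\<close> is what \<open>j\<close> lacks to \<open>q * d\<close>.
        Since \<open>z \<le> exp (- 1)\<close>, the power \<open>z powr (- y)\<close> is at least
        \<open>exp y\<close> and makes up for it.\<close>
      define y where "y = q * d - j"
      have "0 < y" using False by (simp add: y_def)
      have "1 + y \<le> exp y" by (rule exp_ge_add_one_self)
      also have "exp y \<le> z powr (- y)"
      proof -
        have "ln z \<le> - 1" using z ln_le_cancel_iff[of z "exp (- 1)"] by simp
        then have "y \<le> - y * ln z" using \<open>0 < y\<close> mult_left_mono[of "ln z" "- 1" y] by simp
        then show ?thesis using z by (simp add: powr_def)
      qed
      also have "- y = real j - q * d" by (simp add: y_def)
      finally have "1 + y \<le> z powr (real j - q * d)" .
      then have "y \<le> j * (2 * z powr (real j - q * d))"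
        using j \<open>0 < y\<close> mult_mono[of 1 "real j" y "2 * z powr (real j - q * d)"] by simp
      moreover have "y * E l \<le> y" using El \<open>0 < y\<close> by (simp add: mult_left_le)
      ultimately show ?thesis by (simp add: y_def algebra_simps)
    qed
    then have "h * (q * d * E l) \<le> h * (j * (2 * z powr (real j - q * d) + E l))"
      using h by (intro mult_left_mono) auto
    moreover have "E l * (1 - q * d * h) \<le> E (Suc l)"
    proof -
      have "1 - q * d * h \<le> exp (- (q * d * h))" using exp_ge_add_one_self[of "- (q * d * h)"] by simp
      then have "E l * (1 - q * d * h) \<le> E l * exp (- (q * d * h))" using El by (intro mult_left_mono)
      also have "\<dots> = E (Suc l)" by (simp add: E_def algebra_simps flip: exp_add)
      finally show ?thesis .
    qed
    ultimately show "(1 - 2 * h * j) * v l j + h * j * (2 * P + E l) \<le> v (Suc l) j"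
      by (simp add: v_def algebra_simps)
  qed (use that avg in auto)
  then show ?thesis
    using W_mono[of m "v m" i] avg[OF assms(4), of m] by (simp add: E_def P_def)
qed

text \<open>Under feedback \<open>2 * Q\<close> the constant \<open>Q\<close> is stationary, as
  \<open>(1 - 2 * h * j) * Q + h * j * (2 * Q) = Q\<close>. What lies above it starts from at most
  \<open>1\<close> and decays freely at rate \<open>2 * |S|\<close>.\<close>

lemma relaxation:
  assumes W: "\<And>m i. m0 \<le> m \<Longrightarrow> i < d \<Longrightarrow> W m i \<le> 2 * Q" and S: "S \<subseteq> {..<d}" "S \<noteq> {}"
    and "0 \<le> Q"
  shows "U (m0 + l) S \<le> exp (- (2 * (h * l))) ^ card S + Q"
proof -
  have "U (m0 + l) S \<le> (1 - 2 * h * card S) ^ l + Q"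
  proof (induction l)
    case 0
    then show ?case using le_one[OF S, of m0] assms(4) by simp
  next
    case (Suc l)
    have "U (Suc (m0 + l)) S \<le> (1 - 2 * h * card S) * ((1 - 2 * h * card S) ^ l + Q) + h * card S * (2 * Q)"
      by (intro step_le S Suc W) auto
    then show ?case by (simp add: algebra_simps)
  qed
  also have "(1 - 2 * h * card S) ^ l \<le> exp (- (2 * h * card S)) ^ l"
    using coeff_nonneg[OF card_le[OF S(1)]] exp_ge_add_one_self[of "- (2 * h * card S)"]
    by (intro power_mono) auto
  also have "\<dots> = exp (- (2 * (h * l))) ^ card S"
    by (simp add: mult_ac flip: exp_of_nat_mult)
  finally show ?thesis by simp
qed

end

section \<open>Elementary bounds and constants for the decay phases\<close>

lemma one_plus_power_le_exp:
  fixes x :: real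
  assumes "0 \<le> x" "k \<le> d"
  shows "(1 + x) ^ k \<le> exp (d * x)"
proof -
  have "(1 + x) ^ k \<le> exp x ^ k" using assms by (intro power_mono exp_ge_add_one_self) auto
  also have "\<dots> = exp (k * x)" by (simp add: exp_of_nat_mult)
  also have "\<dots> \<le> exp (d * x)" using assms by (simp add: mult_right_mono)
  finally show ?thesis .
qed

lemma excess_mono: "0 \<le> x \<Longrightarrow> x \<le> y \<Longrightarrow> excess d x \<le> excess d y"
  unfolding excess_def by (intro divide_right_mono mult_mono) (auto intro: mult_left_mono)

lemma excess_nonneg: "0 \<le> x \<Longrightarrow> 0 \<le> excess d x"
  by (simp add: excess_def)

lemma half_power_le_excess:
  fixes x :: real
  assumes "0 \<le> x" "0 < d"
  shows "x * ((1 + x) / 2) ^ (d - 1) \<le> excess d x / 2"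
proof -
  have "x * (1 + x) ^ (d - 1) \<le> x * exp (d * x)"
    using assms by (intro mult_left_mono one_plus_power_le_exp) auto
  moreover have "(2::real) ^ d = 2 * 2 ^ (d - 1)" using assms by (cases d) auto
  ultimately show ?thesis by (simp add: excess_def power_divide field_simps)
qed

text \<open>Running \<open>\<theta>\<close> at speed \<open>2 * (1 - \<epsilon>)\<close> instead of \<open>2\<close> leaves this room for the decay of
  \<open>excess d \<theta>\<close>.\<close>

definition slack :: "nat \<Rightarrow> real \<Rightarrow> real \<Rightarrow> bool" where
  "slack d \<epsilon> \<theta> \<longleftrightarrow> (\<forall>j::nat. 1 \<le> j \<longrightarrow>
     2 * (1 + d * \<theta>) * excess d \<theta> \<le> j * (2 * \<epsilon> * \<theta> ^ j + excess d \<theta> / 2))"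

text \<open>The choice makes both terms of \<open>crude_decay\<close> smaller than \<open>excess d (exp (- 6))\<close> after
  \<open>crude_time\<close>, with \<open>q = exp (- 6) / (2 * ln (1 / crude_base))\<close>.\<close>

definition crude_base :: real where "crude_base = exp (- 6) / 2"

definition crude_time :: real where
  "crude_time = 2 * (ln (1 / crude_base))\<^sup>2 / exp (- 6)"

lemma crude_base: "0 < crude_base" "crude_base \<le> exp (- 1)" "0 < ln (1 / crude_base)" "0 < crude_time"
proof -
  show z: "0 < crude_base" by (simp add: crude_base_def)
  have "exp (- 6 :: real) \<le> exp (- 1)" by simp
  then show z1: "crude_base \<le> exp (- 1)" unfolding crude_base_def using exp_gt_zero[of "- 6"] by linarith
  have "exp (- 1) < (1::real)" by simp
  then have "crude_base < 1" using z1 by linarith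
  then show l: "0 < ln (1 / crude_base)" using z by (simp add: field_simps)
  then show "0 < crude_time" unfolding crude_time_def by (intro divide_pos_pos) (auto intro!: mult_pos_pos)
qed

section \<open>Decay of the second moments in three phases\<close>

context cooperative_flow
begin

text \<open>The mean of \<open>\<theta> ^ |R|\<close> over the sets containing \<open>i\<close> is
  at most \<open>excess d \<theta> / 2\<close>, so the feedback is at most
  \<open>3 / 2 * excess d \<theta>\<close>, and the equation lets the additive term decay at net
  rate \<open>j / 2\<close>. Along the falling \<open>\<theta>\<close> it must decay at a rate up to
  \<open>2 * (1 + d * \<theta>)\<close>. For small \<open>j\<close> the missing part comes from
  \<open>2 * \<epsilon> * j * \<theta> ^ j\<close>, gained by slowing \<open>\<theta>\<close>
  down.\<close>

lemma late_decay:
  fixes \<epsilon> \<theta>0 :: real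
  defines "\<theta> \<equiv> \<lambda>l. \<theta>0 * exp (- (2 * (1 - \<epsilon>) * (h * real l)))"
  assumes "0 < \<theta>0" and \<epsilon>: "0 \<le> \<epsilon>" "\<epsilon> \<le> 1"
    and base: "\<And>S. S \<subseteq> {..<d} \<Longrightarrow> S \<noteq> {} \<Longrightarrow> U m0 S \<le> \<theta>0 ^ card S + excess d \<theta>0"
    and slack: "\<And>l. l < L \<Longrightarrow> slack d \<epsilon> (\<theta> l)"
    and "l \<le> L" "S \<subseteq> {..<d}" "S \<noteq> {}"
  shows "U (m0 + l) S \<le> \<theta> l ^ card S + excess d (\<theta> l)"
proof (rule comparison[where L=L and w="\<lambda>l. 3 / 2 * excess d (\<theta> l)" and v="\<lambda>l j. \<theta> l ^ j + excess d (\<theta> l)"])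
  have pos: "0 < \<theta> l" for l using assms(2) by (simp add: \<theta>_def)
  show "2 / 2 ^ d * (\<Sum>R | R \<subseteq> {..<d} \<and> i \<in> R. \<theta> l ^ card R + excess d (\<theta> l)) \<le> 3 / 2 * excess d (\<theta> l)"
    if "i < d" for i l
    using sum_containing_affine[OF that, of 1 "\<theta> l" "excess d (\<theta> l)"]
      half_power_le_excess[of "\<theta> l" d] pos[of l] that by simp
  fix l j :: nat assume "l < L" "1 \<le> j" "j \<le> d"
  define x where "x = excess d (\<theta> l)"
  define s where "s = 2 * (1 - \<epsilon>) * h"
  have s: "0 \<le> s" "s \<le> 2 * h" using \<epsilon> h by (auto simp: s_def algebra_simps)
  have "0 \<le> x" using pos[of l] by (simp add: x_def excess_nonneg)
  have \<theta>': "\<theta> (Suc l) = \<theta> l * exp (- s)"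
    by (simp add: \<theta>_def s_def algebra_simps flip: exp_add)
  have "1 - s * j \<le> exp (- (s * j))" using exp_ge_add_one_self[of "- (s * j)"] by simp
  also have "\<dots> = exp (- s) ^ j" by (simp add: mult.commute flip: exp_of_nat_mult)
  finally have p: "\<theta> l ^ j * (1 - s * j) \<le> \<theta> (Suc l) ^ j"
    unfolding \<theta>' power_mult_distrib using pos[of l] by (intro mult_left_mono) auto
  \<comment> \<open>\<open>2 * (1 + d * \<theta>)\<close> bounds the logarithmic rate at which
    \<open>\<theta> * exp (d * \<theta>)\<close> decreases along the motion of
    \<open>\<theta>\<close>.\<close>
  have e: "x * (1 - 2 * h * (1 + d * \<theta> l)) \<le> excess d (\<theta> (Suc l))"
  proof -
    have "s * (1 + d * \<theta> l) \<le> 2 * h * (1 + d * \<theta> l)"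
      using s pos[of l] by (intro mult_right_mono) auto
    then have "1 - 2 * h * (1 + d * \<theta> l) \<le> exp (- (s * (1 + d * \<theta> l)))"
      using exp_ge_add_one_self[of "- (s * (1 + d * \<theta> l))"] by linarith
    also have "\<dots> = exp (- s) * exp (- (d * \<theta> l * s))" by (simp add: algebra_simps flip: exp_add)
    also have "\<dots> \<le> exp (- s) * exp (- (d * \<theta> l * (1 - exp (- s))))"
    proof -
      have "1 - exp (- s) \<le> s" using exp_ge_add_one_self[of "- s"] by simp
      then show ?thesis using pos[of l] by (simp add: mult_left_mono)
    qed
    finally have "x * (1 - 2 * h * (1 + d * \<theta> l)) \<le> x * (exp (- s) * exp (- (d * \<theta> l * (1 - exp (- s)))))"
      using \<open>0 \<le> x\<close> by (rule mult_left_mono)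
    also have "\<dots> = excess d (\<theta> (Suc l))"
      by (simp add: x_def excess_def \<theta>' algebra_simps exp_add exp_minus exp_diff)
    finally show ?thesis .
  qed
  have "2 * (1 + d * \<theta> l) * x \<le> j * (2 * \<epsilon> * \<theta> l ^ j + x / 2)"
    using slack[OF \<open>l < L\<close>] \<open>1 \<le> j\<close> unfolding slack_def x_def by blast
  then have "h * (2 * (1 + d * \<theta> l) * x) \<le> h * (j * (2 * \<epsilon> * \<theta> l ^ j + x / 2))"
    using h by (intro mult_left_mono) auto
  then have "(1 - 2 * h * j) * (\<theta> l ^ j + x) + h * j * (3 / 2 * x)
      \<le> \<theta> l ^ j * (1 - s * j) + x * (1 - 2 * h * (1 + d * \<theta> l))"
    by (simp add: s_def algebra_simps)
  then show "(1 - 2 * h * j) * (\<theta> l ^ j + excess d (\<theta> l)) + h * j * (3 / 2 * excess d (\<theta> l))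
      \<le> \<theta> (Suc l) ^ j + excess d (\<theta> (Suc l))"
    using p e unfolding x_def by linarith
qed (use assms(7-) base in \<open>auto simp: \<theta>_def\<close>)

lemma W_after_crude_time:
  assumes "i < d" "crude_time \<le> h * m"
  shows "W m i \<le> excess d (exp (- 6))"
proof -
  let ?z = crude_base and ?x = "exp (- 6) :: real"
  define lz where "lz = ln (1 / ?z)"
  define q where "q = ?x / (2 * lz)"
  note z = crude_base
  have lz: "0 < lz" "ln ?z = - lz" using z by (auto simp: lz_def ln_div)
  have q: "0 < q" "q * lz = ?x / 2" "q * crude_time = lz"
    using lz by (auto simp: q_def crude_time_def lz_def[symmetric] power2_eq_square)
  have d: "0 < d" "(2::real) ^ d = 2 * 2 ^ (d - 1)" using assms by (auto, cases d, auto)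
  \<comment> \<open>This power of \<open>?z\<close> and the power of \<open>1 + ?z\<close> below
    each contribute at most \<open>exp (d * (?x / 2))\<close>; together they form the
    \<open>exp (d * ?x)\<close> of \<open>excess d ?x\<close>.\<close>
  have "(1 - q * d) * ln ?z = ln ?z + d * (q * lz)"
    unfolding lz(2) by (simp add: algebra_simps)
  then have powr: "?z powr (1 - q * d) = ?z * exp (d * (?x / 2))"
    unfolding q(2) using z(1) by (simp add: powr_def exp_add)
  have half: "((1 + ?z) / 2) ^ (d - 1) \<le> 2 / 2 ^ d * exp (d * (?x / 2))"
  proof -
    have "((1 + ?z) / 2) ^ (d - 1) = 2 / 2 ^ d * (1 + ?z) ^ (d - 1)" by (simp add: power_divide d(2))
    also have "\<dots> \<le> 2 / 2 ^ d * exp (d * ?z)"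
      using z(1) by (intro mult_left_mono one_plus_power_le_exp) auto
    also have "d * ?z = d * (?x / 2)" by (simp add: crude_base_def)
    finally show ?thesis .
  qed
  have "?z powr (1 - q * d) * ((1 + ?z) / 2) ^ (d - 1) \<le> (?z * exp (d * (?x / 2))) * (2 / 2 ^ d * exp (d * (?x / 2)))"
    unfolding powr using z(1) by (intro mult_left_mono half) auto
  also have "\<dots> = excess d ?x / 4"
    by (simp add: excess_def crude_base_def field_simps flip: exp_add)
  finally have 1: "?z powr (1 - q * d) * ((1 + ?z) / 2) ^ (d - 1) \<le> excess d ?x / 4" .
  \<comment> \<open>By \<open>q * crude_time = lz\<close> this term is at most
    \<open>?z ^ d\<close>, and the factor \<open>1 / 2\<close> in \<open>crude_base\<close> supplies
    the required \<open>2 ^ (- d)\<close>.\<close>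
  have "exp (- (q * d * (h * m))) \<le> exp (- (d * lz))"
  proof -
    have "d * (q * crude_time) \<le> d * (q * (h * m))"
      using assms(2) q by (intro mult_left_mono) auto
    then show ?thesis unfolding q(3) by (simp add: mult_ac)
  qed
  also have "\<dots> = ?z ^ d"
    using z lz by (metis exp_ln exp_of_nat_mult mult_minus_right)
  also have "\<dots> = ?x ^ d / 2 ^ d" by (simp add: crude_base_def power_divide)
  also have "\<dots> \<le> ?x / 2 ^ d"
  proof -
    have "?x ^ d \<le> ?x ^ 1" using d by (intro power_decreasing) auto
    then show ?thesis by (simp add: divide_right_mono)
  qed
  also have "\<dots> \<le> excess d ?x / 4"
    by (simp add: excess_def divide_right_mono)
  finally have "exp (- (q * d * (h * m))) \<le> excess d ?x / 4" .
  then show ?thesis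
    using crude_decay[OF z(1,2) q(1) assms(1), of m] 1 excess_nonneg[of ?x d] by simp
qed

text \<open>\<open>m1\<close> steps bring the feedback down, \<open>m2\<close> steps covering time
  \<open>3\<close> relax the profile to \<open>exp (- 2 * 3) ^ |S|\<close>, and the remaining
  \<open>l\<close> steps are \<open>late_decay\<close> from \<open>\<theta> = exp (- 6)\<close>. The
  term \<open>2 * h\<close> pays for rounding \<open>crude_time\<close> and \<open>3\<close> up to
  whole steps.\<close>

lemma U_le:
  assumes \<epsilon>: "0 \<le> \<epsilon>" "\<epsilon> \<le> 1" and S: "S \<subseteq> {..<d}" "S \<noteq> {}"
    and time: "crude_time + 3 + 2 * h \<le> h * m"
    and slack: "\<And>\<theta>. exp (- (6 + 2 * (h * m))) \<le> \<theta> \<Longrightarrow> \<theta> \<le> exp (- 6) \<Longrightarrow> slack d \<epsilon> \<theta>"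
  defines "y \<equiv> exp (- (2 * (1 - \<epsilon>) * (h * m - crude_time - 3 - 2 * h)))"
  shows "U m S \<le> y ^ card S + excess d y"
proof -
  let ?x = "exp (- 6) :: real"
  define m1 m2 where "m1 = nat \<lceil>crude_time / h\<rceil>" and "m2 = nat \<lceil>3 / h\<rceil>"
  have ceil: "c \<le> h * nat \<lceil>c / h\<rceil>" "h * nat \<lceil>c / h\<rceil> \<le> c + h" if "0 \<le> c" for c
  proof -
    have "real (nat \<lceil>c / h\<rceil>) = \<lceil>c / h\<rceil>" using that h by simp
    moreover have "c / h \<le> \<lceil>c / h\<rceil>" "\<lceil>c / h\<rceil> \<le> c / h + 1" by linarith+
    ultimately have c: "c / h \<le> nat \<lceil>c / h\<rceil>" "nat \<lceil>c / h\<rceil> \<le> c / h + 1" by simp_all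
    from c[THEN mult_left_mono, of h] h
    have "h * (c / h) \<le> h * nat \<lceil>c / h\<rceil>" "h * nat \<lceil>c / h\<rceil> \<le> h * (c / h + 1)"
      by linarith+
    then show "c \<le> h * nat \<lceil>c / h\<rceil>" "h * nat \<lceil>c / h\<rceil> \<le> c + h"
      using h by (simp_all add: distrib_left)
  qed
  have m1: "crude_time \<le> h * m1" "h * m1 \<le> crude_time + h"
    unfolding m1_def using crude_base(4) by (simp_all only: ceil less_imp_le)
  have m2: "3 \<le> h * m2" "h * m2 \<le> 3 + h"
    unfolding m2_def by (rule ceil, simp)+
  have "h * (m1 + m2) \<le> h * m" using m1 m2 time by (simp add: algebra_simps)
  then have "m1 + m2 \<le> m" using h by (simp flip: of_nat_add)
  then obtain l where l: "m = m1 + m2 + l" by (metis le_iff_add)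
  have "0 \<le> excess d ?x" by (simp add: excess_nonneg)
  have base: "U (m1 + m2) S \<le> ?x ^ card S + excess d ?x" if "S \<subseteq> {..<d}" "S \<noteq> {}" for S
  proof -
    have W: "W m i \<le> 2 * excess d ?x" if "m1 \<le> m" "i < d" for m i
    proof -
      have "h * m1 \<le> h * m" using that h by (intro mult_left_mono) auto
      then show ?thesis using W_after_crude_time[of i m] that m1 \<open>0 \<le> excess d ?x\<close> by linarith
    qed
    have "U (m1 + m2) S \<le> exp (- (2 * (h * m2))) ^ card S + excess d ?x"
      by (rule relaxation[OF W that \<open>0 \<le> excess d ?x\<close>])
    also have "exp (- (2 * (h * m2))) ^ card S \<le> ?x ^ card S"
      using m2 by (intro power_mono) auto
    finally show ?thesis by simp
  qed
  define \<theta> where "\<theta> k = ?x * exp (- (2 * (1 - \<epsilon>) * (h * real k)))" for k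
  have \<theta>: "\<theta> k = exp (- (6 + 2 * ((1 - \<epsilon>) * (h * real k))))" for k
    by (simp add: \<theta>_def algebra_simps flip: exp_add)
  have "slack d \<epsilon> (\<theta> k)" if "k < l" for k
  proof (rule slack)
    have "h * k \<le> h * m" using that l h by (intro mult_left_mono) auto
    then have "(1 - \<epsilon>) * (h * k) \<le> 1 * (h * m)"
      using \<epsilon> h by (intro mult_mono) auto
    then show "exp (- (6 + 2 * (h * m))) \<le> \<theta> k"
      unfolding \<theta> by simp
    show "\<theta> k \<le> exp (- 6)"
      using \<epsilon> h by (simp add: \<theta>_def)
  qed
  then have "U m S \<le> \<theta> l ^ card S + excess d (\<theta> l)"
    unfolding l \<theta>_def by (intro late_decay[where L=l] \<epsilon> base S) auto
  also have "\<theta> l \<le> y"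
  proof -
    have "h * m - crude_time - 3 - 2 * h \<le> h * l"
      using m1 m2 unfolding l by (simp add: algebra_simps)
    then have "(1 - \<epsilon>) * (h * m - crude_time - 3 - 2 * h) \<le> (1 - \<epsilon>) * (h * l)"
      using \<epsilon> by (intro mult_left_mono) auto
    then show ?thesis unfolding \<theta> y_def exp_le_cancel_iff by linarith
  qed
  then have "\<theta> l ^ card S + excess d (\<theta> l) \<le> y ^ card S + excess d y"
    by (intro add_mono power_mono excess_mono) (auto simp: \<theta>_def)
  finally show ?thesis .
qed

end

section \<open>Summation over all sets and verification of the slack\<close>

lemma sum_nonempty_le:
  fixes x b :: real
  assumes "0 \<le> x" "0 \<le> b"
  shows "(\<Sum>S\<in>Pow {..<d} - {{}}. x ^ card S + b) \<le> exp (d * x) - 1 + 2 ^ d * b"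
proof -
  have "(\<Sum>S\<in>Pow {..<d} - {{}}. x ^ card S + b) = (\<Sum>S\<in>Pow {..<d}. x ^ card S + b) - (1 + b)"
    by (simp add: sum_diff1)
  also have "\<dots> = (1 + x) ^ d + 2 ^ d * b - (1 + b)"
    by (simp add: sum.distrib sum_power_card_Pow card_Pow)
  finally show ?thesis using one_plus_power_le_exp[of x d d] assms by simp
qed

text \<open>From \<open>ln u \<le> u - 1\<close> at \<open>u = 1 / sqrt x\<close>.\<close>

lemma x_ln_x_ge: "0 < x \<Longrightarrow> - 2 * sqrt x \<le> x * ln (x::real)"
proof -
  assume x: "0 < x"
  have "ln (1 / sqrt x) \<le> 1 / sqrt x - 1" using x by (intro ln_le_minus_one) auto
  then have "- ln x \<le> 2 / sqrt x" using x by (simp add: ln_div ln_sqrt)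
  then have "x * (- ln x) \<le> x * (2 / sqrt x)" using x by (intro mult_left_mono) auto
  also have "\<dots> = 2 * sqrt x" using x by (simp add: field_simps)
  finally show ?thesis by simp
qed

text \<open>Tuned to \<open>x_ln_x_ge\<close>: \<open>\<theta> \<le> exp (- 6)\<close> gives
  \<open>sqrt \<theta> \<le> 1 / 16\<close>, hence
  \<open>\<theta> * ln \<theta> \<ge> - 1 / 8\<close>.\<close>

lemma exp_bounds: "exp (- 3) \<le> 1 / (16::real)" "exp (- 6) \<le> 1 / (256::real)"
proof -
  have "1 + 1 / 2 + (1 / 2)\<^sup>2 / 2 \<le> exp (1 / 2 :: real)"
    by (rule exp_lower_Taylor_quadratic) simp
  then have "(13 / 8) ^ 6 \<le> exp (1 / 2 :: real) ^ 6"
    by (intro power_mono) (auto simp: power2_eq_square)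
  also have "\<dots> = exp 3" by (simp flip: exp_of_nat_mult)
  finally have e: "16 \<le> exp (3::real)" by (simp add: power_divide)
  then show 3: "exp (- 3) \<le> 1 / (16::real)" by (simp add: exp_minus field_simps)
  have "exp (- 6 :: real) = exp (- 3) * exp (- 3)" by (simp flip: exp_add)
  also have "\<dots> \<le> 1 / 16 * (1 / 16)" using 3 by (intro mult_mono) auto
  finally show "exp (- 6) \<le> 1 / (256::real)" by simp
qed

text \<open>For \<open>j \<ge> 4 * (1 + d * \<theta>)\<close> the summand
  \<open>excess d \<theta> / 2\<close> suffices. For smaller \<open>j\<close>,
  \<open>\<theta> ^ j\<close> is at least \<open>\<theta> powr (4 * (1 + d * \<theta>))\<close>,
  which by \<open>- \<theta> * ln \<theta> \<le> 1 / 8\<close> is at least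
  \<open>exp (- d / 2)\<close> up to powers of \<open>d\<close>, while
  \<open>excess d \<theta>\<close> is at most of order \<open>exp (d / 256) / 2 ^ d\<close>. The
  lower limit \<open>c / d\<close> is the order of \<open>\<theta>\<close> at the cutoff
  time.\<close>

lemma eventually_slack:
  fixes c :: real
  assumes "0 < c"
  shows "\<forall>\<^sub>F d in sequentially. \<forall>\<theta>. c / d \<le> \<theta> \<and> \<theta> \<le> exp (- 6) \<longrightarrow> slack d (1 / d) \<theta>"
proof -
  \<comment> \<open>The exponent \<open>d / 8\<close> fits because
    \<open>1 / 8 + 1 / 256 + 1 / 2 \<le> 2 / 3 \<le> ln 2\<close>.\<close>
  have "\<forall>\<^sub>F d::nat in sequentially. 4 * real d * (1 + real d) * (d / c) ^ 3 \<le> exp (d / 8)"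
    using assms by real_asymp
  then show ?thesis
    using eventually_ge_at_top[of 1]
  proof eventually_elim
    case (elim d)
    show ?case
    proof safe
      fix \<theta> :: real assume \<theta>: "c / d \<le> \<theta>" "\<theta> \<le> exp (- 6)"
      have "0 < \<theta>" using \<theta>(1) assms elim by (auto intro: less_le_trans[of _ "c / d"])
      have "exp (- 6) < (1::real)" by simp
      then have "\<theta> < 1" using \<theta> by linarith
      have \<theta>le: "\<theta> \<le> 1 / 256" using \<theta>(2) exp_bounds by linarith
      show "slack d (1 / d) \<theta>"
        unfolding slack_def
      proof safe
        fix j :: nat assume "1 \<le> j"
        have x: "0 \<le> excess d \<theta>" using \<open>0 < \<theta>\<close> by (simp add: excess_nonneg)
        have pj: "0 \<le> \<theta> ^ j" using \<open>0 < \<theta>\<close> by simp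
        show "2 * (1 + d * \<theta>) * excess d \<theta> \<le> j * (2 * (1 / d) * \<theta> ^ j + excess d \<theta> / 2)"
        proof (cases "4 * (1 + d * \<theta>) \<le> j")
          case True
          then have "4 * (1 + d * \<theta>) * (excess d \<theta> / 2) \<le> j * (excess d \<theta> / 2)"
            using x by (intro mult_right_mono) auto
          moreover have "0 \<le> j * (2 * (1 / d) * \<theta> ^ j)" using pj by simp
          ultimately show ?thesis by (simp add: algebra_simps)
        next
          case False
          \<comment> \<open>The exponent is \<open>4 * (1 + d * \<theta>) - 1\<close>, one factor
            \<open>\<theta>\<close> being present in \<open>excess d \<theta>\<close>.\<close>
          have "(3 + 4 * (d * \<theta>)) * ln \<theta> \<ge> 3 * ln (c / d) - d / 2"
          proof -
            have "ln (c / d) \<le> ln \<theta>" using \<theta> assms elim by (intro ln_mono) auto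
            moreover have "- 2 * sqrt \<theta> \<le> \<theta> * ln \<theta>" by (rule x_ln_x_ge) fact
            moreover have "sqrt \<theta> \<le> 1 / 16"
              using real_sqrt_le_mono[OF \<theta>le] by (simp add: real_sqrt_divide)
            ultimately have "ln (c / d) \<le> ln \<theta>" "- (1 / 8) \<le> \<theta> * ln \<theta>" by auto
            moreover from this(2) have "4 * d * - (1 / 8) \<le> 4 * d * (\<theta> * ln \<theta>)"
              by (intro mult_left_mono) auto
            ultimately show ?thesis by (simp add: algebra_simps)
          qed
          moreover have "exp (3 * ln (c / d) - d / 2) = (c / d) ^ 3 / exp (d / 2)"
          proof -
            have "exp (3 * ln (c / d)) = exp (ln (c / d)) ^ 3" by (simp flip: exp_of_nat_mult)
            then show ?thesis using assms elim by (simp add: exp_diff)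
          qed
          ultimately have low: "(c / d) ^ 3 / exp (d / 2) \<le> \<theta> powr (3 + 4 * (d * \<theta>))"
            using \<open>0 < \<theta>\<close> by (simp add: powr_def) (metis exp_le_cancel_iff)
          have "4 * d * (1 + d * \<theta>) * exp (d * \<theta>) / 2 ^ d \<le> 4 * real d * (1 + real d) * exp (d / 256) / exp (2 * d / 3)"
          proof (rule frac_le)
            have "d * \<theta> \<le> d * (1 / 256)" using \<theta>le by (intro mult_left_mono) auto
            then have A: "exp (d * \<theta>) \<le> exp (d / 256)" by simp
            have B: "1 + d * \<theta> \<le> 1 + real d" using \<open>\<theta> < 1\<close> by (simp add: mult_left_le)
            show "4 * d * (1 + d * \<theta>) * exp (d * \<theta>) \<le> 4 * real d * (1 + real d) * exp (d / 256)"
              by (intro mult_mono A B) (use \<open>0 < \<theta>\<close> in auto)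
            have "d * (2 / 3) \<le> d * ln 2" using ln2_ge_two_thirds by (intro mult_left_mono) auto
            then have "exp (2 * d / 3) \<le> exp (d * ln 2)" by simp
            then show "exp (2 * d / 3) \<le> 2 ^ d" by (simp add: exp_of_nat_mult)
          qed auto
          also have "\<dots> \<le> (c / d) ^ 3 / exp (d / 2)"
          proof -
            have "(c / d) ^ 3 * (4 * real d * (1 + real d) * (d / c) ^ 3) \<le> (c / d) ^ 3 * exp (d / 8)"
              using elim(1) assms by (intro mult_left_mono) auto
            moreover have "(c / d) ^ 3 * (d / c) ^ 3 = 1"
              using elim assms by (simp flip: power_mult_distrib)
            ultimately have "4 * real d * (1 + real d) \<le> (c / d) ^ 3 * exp (d / 8)"
              by (simp only: mult.left_commute[of "(c / d) ^ 3"] mult_1_right)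
            then have "4 * real d * (1 + real d) * exp (d / 256) * exp (d / 2)
                \<le> (c / d) ^ 3 * exp (d / 8) * exp (d / 256) * exp (d / 2)"
              by (intro mult_right_mono) auto
            also have "\<dots> = (c / d) ^ 3 * exp (d / 8 + d / 256 + d / 2)"
              by (simp only: exp_add mult.assoc)
            also have "\<dots> \<le> (c / d) ^ 3 * exp (2 * d / 3)"
              using assms by (intro mult_left_mono) auto
            finally show ?thesis
              by (subst pos_divide_le_eq, simp, subst times_divide_eq_left, subst pos_le_divide_eq) auto
          qed
          also note low
          finally have key: "4 * d * (1 + d * \<theta>) * exp (d * \<theta>) / 2 ^ d \<le> \<theta> powr (3 + 4 * (d * \<theta>))" .
          have "\<theta> * (4 * d * (1 + d * \<theta>) * exp (d * \<theta>) / 2 ^ d) \<le> \<theta> * \<theta> powr (3 + 4 * (d * \<theta>))"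
            using \<open>0 < \<theta>\<close> key by (intro mult_left_mono) auto
          also have "\<dots> = \<theta> powr (4 * (1 + d * \<theta>))"
            using \<open>0 < \<theta>\<close> by (simp add: powr_mult_base algebra_simps)
          also have "\<dots> \<le> \<theta> powr j"
            using False \<open>0 < \<theta>\<close> \<open>\<theta> < 1\<close> by (intro powr_mono') auto
          also have "\<dots> = \<theta> ^ j" using \<open>0 < \<theta>\<close> by (simp add: powr_realpow)
          finally have "2 * (1 / d) * (\<theta> * (4 * d * (1 + d * \<theta>) * exp (d * \<theta>) / 2 ^ d)) \<le> 2 * (1 / d) * \<theta> ^ j"
            by (intro mult_left_mono) auto
          moreover have "2 * (1 + d * \<theta>) * excess d \<theta> = 2 * (1 / d) * (\<theta> * (4 * d * (1 + d * \<theta>) * exp (d * \<theta>) / 2 ^ d))"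
            using elim by (simp add: excess_def)
          ultimately have "2 * (1 + d * \<theta>) * excess d \<theta> \<le> 2 * (1 / d) * \<theta> ^ j" by (simp only:)
          also have "\<dots> \<le> j * (2 * (1 / d) * \<theta> ^ j + excess d \<theta> / 2)"
            using \<open>1 \<le> j\<close> x pj mult_mono[of 1 "real j" "2 * (1 / d) * \<theta> ^ j" "2 * (1 / d) * \<theta> ^ j + excess d \<theta> / 2"] by simp
          finally show ?thesis .
        qed
      qed
    qed
  qed
qed

section \<open>Moments of the averaging process on the hypercube\<close>

text \<open>Mass functions in extensional form, so that they are points of the product space over
  the cube.\<close>

definition cube_masses :: "nat \<Rightarrow> ((nat \<Rightarrow> nat) \<Rightarrow> real) set" where
  "cube_masses d = {\<eta> \<in> extensional (cube d). (\<forall>x\<in>cube d. 0 \<le> \<eta> x) \<and> (\<Sum>x\<in>cube d. \<eta> x) = 1}"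

lemma fourier_empty: "fourier d {} \<eta> = (\<Sum>x\<in>cube d. \<eta> x)"
  by (simp add: fourier_def chi_def)

lemma fourier_restrict [simp]: "fourier d S (restrict \<eta> (cube d)) = fourier d S \<eta>"
  by (simp add: fourier_def)

lemma cube_masses_extensional: "cube_masses d \<subseteq> extensional (cube d)"
  by (auto simp: cube_masses_def)

lemma restrict_in_cube_masses: "\<xi> \<in> mass_functions (cube d) \<Longrightarrow> restrict \<xi> (cube d) \<in> cube_masses d"
  by (simp add: cube_masses_def mass_functions_def)

lemma average_edge_in_cube_masses:
  assumes "e \<in> cube_edges d" "\<eta> \<in> cube_masses d"
  shows "average_edge e \<eta> \<in> cube_masses d"
proof -
  obtain i x where e: "e = {x, flip i x}" "i < d" "x \<in> cube d"
    using assms(1) by (auto simp: cube_edges_eq)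
  have "(\<Sum>z\<in>cube d. average_edge e \<eta> z) = (\<Sum>z\<in>cube d. \<eta> z)"
    using fourier_average_edge[OF e(3,2), of "{}" \<eta>] by (simp add: fourier_empty e(1))
  moreover have "e \<subseteq> cube d" "finite e" using cube_edgesD[OF assms(1)] by auto
  ultimately show ?thesis
    using assms(2) by (auto simp: cube_masses_def average_edge_def extensional_def intro!: sum_nonneg)
qed

lemma abs_fourier_le:
  assumes "\<eta> \<in> cube_masses d"
  shows "\<bar>fourier d S \<eta>\<bar> \<le> 1"
proof -
  have "\<bar>fourier d S \<eta>\<bar> \<le> (\<Sum>x\<in>cube d. \<bar>\<eta> x * chi S x\<bar>)"
    unfolding fourier_def by (rule sum_abs)
  also have "\<dots> = 1" using assms by (simp add: abs_mult cube_masses_def)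
  finally show ?thesis .
qed

lemma fourier_square_le: "\<eta> \<in> cube_masses d \<Longrightarrow> (fourier d S \<eta>)\<^sup>2 \<le> 1"
  using abs_fourier_le[of \<eta> d S] by (simp add: abs_square_le_1)

lemma measurable_fourier: "fourier d S \<in> borel_measurable (PiM (cube d) (\<lambda>_. borel))"
  unfolding fourier_def by (intro borel_measurable_sum borel_measurable_times) auto

text \<open>The correction \<open>exp (- (t / m * c))\<close> tends to \<open>1\<close>, so
  probabilities of lone rings act like interval lengths in the limit.\<close>

lemma step_size_limits:
  fixes t c :: real
  assumes "0 < t"
  shows "(\<lambda>m. t / real m * exp (- (t / real m * c))) \<longlonglongrightarrow> 0"
    "(\<lambda>m. t / real m * exp (- (t / real m * c)) * real m) \<longlonglongrightarrow> t"
    "(\<lambda>m. (1 - t / real m * exp (- (t / real m * c)) * k) ^ m) \<longlonglongrightarrow> exp (- (k * t))"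
proof -
  show "(\<lambda>m. t / real m * exp (- (t / real m * c))) \<longlonglongrightarrow> 0" by real_asymp
  show "(\<lambda>m. t / real m * exp (- (t / real m * c)) * real m) \<longlonglongrightarrow> t" by real_asymp
  show "(\<lambda>m. (1 - t / real m * exp (- (t / real m * c)) * k) ^ m) \<longlonglongrightarrow> exp (- (k * t))"
    by real_asymp
qed

locale cube_averaging = prob_space M for M :: "'a measure" +
  fixes d :: nat and \<xi> :: "(nat \<Rightarrow> nat) \<Rightarrow> real" and \<eta> :: "real \<Rightarrow> 'a \<Rightarrow> (nat \<Rightarrow> nat) \<Rightarrow> real" and t :: real
  assumes process: "averaging_process (cube d) (cube_edges d) \<xi> M \<eta>"
    and \<xi>: "\<xi> \<in> mass_functions (cube d)" and d: "0 < d" and t: "0 < t"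
begin

text \<open>The probability that a given clock rings exactly once in an interval of length \<open>t / m\<close>
  while no other clock rings.\<close>

definition step_size :: "nat \<Rightarrow> real" where
  "step_size m = t / m * exp (- (t / m * card (cube_edges d)))"

lemma AE_masses: "AE \<omega> in M. restrict (\<eta> t \<omega>) (cube d) \<in> cube_masses d"
  by (rule AE_averaging_process[OF process])
    (use d t \<xi> cube_edgesD cube_masses_extensional in
      \<open>auto simp: cube_edges_nonempty restrict_in_cube_masses average_edge_in_cube_masses\<close>)

lemma limit:
  assumes "F \<in> borel_measurable (PiM (cube d) (\<lambda>_. borel))" "\<And>\<eta>. \<eta> \<in> cube_masses d \<Longrightarrow> \<bar>F \<eta>\<bar> \<le> 1"
  shows "(\<lambda>m. (avg_op (cube_edges d) (step_size m) ^^ m) F (restrict \<xi> (cube d)))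
      \<longlonglongrightarrow> expectation (\<lambda>\<omega>. F (restrict (\<eta> t \<omega>) (cube d)))"
  unfolding step_size_def
  by (rule averaging_process_limit(2)[OF process, where K="cube_masses d" and B=1])
    (use assms d t \<xi> cube_edgesD cube_masses_extensional in
      \<open>auto simp: cube_edges_nonempty restrict_in_cube_masses average_edge_in_cube_masses\<close>)

lemma measurable_process: "(\<lambda>\<omega>. restrict (\<eta> t \<omega>) (cube d)) \<in> measurable M (PiM (cube d) (\<lambda>_. borel))"
  using averaging_processD(2)[OF process] t by (intro measurable_restrict) auto

lemma integrable_fourier: "integrable M (\<lambda>\<omega>. fourier d S (\<eta> t \<omega>))"
proof (rule integrable_const_bound[of _ 1])
  show "AE \<omega> in M. norm (fourier d S (\<eta> t \<omega>)) \<le> 1"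
    using AE_masses by eventually_elim (metis abs_fourier_le fourier_restrict real_norm_def)
qed (use measurable_compose[OF measurable_process measurable_fourier[of d S]] in simp)

lemma integrable_fourier_square: "integrable M (\<lambda>\<omega>. (fourier d S (\<eta> t \<omega>))\<^sup>2)"
proof (rule integrable_const_bound[of _ 1])
  show "AE \<omega> in M. norm ((fourier d S (\<eta> t \<omega>))\<^sup>2) \<le> 1"
    using AE_masses by eventually_elim (metis fourier_square_le fourier_restrict real_norm_def abs_power2)
qed (use measurable_compose[OF measurable_process measurable_fourier[of d S]] in simp)

lemma expectation_fourier:
  assumes "S \<subseteq> {..<d}"
  shows "expectation (\<lambda>\<omega>. fourier d S (\<eta> t \<omega>)) = exp (- (card S * t)) * fourier d S \<xi>"
proof (rule LIMSEQ_unique)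
  show "(\<lambda>m. (1 - step_size m * card S) ^ m * fourier d S \<xi>) \<longlonglongrightarrow> expectation (\<lambda>\<omega>. fourier d S (\<eta> t \<omega>))"
    using limit[OF measurable_fourier abs_fourier_le, of S] by (simp add: funpow_avg_op_fourier[OF assms])
  show "(\<lambda>m. (1 - step_size m * card S) ^ m * fourier d S \<xi>) \<longlonglongrightarrow> exp (- (card S * t)) * fourier d S \<xi>"
    unfolding step_size_def by (intro tendsto_mult_right step_size_limits t)
qed

text \<open>\<open>U_le\<close> holds at every fine mesh and passes to the limit. The strict
  inequality \<open>crude_time + 3 < t\<close> leaves room for the term \<open>2 * h\<close> and for
  \<open>h * m\<close> falling short of \<open>t\<close>.\<close>

lemma expectation_fourier_square_le:
  assumes \<epsilon>: "0 \<le> \<epsilon>" "\<epsilon> \<le> 1" and S: "S \<subseteq> {..<d}" "S \<noteq> {}"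
    and time: "crude_time + 3 < t"
    and slack: "\<And>\<theta>. exp (- (6 + 2 * t)) \<le> \<theta> \<Longrightarrow> \<theta> \<le> exp (- 6) \<Longrightarrow> slack d \<epsilon> \<theta>"
  defines "y \<equiv> exp (- (2 * (1 - \<epsilon>) * (t - crude_time - 3)))"
  shows "expectation (\<lambda>\<omega>. (fourier d S (\<eta> t \<omega>))\<^sup>2) \<le> y ^ card S + excess d y"
proof -
  let ?A = "\<lambda>m S. (avg_op (cube_edges d) (step_size m) ^^ m) (\<lambda>\<eta>. (fourier d S \<eta>)\<^sup>2) (restrict \<xi> (cube d))"
  let ?y = "\<lambda>m. exp (- (2 * (1 - \<epsilon>) * (step_size m * m - crude_time - 3 - 2 * step_size m)))"
  have h0: "step_size \<longlonglongrightarrow> 0" and ht: "(\<lambda>m. step_size m * m) \<longlonglongrightarrow> t"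
    unfolding step_size_def[abs_def] by (rule step_size_limits[OF t])+
  have ylim: "?y \<longlonglongrightarrow> y"
    unfolding y_def by (rule tendsto_eq_intros h0 ht refl | simp)+
  have "(\<lambda>m. ?A m S) \<longlonglongrightarrow> expectation (\<lambda>\<omega>. (fourier d S (\<eta> t \<omega>))\<^sup>2)"
    using limit[of "\<lambda>\<eta>. (fourier d S \<eta>)\<^sup>2"] measurable_fourier[of d S] fourier_square_le[of _ d S] by simp
  moreover have "(\<lambda>m. ?y m ^ card S + excess d (?y m)) \<longlonglongrightarrow> y ^ card S + excess d y"
    unfolding excess_def by (intro tendsto_intros ylim) auto
  moreover have "\<forall>\<^sub>F m in sequentially. ?A m S \<le> ?y m ^ card S + excess d (?y m)"
  proof -
    have "\<forall>\<^sub>F m in sequentially. step_size m < 1 / (2 * d)"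
      using h0 d by (intro order_tendstoD) auto
    moreover have "(\<lambda>m. step_size m * m - 2 * step_size m) \<longlonglongrightarrow> t - 2 * 0"
      by (intro tendsto_intros h0 ht)
    then have "\<forall>\<^sub>F m in sequentially. crude_time + 3 < step_size m * m - 2 * step_size m"
      using time by (intro order_tendstoD) auto
    ultimately show ?thesis
      using eventually_gt_at_top[of 0]
    proof eventually_elim
      case (elim m)
      define h where "h = step_size m"
      have "0 < h" using t elim by (simp add: h_def step_size_def)
      define U where "U k S = (avg_op (cube_edges d) h ^^ k) (\<lambda>\<eta>. (fourier d S \<eta>)\<^sup>2) (restrict \<xi> (cube d))" for k S
      interpret cooperative_flow d h U
      proof
        show "0 < h" by fact
        show "2 * h * d \<le> 1" using elim d by (simp add: h_def field_simps)
        show "U 0 S \<le> 1" for S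
          using fourier_square_le[OF restrict_in_cube_masses[OF \<xi>], of S] by (simp add: U_def)
      qed (use funpow_avg_op_fourier_square in \<open>simp add: U_def\<close>)
      \<comment> \<open>The discrete time \<open>h * m\<close> never exceeds \<open>t\<close>, so
        the slack assumed down to \<open>exp (- (6 + 2 * t))\<close> covers the range that
        \<open>U_le\<close> asks for.\<close>
      have "exp (- (t / m * card (cube_edges d))) \<le> 1" using t by simp
      then have "h \<le> t / m" unfolding h_def step_size_def using t by (intro mult_left_le) auto
      then have "h * m \<le> t" using elim by (simp add: field_simps)
      have "U m S \<le> ?y m ^ card S + excess d (?y m)"
        unfolding h_def[symmetric]
      proof (rule U_le[OF \<epsilon> S])
        show "crude_time + 3 + 2 * h \<le> h * m" using elim by (simp add: h_def)
        fix \<theta> assume "exp (- (6 + 2 * (h * m))) \<le> \<theta>" "\<theta> \<le> exp (- 6)"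
        moreover have "exp (- (6 + 2 * t)) \<le> exp (- (6 + 2 * (h * m)))" using \<open>h * m \<le> t\<close> by simp
        ultimately show "slack d \<epsilon> \<theta>" by (intro slack) linarith+
      qed
      then show ?case by (simp add: U_def h_def)
    qed
  qed
  ultimately show ?thesis
    by (intro LIMSEQ_le) (auto simp: eventually_sequentially)
qed

end

section \<open>The distances in terms of Fourier coefficients\<close>

abbreviation (input) density_deviation :: "nat \<Rightarrow> ((nat \<Rightarrow> nat) \<Rightarrow> real) \<Rightarrow> (nat \<Rightarrow> nat) \<Rightarrow> real" where
  "density_deviation d \<eta> \<equiv> \<lambda>x. \<eta> x / uniform_mass (cube d) x - 1"

lemma Lp_norm_1:
  "Lp_norm (cube d) (uniform_mass (cube d)) 1 (density_deviation d \<eta>) powr 1 = (\<Sum>x\<in>cube d. \<bar>\<eta> x - 1 / 2 ^ d\<bar>)"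
proof -
  have "1 / 2 ^ d * \<bar>\<eta> x * 2 ^ d - 1\<bar> = \<bar>\<eta> x - 1 / 2 ^ d\<bar>" for x
  proof -
    have "1 / 2 ^ d * \<bar>\<eta> x * 2 ^ d - 1\<bar> = \<bar>1 / 2 ^ d * (\<eta> x * 2 ^ d - 1)\<bar>"
      by (simp only: abs_mult) simp
    also have "1 / 2 ^ d * (\<eta> x * 2 ^ d - 1) = \<eta> x - 1 / 2 ^ d" by (simp add: field_simps)
    finally show ?thesis .
  qed
  then show ?thesis
    by (simp add: Lp_norm_def uniform_mass_def sum_nonneg powr_one)
qed

text \<open>By Parseval: subtracting the constant density \<open>1\<close> removes exactly the
  coefficient of the empty set.\<close>

lemma Lp_norm_2:
  assumes "fourier d {} \<eta> = 1"
  shows "Lp_norm (cube d) (uniform_mass (cube d)) 2 (density_deviation d \<eta>) powr 2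
    = (\<Sum>S\<in>Pow {..<d} - {{}}. (fourier d S \<eta>)\<^sup>2)"
proof -
  have "Lp_norm (cube d) (uniform_mass (cube d)) 2 (density_deviation d \<eta>) powr 2
      = (\<Sum>x\<in>cube d. 1 / 2 ^ d * (\<eta> x * 2 ^ d - 1)\<^sup>2)"
    by (simp add: Lp_norm_def uniform_mass_def powr_powr powr_numeral sum_nonneg powr_one)
  also have "\<dots> = (\<Sum>x\<in>cube d. 2 ^ d * (\<eta> x)\<^sup>2 - 2 * \<eta> x + 1 / 2 ^ d)"
    by (intro sum.cong) (auto simp: power2_eq_square field_simps)
  also have "\<dots> = 2 ^ d * (\<Sum>x\<in>cube d. (\<eta> x)\<^sup>2) - 1"
    using assms by (simp add: sum.distrib sum_subtractf fourier_empty flip: sum_distrib_left)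
  also have "\<dots> = (\<Sum>S\<in>Pow {..<d} - {{}}. (fourier d S \<eta>)\<^sup>2)"
    using assms by (simp add: sum_diff1 flip: parseval)
  finally show ?thesis .
qed

section \<open>Moments of the sum of the singleton characters\<close>

lemma fourier_const:
  assumes "S \<subseteq> {..<d}" "S \<noteq> {}"
  shows "fourier d S (\<lambda>_. c) = 0"
proof -
  obtain i where "i \<in> S" using assms by auto
  moreover have "finite S" using assms(1) by (auto intro: finite_subset)
  ultimately show ?thesis using fourier_flip[of i d S "\<lambda>_. c"] assms(1) by auto
qed

text \<open>On the cube this is \<open>d\<close> minus twice the number of ones in \<open>x\<close>,
  the statistic that tells the two laws apart below the cutoff.\<close>

definition char_sum :: "nat \<Rightarrow> (nat \<Rightarrow> nat) \<Rightarrow> real" where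
  "char_sum d x = (\<Sum>i<d. chi {i} x)"

lemma sum_char_sum: "(\<Sum>x\<in>cube d. \<eta> x * char_sum d x) = (\<Sum>i<d. fourier d {i} \<eta>)"
  unfolding char_sum_def fourier_def sum_distrib_left by (rule sum.swap)

lemma chi_insert_pair: "chi {i} x * chi {j} x = chi (if i = j then {} else {i, j}) x"
  using chi_square[of "{j}" x] by (auto simp: chi_def)

text \<open>The square contains only characters of sets of size \<open>0\<close> or
  \<open>2\<close>, so the second moment is linear in coefficients whose expectations are known
  exactly.\<close>

lemma sum_char_sum_square:
  "(\<Sum>x\<in>cube d. \<eta> x * (char_sum d x)\<^sup>2) = (\<Sum>i<d. \<Sum>j<d. fourier d (if i = j then {} else {i, j}) \<eta>)"
proof -
  have "(char_sum d x)\<^sup>2 = (\<Sum>i<d. \<Sum>j<d. chi (if i = j then {} else {i, j}) x)" for x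
    by (simp only: char_sum_def power2_eq_square sum_product chi_insert_pair)
  then have "(\<Sum>x\<in>cube d. \<eta> x * (char_sum d x)\<^sup>2)
      = (\<Sum>x\<in>cube d. \<Sum>i<d. \<Sum>j<d. \<eta> x * chi (if i = j then {} else {i, j}) x)"
    by (simp only: sum_distrib_left)
  also have "\<dots> = (\<Sum>i<d. \<Sum>j<d. \<Sum>x\<in>cube d. \<eta> x * chi (if i = j then {} else {i, j}) x)"
    by (subst sum.swap, rule sum.cong[OF refl], rule sum.swap)
  finally show ?thesis by (simp only: fourier_def)
qed

lemma sum_if_diagonal:
  fixes a b :: real
  shows "(\<Sum>i<d. \<Sum>j<d. if i = j then a else b) = real d * a + real d * (real d - 1) * b"
proof -
  have "(\<Sum>j<d. if i = j then a else b) = a + (real d - 1) * b" if "i \<in> {..<d}" for i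
  proof -
    have "(\<Sum>j<d. if i = j then a else b) = (\<Sum>j<d. b + (if i = j then a - b else 0))"
      by (intro sum.cong) auto
    then show ?thesis using that by (simp add: sum.distrib algebra_simps)
  qed
  then have "(\<Sum>i<d. \<Sum>j<d. if i = j then a else b) = (\<Sum>i<d. a + (real d - 1) * b)"
    by (rule sum.cong[OF refl])
  then show ?thesis by (simp add: algebra_simps)
qed

lemma sum_uniform_char_sum_square: "(\<Sum>x\<in>cube d. 1 / 2 ^ d * (char_sum d x)\<^sup>2) = d"
proof -
  have "(\<Sum>x\<in>cube d. 1 / 2 ^ d * (char_sum d x)\<^sup>2)
      = (\<Sum>i<d. \<Sum>j<d. fourier d (if i = j then {} else {i, j}) (\<lambda>_. 1 / 2 ^ d))"
    by (rule sum_char_sum_square)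
  also have "\<dots> = (\<Sum>i<d. \<Sum>j<d. if i = j then 1 else 0)"
    by (intro sum.cong refl) (auto simp: fourier_const fourier_empty)
  finally show ?thesis by (simp only: sum_if_diagonal)
qed

lemma sum_second_moment:
  "(\<Sum>x\<in>cube d. \<eta> x * (char_sum d x - \<mu>)\<^sup>2) =
    (\<Sum>i<d. \<Sum>j<d. fourier d (if i = j then {} else {i, j}) \<eta>) - 2 * \<mu> * (\<Sum>i<d. fourier d {i} \<eta>) + \<mu>\<^sup>2 * fourier d {} \<eta>"
  unfolding sum_char_sum_square[symmetric] sum_char_sum[symmetric] fourier_empty sum_distrib_left
    sum_subtractf[symmetric] sum.distrib[symmetric]
  by (intro sum.cong) (auto simp: power2_diff algebra_simps)

text \<open>Test against the function equal to \<open>1\<close> where \<open>char_sum\<close> exceeds \<open>\<mu> / 2\<close> and to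
  \<open>-1\<close> elsewhere, with both tails bounded by Chebyshev's inequality.\<close>

lemma total_variation_ge:
  assumes \<eta>: "\<eta> \<in> cube_masses d" and \<mu>: "0 < \<mu>"
  shows "2 - 8 / \<mu>\<^sup>2 * (\<Sum>x\<in>cube d. \<eta> x * (char_sum d x - \<mu>)\<^sup>2) - 8 / \<mu>\<^sup>2 * d \<le> (\<Sum>x\<in>cube d. \<bar>\<eta> x - 1 / 2 ^ d\<bar>)"
proof -
  define g :: "(nat \<Rightarrow> nat) \<Rightarrow> real" where "g x = (if \<mu> / 2 < char_sum d x then 1 else - 1)" for x
  \<comment> \<open>\<open>8 / \<mu>\<^sup>2\<close> is the gap \<open>2\<close> between the values
    of \<open>g\<close> times the Chebyshev factor \<open>1 / (\<mu> / 2)\<^sup>2\<close>.\<close>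
  have lower: "1 - 8 / \<mu>\<^sup>2 * (char_sum d x - \<mu>)\<^sup>2 \<le> g x" for x
  proof (cases "\<mu> / 2 < char_sum d x")
    case False
    then have "(\<mu> / 2)\<^sup>2 \<le> (\<mu> - char_sum d x)\<^sup>2" using \<mu> by (intro power_mono) auto
    then have "8 / \<mu>\<^sup>2 * (\<mu> / 2)\<^sup>2 \<le> 8 / \<mu>\<^sup>2 * (char_sum d x - \<mu>)\<^sup>2"
      by (intro mult_left_mono) (auto simp: power2_commute)
    then show ?thesis using False \<mu> by (simp add: g_def power_divide)
  qed (simp add: g_def)
  have upper: "g x \<le> - 1 + 8 / \<mu>\<^sup>2 * (char_sum d x)\<^sup>2" for x
  proof (cases "\<mu> / 2 < char_sum d x")
    case True
    then have "(\<mu> / 2)\<^sup>2 \<le> (char_sum d x)\<^sup>2" using \<mu> by (intro power_mono) auto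
    then have "8 / \<mu>\<^sup>2 * (\<mu> / 2)\<^sup>2 \<le> 8 / \<mu>\<^sup>2 * (char_sum d x)\<^sup>2"
      by (intro mult_left_mono) auto
    then show ?thesis using True \<mu> by (simp add: g_def power_divide)
  qed (simp add: g_def)
  have "(\<Sum>x\<in>cube d. \<eta> x * (1 - 8 / \<mu>\<^sup>2 * (char_sum d x - \<mu>)\<^sup>2)) \<le> (\<Sum>x\<in>cube d. \<eta> x * g x)"
    using \<eta> lower by (intro sum_mono mult_left_mono) (auto simp: cube_masses_def)
  moreover have "(\<Sum>x\<in>cube d. \<eta> x * (1 - 8 / \<mu>\<^sup>2 * (char_sum d x - \<mu>)\<^sup>2))
      = 1 - 8 / \<mu>\<^sup>2 * (\<Sum>x\<in>cube d. \<eta> x * (char_sum d x - \<mu>)\<^sup>2)"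
    using \<eta> by (simp add: cube_masses_def right_diff_distrib sum_subtractf sum_distrib_left mult_ac)
  moreover have "(\<Sum>x\<in>cube d. 1 / 2 ^ d * g x) \<le> (\<Sum>x\<in>cube d. 1 / 2 ^ d * (- 1 + 8 / \<mu>\<^sup>2 * (char_sum d x)\<^sup>2))"
    using upper by (intro sum_mono mult_left_mono) auto
  moreover have "(\<Sum>x\<in>cube d. 1 / 2 ^ d * (- 1 + 8 / \<mu>\<^sup>2 * (char_sum d x)\<^sup>2))
      = (\<Sum>x\<in>cube d. - 1 / 2 ^ d) + 8 / \<mu>\<^sup>2 * (\<Sum>x\<in>cube d. 1 / 2 ^ d * (char_sum d x)\<^sup>2)"
    unfolding sum_distrib_left sum.distrib[symmetric] by (intro sum.cong) (auto simp: field_simps)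
  moreover have "(\<Sum>x\<in>cube d. \<eta> x * g x) - (\<Sum>x\<in>cube d. 1 / 2 ^ d * g x) \<le> (\<Sum>x\<in>cube d. \<bar>\<eta> x - 1 / 2 ^ d\<bar>)"
    unfolding sum_subtractf[symmetric] by (intro sum_mono) (auto simp: g_def)
  ultimately show ?thesis
    unfolding sum_uniform_char_sum_square by simp
qed

lemma total_variation_le:
  assumes "\<eta> \<in> cube_masses d"
  shows "(\<Sum>x\<in>cube d. \<bar>\<eta> x - 1 / 2 ^ d\<bar>) \<le> 2"
proof -
  have "(\<Sum>x\<in>cube d. \<bar>\<eta> x - 1 / 2 ^ d\<bar>) \<le> (\<Sum>x\<in>cube d. \<eta> x + 1 / 2 ^ d)"
    using assms by (intro sum_mono) (auto simp: cube_masses_def abs_le_iff add_increasing)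
  also have "\<dots> = 2" using assms by (simp add: sum.distrib cube_masses_def)
  finally show ?thesis .
qed

text \<open>The arithmetic-geometric mean inequality in place of Cauchy-Schwarz: the bound is affine
  in the sum of squares, so its expectation is immediate and \<open>\<delta>\<close> can be chosen
  afterwards.\<close>

lemma total_variation_le_square:
  assumes "0 < \<delta>" "fourier d {} \<eta> = 1"
  shows "(\<Sum>x\<in>cube d. \<bar>\<eta> x - 1 / 2 ^ d\<bar>) \<le> (\<delta> + (\<Sum>S\<in>Pow {..<d} - {{}}. (fourier d S \<eta>)\<^sup>2) / \<delta>) / 2"
proof -
  have amgm: "\<bar>z\<bar> \<le> (\<delta> + z\<^sup>2 / \<delta>) / 2" for z :: real
  proof -
    have "0 \<le> (\<delta> - \<bar>z\<bar>)\<^sup>2" by simp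
    then show ?thesis using assms(1) by (simp add: power2_diff field_simps power2_eq_square)
  qed
  let ?z = "density_deviation d \<eta>"
  have "(\<Sum>x\<in>cube d. \<bar>\<eta> x - 1 / 2 ^ d\<bar>) = (\<Sum>x\<in>cube d. 1 / 2 ^ d * \<bar>?z x\<bar>)"
    using Lp_norm_1[of d \<eta>] by (simp add: Lp_norm_def uniform_mass_def sum_nonneg powr_one)
  also have "\<dots> \<le> (\<Sum>x\<in>cube d. 1 / 2 ^ d * ((\<delta> + (?z x)\<^sup>2 / \<delta>) / 2))"
    by (intro sum_mono mult_left_mono amgm) auto
  also have "\<dots> = (\<delta> + (\<Sum>x\<in>cube d. 1 / 2 ^ d * (?z x)\<^sup>2) / \<delta>) / 2"
    by (simp add: sum.distrib sum_divide_distrib add_divide_distrib distrib_left mult_ac)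
  also have "(\<Sum>x\<in>cube d. 1 / 2 ^ d * (?z x)\<^sup>2) = (\<Sum>S\<in>Pow {..<d} - {{}}. (fourier d S \<eta>)\<^sup>2)"
    using Lp_norm_2[OF assms(2)]
    by (simp add: Lp_norm_def uniform_mass_def powr_powr powr_numeral sum_nonneg powr_one)
  finally show ?thesis .
qed

definition point_mass :: "nat \<Rightarrow> (nat \<Rightarrow> nat) \<Rightarrow> real" where
  "point_mass d x = (if x = (\<lambda>i\<in>{..<d}. 0) then 1 else 0)"

lemma zero_in_cube: "(\<lambda>i\<in>{..<d}. 0) \<in> cube d"
  by (auto simp: cube_def)

lemma point_mass: "point_mass d \<in> mass_functions (cube d)"
  using zero_in_cube[of d] by (auto simp: mass_functions_def point_mass_def)

lemma fourier_point_mass: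
  assumes "S \<subseteq> {..<d}"
  shows "fourier d S (point_mass d) = 1"
proof -
  have "fourier d S (point_mass d) = (\<Sum>x\<in>cube d. if x = (\<lambda>i\<in>{..<d}. 0) then chi S x else 0)"
    unfolding fourier_def by (intro sum.cong) (auto simp: point_mass_def)
  also have "\<dots> = chi S (\<lambda>i\<in>{..<d}. 0)" using zero_in_cube[of d] by simp
  also have "\<dots> = 1" unfolding chi_def using assms by (intro prod.neutral) auto
  finally show ?thesis .
qed

section \<open>Expected distances at a fixed time\<close>

context cube_averaging
begin

text \<open>Twice the total variation distance to the uniform law, whence the limit value
  \<open>2\<close> for \<open>p = 1\<close>.\<close>

abbreviation "tv \<omega> \<equiv> \<Sum>x\<in>cube d. \<bar>\<eta> t \<omega> x - 1 / 2 ^ d\<bar>"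
abbreviation "energy \<omega> \<equiv> \<Sum>S\<in>Pow {..<d} - {{}}. (fourier d S (\<eta> t \<omega>))\<^sup>2"

lemma AE_total_mass: "AE \<omega> in M. fourier d {} (\<eta> t \<omega>) = 1"
  using AE_masses by eventually_elim (simp add: fourier_empty cube_masses_def)

lemma AE_tv_le: "AE \<omega> in M. tv \<omega> \<le> 2"
  using AE_masses
proof eventually_elim
  case (elim \<omega>)
  then show ?case using total_variation_le[OF elim] by simp
qed

lemma integrable_tv: "integrable M tv"
proof (rule integrable_const_bound[of _ 2])
  show "AE \<omega> in M. norm (tv \<omega>) \<le> 2" using AE_tv_le by eventually_elim (simp add: sum_nonneg)
  show "tv \<in> borel_measurable M"
    using averaging_processD(2)[OF process] t
    by (intro borel_measurable_sum borel_measurable_abs borel_measurable_diff) auto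
qed

lemma integrable_energy: "integrable M energy"
  using integrable_fourier_square by (intro Bochner_Integration.integrable_sum)

lemma nn_integral_Lp_norm_1:
  "(\<integral>\<^sup>+ \<omega>. ennreal (Lp_norm (cube d) (uniform_mass (cube d)) 1 (density_deviation d (\<eta> t \<omega>)) powr 1) \<partial>M)
    = ennreal (expectation tv)"
  unfolding Lp_norm_1 using integrable_tv by (intro nn_integral_eq_integral) (auto simp: sum_nonneg)

lemma nn_integral_Lp_norm_2:
  "(\<integral>\<^sup>+ \<omega>. ennreal (Lp_norm (cube d) (uniform_mass (cube d)) 2 (density_deviation d (\<eta> t \<omega>)) powr 2) \<partial>M)
    = ennreal (expectation energy)"
proof -
  have "(\<integral>\<^sup>+ \<omega>. ennreal (Lp_norm (cube d) (uniform_mass (cube d)) 2 (density_deviation d (\<eta> t \<omega>)) powr 2) \<partial>M)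
      = (\<integral>\<^sup>+ \<omega>. ennreal (energy \<omega>) \<partial>M)"
    using AE_total_mass by (intro nn_integral_cong_AE) (auto elim!: eventually_mono simp: Lp_norm_2)
  also have "\<dots> = ennreal (expectation energy)"
    using integrable_energy by (intro nn_integral_eq_integral) (auto simp: sum_nonneg)
  finally show ?thesis .
qed

lemma expectation_tv_le: "expectation tv \<le> 2"
  using integral_mono_AE[OF integrable_tv _ AE_tv_le] by (simp add: prob_space)

lemma expectation_tv_le_sqrt:
  assumes "expectation energy \<le> r" "0 < r"
  shows "expectation tv \<le> sqrt r"
proof -
  \<comment> \<open>\<open>\<delta> = sqrt r\<close> balances the two terms.\<close>
  have "expectation tv \<le> expectation (\<lambda>\<omega>. (sqrt r + energy \<omega> / sqrt r) / 2)"
  proof (rule integral_mono_AE[OF integrable_tv])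
    show "integrable M (\<lambda>\<omega>. (sqrt r + energy \<omega> / sqrt r) / 2)"
      using integrable_energy by simp
    show "AE \<omega> in M. tv \<omega> \<le> (sqrt r + energy \<omega> / sqrt r) / 2"
      using AE_total_mass by eventually_elim (rule total_variation_le_square, use assms(2) in auto)
  qed
  also have "\<dots> = (sqrt r + expectation energy / sqrt r) / 2"
    using integrable_energy by (simp add: prob_space)
  also have "\<dots> \<le> (sqrt r + r / sqrt r) / 2"
    using assms by (intro divide_right_mono add_left_mono) auto
  also have "\<dots> = sqrt r" by (simp add: real_div_sqrt assms(2) less_imp_le)
  finally show ?thesis .
qed

lemma expectation_energy_le:
  fixes \<epsilon> y :: real
  assumes "0 \<le> \<epsilon>" "\<epsilon> \<le> 1" "crude_time + 3 < t"
    and "\<And>\<theta>. exp (- (6 + 2 * t)) \<le> \<theta> \<Longrightarrow> \<theta> \<le> exp (- 6) \<Longrightarrow> slack d \<epsilon> \<theta>"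
  defines "y \<equiv> exp (- (2 * (1 - \<epsilon>) * (t - crude_time - 3)))"
  shows "expectation energy \<le> exp (d * y) - 1 + 4 * y * exp (d * y)"
proof -
  have "expectation energy = (\<Sum>S\<in>Pow {..<d} - {{}}. expectation (\<lambda>\<omega>. (fourier d S (\<eta> t \<omega>))\<^sup>2))"
    using integrable_fourier_square by (intro Bochner_Integration.integral_sum)
  also have "\<dots> \<le> (\<Sum>S\<in>Pow {..<d} - {{}}. y ^ card S + excess d y)"
    unfolding y_def using assms(1-4) by (intro sum_mono expectation_fourier_square_le) auto
  also have "\<dots> \<le> exp (d * y) - 1 + 2 ^ d * excess d y"
    by (intro sum_nonempty_le excess_nonneg) (auto simp: y_def)
  finally show ?thesis by (simp add: excess_def)
qed

text \<open>Only the singletons are kept. Jensen's inequality appears as the tangent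
  \<open>2 * c * z - c * c \<le> z\<^sup>2\<close> at \<open>c = exp (- t)\<close>, the expectation
  of each singleton coefficient, so that the tangent has expectation \<open>c * c\<close>.\<close>

lemma expectation_energy_ge:
  assumes "\<xi> = point_mass d"
  shows "d * exp (- (2 * t)) \<le> expectation energy"
proof -
  let ?c = "exp (- t)"
  have E: "expectation (\<lambda>\<omega>. fourier d {i} (\<eta> t \<omega>)) = ?c" if "i < d" for i
    using that by (simp add: expectation_fourier assms fourier_point_mass)
  have "d * exp (- (2 * t)) = d * (?c * ?c)" by (simp flip: exp_add)
  also have "\<dots> = expectation (\<lambda>\<omega>. \<Sum>i<d. 2 * ?c * fourier d {i} (\<eta> t \<omega>) - ?c * ?c)"
    using integrable_fourier E by (simp add: prob_space)
  also have "\<dots> \<le> expectation energy"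
  proof (rule integral_mono)
    show "integrable M (\<lambda>\<omega>. \<Sum>i<d. 2 * ?c * fourier d {i} (\<eta> t \<omega>) - ?c * ?c)"
      using integrable_fourier by simp
    fix \<omega>
    have "2 * ?c * z - ?c * ?c \<le> z\<^sup>2" for z
      using zero_le_power2[of "z - ?c"] by (simp add: power2_eq_square algebra_simps)
    then have "(\<Sum>i<d. 2 * ?c * fourier d {i} (\<eta> t \<omega>) - ?c * ?c) \<le> (\<Sum>i<d. (fourier d {i} (\<eta> t \<omega>))\<^sup>2)"
      by (intro sum_mono)
    also have "\<dots> = (\<Sum>S\<in>(\<lambda>i. {i}) ` {..<d}. (fourier d S (\<eta> t \<omega>))\<^sup>2)"
      by (subst sum.reindex) auto
    also have "\<dots> \<le> energy \<omega>" by (intro sum_mono2) auto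
    finally show "(\<Sum>i<d. 2 * ?c * fourier d {i} (\<eta> t \<omega>) - ?c * ?c) \<le> energy \<omega>" .
  qed (rule integrable_energy)
  finally show ?thesis .
qed

text \<open>\<open>\<mu>\<close> is the expected mean of \<open>char_sum\<close> under the process,
  so \<open>?Q\<close> has expectation \<open>d - d * exp (- (2 * t))\<close>, at most the uniform
  second moment \<open>d\<close>. Each law then contributes a Chebyshev term
  \<open>8 * d / \<mu>\<^sup>2 = 8 * exp (2 * t) / d\<close>, whence the \<open>16\<close>.\<close>

lemma expectation_tv_ge:
  assumes "\<xi> = point_mass d"
  shows "2 - 16 * exp (2 * t) / d \<le> expectation tv"
proof -
  define \<mu> :: real where "\<mu> = d * exp (- t)"
  have "0 < \<mu>" using d by (simp add: \<mu>_def)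
  let ?Q = "\<lambda>\<omega>. \<Sum>x\<in>cube d. \<eta> t \<omega> x * (char_sum d x - \<mu>)\<^sup>2"
  have E: "expectation (\<lambda>\<omega>. fourier d S (\<eta> t \<omega>)) = exp (- (card S * t))" if "S \<subseteq> {..<d}" for S
    using that by (simp add: expectation_fourier assms fourier_point_mass)
  have Q: "integrable M ?Q"
    unfolding sum_second_moment using integrable_fourier by simp
  have "expectation ?Q = (\<Sum>i<d. \<Sum>j<d. if i = j then 1 else exp (- (2 * t))) - 2 * \<mu> * (\<Sum>i<d. exp (- t)) + \<mu>\<^sup>2"
    unfolding sum_second_moment using integrable_fourier E
    by (auto intro!: sum.cong)
  also have "\<dots> = d - d * exp (- (2 * t))"
    unfolding sum_if_diagonal by (simp add: \<mu>_def power2_eq_square algebra_simps flip: exp_add)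
  also have "\<dots> \<le> d" by simp
  finally have EQ: "expectation ?Q \<le> d" .
  have "2 - 16 * exp (2 * t) / d = 2 - 8 / \<mu>\<^sup>2 * d - 8 / \<mu>\<^sup>2 * d"
    using d by (simp add: \<mu>_def power2_eq_square exp_minus field_simps flip: exp_add)
  also have "\<dots> \<le> 2 - 8 / \<mu>\<^sup>2 * expectation ?Q - 8 / \<mu>\<^sup>2 * d"
    using EQ by (intro diff_right_mono diff_left_mono mult_left_mono) auto
  also have "\<dots> = expectation (\<lambda>\<omega>. 2 - 8 / \<mu>\<^sup>2 * ?Q \<omega> - 8 / \<mu>\<^sup>2 * d)"
    using Q by (simp add: prob_space)
  also have "\<dots> \<le> expectation tv"
  proof (rule integral_mono_AE[OF _ integrable_tv])
    show "integrable M (\<lambda>\<omega>. 2 - 8 / \<mu>\<^sup>2 * ?Q \<omega> - 8 / \<mu>\<^sup>2 * d)" using Q by simp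
    show "AE \<omega> in M. 2 - 8 / \<mu>\<^sup>2 * ?Q \<omega> - 8 / \<mu>\<^sup>2 * d \<le> tv \<omega>"
      using AE_masses
    proof eventually_elim
      case (elim \<omega>)
      then show ?case using total_variation_ge[OF elim \<open>0 < \<mu>\<close>] by simp
    qed
  qed
  finally show ?thesis .
qed

end

section \<open>The cutoff\<close>

lemma eventually_cutoff_time_pos: "\<forall>\<^sub>F d in sequentially. 0 < cutoff_time d a \<and> 2 \<le> d"
proof -
  have "\<forall>\<^sub>F d::nat in sequentially. 0 < 1 / 2 * ln (real d) + a" by real_asymp
  then show ?thesis
    using eventually_ge_at_top[of 2] by eventually_elim (simp add: cutoff_time_def)
qed

lemma exp_cutoff_time: "0 < d \<Longrightarrow> exp (2 * cutoff_time d a) = d * exp (2 * a)"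
  by (simp add: cutoff_time_def exp_add distrib_left)

lemma d_exp_cutoff_time: "0 < d \<Longrightarrow> d * exp (- (2 * cutoff_time d a)) = exp (- (2 * a))"
  by (simp add: exp_minus exp_cutoff_time)

text \<open>The slowdown by \<open>1 - 1 / d\<close> costs \<open>ln d / d \<le> 1\<close> in the
  exponent, the summand \<open>1\<close> on the right. On the remaining time \<open>a - c\<close>
  the rate \<open>2 * (1 - 1 / d)\<close> is at least \<open>1\<close> because
  \<open>d \<ge> 2\<close>.\<close>

lemma shifted_cutoff_bound:
  assumes "2 \<le> d" "c \<le> a"
  shows "d * exp (- (2 * (1 - 1 / d) * (cutoff_time d a - c))) \<le> exp (1 + c - a)"
proof -
  define l where "l = ln (real d)"
  have l: "d = exp l" "l \<le> d" using assms(1) ln_le_minus_one[of "real d"] by (auto simp: l_def)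
  have 1: "1 * (a - c) \<le> 2 * (1 - 1 / d) * (a - c)"
    using assms by (intro mult_right_mono) (auto simp: field_simps)
  have 2: "l / d \<le> 1" using l assms by (simp add: divide_le_eq)
  have "l - 2 * (1 - 1 / d) * (1 / 2 * l + a - c) = l / d - 2 * (1 - 1 / d) * (a - c)"
    by (simp add: algebra_simps diff_divide_distrib)
  also have "\<dots> \<le> 1 - 1 * (a - c)" by (rule diff_mono[OF 2 1])
  finally have "l - 2 * (1 - 1 / d) * (1 / 2 * l + a - c) \<le> 1 + c - a" by simp
  moreover have "d * exp (- (2 * (1 - 1 / d) * (cutoff_time d a - c)))
      = exp (l - 2 * (1 - 1 / d) * (1 / 2 * l + a - c))"
    by (subst l(1)) (simp add: cutoff_time_def l_def[symmetric] flip: exp_add)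
  ultimately show ?thesis by simp
qed

text \<open>The bound of \<open>expectation_energy_le\<close> with \<open>d * y\<close> and
  \<open>y\<close> both replaced by the estimate of \<open>shifted_cutoff_bound\<close> for
  \<open>c = crude_time + 3\<close>.\<close>

definition energy_bound :: "real \<Rightarrow> real" where
  "energy_bound a = exp (exp (1 + (crude_time + 3) - a)) - 1
     + 4 * exp (1 + (crude_time + 3) - a) * exp (exp (1 + (crude_time + 3) - a))"

lemma energy_bound_pos: "0 < energy_bound a"
  unfolding energy_bound_def by (intro add_nonneg_pos) auto

lemma energy_bound_tendsto: "(energy_bound \<longlongrightarrow> 0) at_top"
  unfolding energy_bound_def[abs_def] by real_asymp

text \<open>The threshold on \<open>d\<close> is uniform in the probability space, the starting
  point and the process, so a supremum over starting points can be taken afterwards.\<close>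

lemma eventually_energy_le:
  assumes a: "crude_time + 3 \<le> a"
  shows "\<forall>\<^sub>F d in sequentially. \<forall>(M :: 'a measure) \<xi> \<eta>. cube_averaging M d \<xi> \<eta> (cutoff_time d a) \<longrightarrow>
    (\<integral>\<omega>. (\<Sum>S\<in>Pow {..<d} - {{}}. (fourier d S (\<eta> (cutoff_time d a) \<omega>))\<^sup>2) \<partial>M) \<le> energy_bound a"
  \<comment> \<open>At the cutoff time \<open>exp (- (6 + 2 * t)) = exp (- (6 + 2 * a)) / d\<close>,
    which determines the constant \<open>c\<close>.\<close>
  using eventually_slack[OF exp_gt_zero[of "- (6 + 2 * a)"]] eventually_ge_at_top[of 2]
proof eventually_elim
  case (elim d)
  let ?t = "cutoff_time d a"
  show ?case
  proof (intro allI impI)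
    fix M :: "'a measure" and \<xi> \<eta> assume "cube_averaging M d \<xi> \<eta> ?t"
    then interpret cube_averaging M d \<xi> \<eta> ?t .
    define y where "y = exp (- (2 * (1 - 1 / d) * (?t - crude_time - 3)))"
    define z where "z = exp (1 + (crude_time + 3) - a)"
    have dy: "d * y \<le> z"
      using shifted_cutoff_bound[OF elim(2) a] by (simp add: y_def z_def diff_diff_eq)
    have "1 * y \<le> d * y" using elim(2) by (intro mult_right_mono) (auto simp: y_def)
    then have "y \<le> z" using dy by simp
    have "0 < ln (real d)" using elim(2) by simp
    then have time: "crude_time + 3 < ?t" using a by (simp add: cutoff_time_def)
    have "exp (- (6 + 2 * ?t)) = exp (- (6 + 2 * a)) / d"
    proof -
      have split: "exp (- (6 + 2 * x)) = exp (- 6) * exp (- (2 * x))" for x :: real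
        by (simp flip: exp_add)
      show ?thesis
        unfolding split using elim(2) d_exp_cutoff_time[of d a] by (simp add: field_simps)
    qed
    then have "slack d (1 / d) \<theta>" if "exp (- (6 + 2 * ?t)) \<le> \<theta>" "\<theta> \<le> exp (- 6)" for \<theta>
      using elim(1) that by simp
    then have "expectation energy \<le> exp (d * y) - 1 + 4 * y * exp (d * y)"
      unfolding y_def using elim(2) time by (intro expectation_energy_le) auto
    also have "\<dots> \<le> exp z - 1 + 4 * z * exp z"
      using dy \<open>y \<le> z\<close> by (intro add_mono diff_right_mono mult_mono) (auto simp: y_def z_def)
    finally show "expectation energy \<le> energy_bound a"
      by (simp add: energy_bound_def z_def)
  qed
qed

theorem theorem1p1:
  fixes M :: "nat \<Rightarrow> ((nat \<Rightarrow> nat) \<Rightarrow> real) \<Rightarrow> 'a measure"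
    and \<eta> :: "nat \<Rightarrow> ((nat \<Rightarrow> nat) \<Rightarrow> real) \<Rightarrow> real \<Rightarrow> 'a \<Rightarrow> (nat \<Rightarrow> nat) \<Rightarrow> real"
    and p :: real
  assumes "\<And>d \<xi>. \<xi> \<in> mass_functions (cube d) \<Longrightarrow>
             averaging_process (cube d) (cube_edges d) \<xi> (M d \<xi>) (\<eta> d \<xi>)"
    and "p \<in> {1, 2}"
  shows "((\<lambda>a. limsup (\<lambda>d. SUP \<xi>\<in>mass_functions (cube d).
            \<integral>\<^sup>+ \<omega>. ennreal (Lp_norm (cube d) (uniform_mass (cube d)) p
              (\<lambda>x. \<eta> d \<xi> (cutoff_time d a) \<omega> x / uniform_mass (cube d) x - 1) powr p) \<partial>M d \<xi>))
          \<longlongrightarrow> 0) at_top \<and>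
         ((\<lambda>a. liminf (\<lambda>d. SUP \<xi>\<in>mass_functions (cube d).
            \<integral>\<^sup>+ \<omega>. ennreal (Lp_norm (cube d) (uniform_mass (cube d)) p
              (\<lambda>x. \<eta> d \<xi> (cutoff_time d a) \<omega> x / uniform_mass (cube d) x - 1) powr p) \<partial>M d \<xi>))
          \<longlongrightarrow> (if p = 1 then 2 else \<infinity>)) at_bot"
proof -
  define J where "J d a \<xi> = (\<integral>\<^sup>+ \<omega>. ennreal (Lp_norm (cube d) (uniform_mass (cube d)) p
      (\<lambda>x. \<eta> d \<xi> (cutoff_time d a) \<omega> x / uniform_mass (cube d) x - 1) powr p) \<partial>M d \<xi>)" for d a \<xi>
  define I where "I d a = (SUP \<xi>\<in>mass_functions (cube d). J d a \<xi>)" for d a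
  have process: "cube_averaging (M d \<xi>) d \<xi> (\<eta> d \<xi>) (cutoff_time d a)"
    if "\<xi> \<in> mass_functions (cube d)" "0 < cutoff_time d a" "2 \<le> d" for d \<xi> a
    using that assms(1)[OF that(1)] averaging_processD(1)[OF assms(1)[OF that(1)]]
    by (simp add: cube_averaging_def cube_averaging_axioms_def)
  have p: "p = 1 \<or> p = 2" using assms(2) by auto
  define B where "B a = (if p = 1 then sqrt (energy_bound a) else energy_bound a)" for a
  have upper: "limsup (\<lambda>d. I d a) \<le> ennreal (B a)" if a: "crude_time + 3 \<le> a" for a
  proof (rule Limsup_bounded)
    show "\<forall>\<^sub>F d in sequentially. I d a \<le> ennreal (B a)"
      using eventually_energy_le[OF a, where 'a='a] eventually_cutoff_time_pos[of a]
    proof eventually_elim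
      case (elim d)
      show ?case
        unfolding I_def
      proof (rule SUP_least)
        fix \<xi> assume "\<xi> \<in> mass_functions (cube d)"
        then interpret cube_averaging "M d \<xi>" d \<xi> "\<eta> d \<xi>" "cutoff_time d a"
          using process elim(2) by simp
        have "expectation energy \<le> energy_bound a"
          using elim(1) cube_averaging_axioms by blast
        moreover from this have "expectation tv \<le> sqrt (energy_bound a)"
          by (rule expectation_tv_le_sqrt) (rule energy_bound_pos)
        ultimately show "J d a \<xi> \<le> ennreal (B a)"
          using p
        proof (elim disjE)
          assume "p = 1" "expectation tv \<le> sqrt (energy_bound a)"
          then show ?thesis
            unfolding J_def B_def \<open>p = 1\<close> nn_integral_Lp_norm_1 by (simp add: ennreal_leI)
        next
          assume "p = 2" "expectation energy \<le> energy_bound a"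
          then show ?thesis
            unfolding J_def B_def \<open>p = 2\<close> nn_integral_Lp_norm_2 by (simp add: ennreal_leI)
        qed
      qed
    qed
  qed
  have "(B \<longlongrightarrow> 0) at_top"
    unfolding B_def[abs_def] using energy_bound_tendsto tendsto_real_sqrt[OF energy_bound_tendsto]
    by (cases "p = 1") auto
  then have B0: "((\<lambda>a. ennreal (B a)) \<longlongrightarrow> 0) at_top"
    using tendsto_ennrealI by fastforce
  have 1: "((\<lambda>a. limsup (\<lambda>d. I d a)) \<longlongrightarrow> 0) at_top"
  proof (rule tendsto_sandwich[OF _ _ tendsto_const B0])
    show "\<forall>\<^sub>F a in at_top. limsup (\<lambda>d. I d a) \<le> ennreal (B a)"
      using eventually_ge_at_top[of "crude_time + 3"] by eventually_elim (rule upper)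
  qed simp
  \<comment> \<open>Both lower bounds come from the point mass. For \<open>p = 1\<close> negative
    values are truncated to \<open>0\<close> by \<open>ennreal\<close>, which is harmless as
    \<open>a\<close> tends to minus infinity.\<close>
  define L :: "real \<Rightarrow> real" where "L a = (if p = 1 then 2 - 16 * exp (2 * a) else exp (- (2 * a)))" for a
  have lower: "ennreal (L a) \<le> liminf (\<lambda>d. I d a)" for a
  proof (rule Liminf_bounded)
    show "\<forall>\<^sub>F d in sequentially. ennreal (L a) \<le> I d a"
      using eventually_cutoff_time_pos[of a]
    proof eventually_elim
      case (elim d)
      interpret cube_averaging "M d (point_mass d)" d "point_mass d" "\<eta> d (point_mass d)" "cutoff_time d a"
        using process[OF point_mass] elim by simp
      have "exp (- (2 * a)) \<le> expectation energy"
        using expectation_energy_ge d_exp_cutoff_time[of d a] elim by simp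
      moreover have "2 - 16 * exp (2 * a) \<le> expectation tv"
        using expectation_tv_ge exp_cutoff_time[of d a] elim by simp
      ultimately have "ennreal (L a) \<le> J d a (point_mass d)"
        using p
      proof (elim disjE)
        assume "p = 1" "2 - 16 * exp (2 * a) \<le> expectation tv"
        then show ?thesis
          unfolding J_def L_def \<open>p = 1\<close> nn_integral_Lp_norm_1 by (simp add: ennreal_leI)
      next
        assume "p = 2" "exp (- (2 * a)) \<le> expectation energy"
        then show ?thesis
          unfolding J_def L_def \<open>p = 2\<close> nn_integral_Lp_norm_2 by (simp add: ennreal_leI)
      qed
      also have "\<dots> \<le> I d a" unfolding I_def by (intro SUP_upper point_mass)
      finally show ?case .
    qed
  qed
  have 2: "((\<lambda>a. liminf (\<lambda>d. I d a)) \<longlongrightarrow> (if p = 1 then 2 else \<infinity>)) at_bot"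
  proof (cases "p = 1")
    case True
    \<comment> \<open>The distance for \<open>p = 1\<close> never exceeds \<open>2\<close>, so this
      side of the squeeze holds for every \<open>a\<close>.\<close>
    have le2: "liminf (\<lambda>d. I d a) \<le> 2" for a
    proof -
      have "liminf (\<lambda>d. I d a) \<le> limsup (\<lambda>d. I d a)" by (rule Liminf_le_Limsup) simp
      also have "\<dots> \<le> ennreal 2"
      proof (rule Limsup_bounded)
        show "\<forall>\<^sub>F d in sequentially. I d a \<le> ennreal 2"
          using eventually_cutoff_time_pos[of a]
        proof eventually_elim
          case (elim d)
          show ?case
            unfolding I_def
          proof (rule SUP_least)
            fix \<xi> assume "\<xi> \<in> mass_functions (cube d)"
            then interpret cube_averaging "M d \<xi>" d \<xi> "\<eta> d \<xi>" "cutoff_time d a"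
              using process elim by simp
            show "J d a \<xi> \<le> ennreal 2"
              unfolding J_def True nn_integral_Lp_norm_1 by (rule ennreal_leI[OF expectation_tv_le])
          qed
        qed
      qed
      finally show ?thesis by simp
    qed
    have "(L \<longlongrightarrow> 2) at_bot"
      unfolding L_def[abs_def] using True by (simp, real_asymp)
    from tendsto_ennrealI[OF this] have L2: "((\<lambda>a. ennreal (L a)) \<longlongrightarrow> 2) at_bot" by simp
    have "((\<lambda>a. liminf (\<lambda>d. I d a)) \<longlongrightarrow> 2) at_bot"
      by (rule tendsto_sandwich[OF always_eventually always_eventually L2 tendsto_const])
        (rule allI, rule lower, rule allI, rule le2)
    then show ?thesis using True by simp
  next
    case False
    have "filterlim (\<lambda>a::real. exp (- (2 * a))) at_top at_bot" by real_asymp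
    then have "\<forall>\<^sub>F a in at_bot. l < L a" for l
      unfolding L_def using False by (simp add: filterlim_at_top_dense)
    then have "\<forall>\<^sub>F a in at_bot. ennreal l < liminf (\<lambda>d. I d a)" if "0 \<le> l" for l
    proof (rule eventually_mono)
      fix a assume "l < L a"
      then have "ennreal l < ennreal (L a)" using that by (simp add: ennreal_less_iff)
      then show "ennreal l < liminf (\<lambda>d. I d a)" using lower[of a] by (rule less_le_trans)
    qed
    then show ?thesis using False by (simp add: tendsto_top_iff_ennreal)
  qed
  show ?thesis using 1 2 unfolding I_def J_def by simp
qed

end
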